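(* Consider the primal-dual pair of semidefinite programs with data $(\mathcal{A},b,C)$ and Algorithm SSN described in the context. Let $(\bar\epsilon,\bar X,\bar y,\bar Z)$ be an accumulation point of the infinite sequence $\{(\epsilon^k,X^k,y^k,Z^k)\}$ generated by Algorithm SSN. Suppose that the primal constraint nondegeneracy condition holds at $\bar X$ and the dual constraint nondegeneracy condition holds at $(\bar y,\bar Z)$. Then the whole sequence $\{(\epsilon^k,X^k,y^k,Z^k)\}$ converges to $(\bar\epsilon,\bar X,\bar y,\bar Z)$ superlinearly, i.e., $$\|(\epsilon^{k+1}-\bar\epsilon,X^{k+1}-\bar X,y^{k+1}-\bar y,Z^{k+1}-\bar Z)\|=O\left(\|(\epsilon^k-\bar\epsilon,X^k-\bar X,y^k-\bar y,Z^k-\bar Z)\|^{1+\tau}\right),$$ where $\tau\in(0,1]$ is the parameter of the algorithm controlling the accuracy to which the Newton systems are solved.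
   Context: $\mathbb{S}^n$ is the space of real symmetric $n\times n$ matrices with trace inner product $\langle\cdot,\cdot\rangle$ and induced norm; $\mathbb{S}^n_+$, $\mathbb{S}^n_{++}$ are the cones of positive semidefinite and positive definite matrices. Data: $C\in\mathbb{S}^n$, $b\in\mathbb{R}^m$, and a linear map $\mathcal{A}:\mathbb{S}^n\to\mathbb{R}^m$, $\mathcal{A}X=(\langle A_1,X\rangle,\dots,\langle A_m,X\rangle)^T$ with $A_i\in\mathbb{S}^n$, with adjoint $\mathcal{A}^*y=\sum_i y_iA_i$. Primal problem: $\min\{\langle C,X\rangle:\mathcal{A}X=b,\ X\in\mathbb{S}^n_+\}$; dual problem: $\max\{\langle b,y\rangle:\mathcal{A}^*y+Z=C,\ Z\in\mathbb{S}^n_+\}$. Standing assumption: the primal problem has at least one optimal solution and there is $\tilde X\in\mathbb{S}^n_{++}$ with $\mathcal{A}\tilde X=b$. Nondegeneracy: $\mathcal{T}_{\mathbb{S}^n_+}(\cdot)$ is the tangent cone of $\mathbb{S}^n_+$ and $\mathrm{lin}(\cdot)$ the largest linear subspace contained in a cone. Primal constraint nondegeneracy holds at a primal feasible $\bar X$ if $\{(\mathcal{A}H,H):H\in\mathbb{S}^n\}+\{0\}\times\mathrm{lin}(\mathcal{T}_{\mathbb{S}^n_+}(\bar X))=\mathbb{R}^m\times\mathbb{S}^n$ (equivalently $\mathcal{A}\,\mathrm{lin}(\mathcal{T}_{\mathbb{S}^n_+}(\bar X))=\mathbb{R}^m$). Dual constraint nondegeneracy holds at a dual feasible $(\bar y,\bar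 Z)\in\mathbb{R}^m\times\mathbb{S}^n_+$ if $\{(\mathcal{A}^*y+S,S):y\in\mathbb{R}^m,S\in\mathbb{S}^n\}+\{0\}\times\mathrm{lin}(\mathcal{T}_{\mathbb{S}^n_+}(\bar Z))=\mathbb{S}^n\times\mathbb{S}^n$ (equivalently $\mathcal{A}^*\mathbb{R}^m+\mathrm{lin}(\mathcal{T}_{\mathbb{S}^n_+}(\bar Z))=\mathbb{S}^n$). Huber function: for $\epsilon\ne0$, $h(\epsilon,t)=t-|\epsilon|/2$ if $t>|\epsilon|$, $h(\epsilon,t)=t^2/(2|\epsilon|)$ if $0\le t\le|\epsilon|$, $h(\epsilon,t)=0$ if $t<0$; and $h(0,t)=\max\{0,t\}$. For $W\in\mathbb{S}^n$ with spectral decomposition $W=P\,\mathrm{diag}(d_1,\dots,d_n)P^T$, $\Phi(\epsilon,W):=P\,\mathrm{diag}(h(\epsilon,d_1),\dots,h(\epsilon,d_n))P^T$. Let $\mathbb{X}:=\mathbb{S}^n\times\mathbb{R}^m\times\mathbb{S}^n$ and let $\kappa_p>0,\kappa_c>0$ be given constants. Define $\mathcal{E}:\mathbb{R}\times\mathbb{X}\to\mathbb{R}^m\times\mathbb{S}^n\times\mathbb{S}^n$ by $$\mathcal{E}(\epsilon,X,y,Z)=\big(\mathcal{A}X+\kappa_p|\epsilon|y-b,\ -\mathcal{A}^*y-Z+C,\ (1+\kappa_c|\epsilon|)X-\Phi(\epsilon,X-Z)\big),$$ $\widehat{\mathcal{E}}(\epsilon,X,y,Z)=(\epsilon,\mathcal{E}(\epsilon,X,y,Z))$,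 and $\psi=\|\widehat{\mathcal{E}}\|^2$. $\mathcal{E}$ is continuously differentiable where $\epsilon\neq0$; $\mathcal{E}'$, $\widehat{\mathcal{E}}'$ denote derivatives and $\mathcal{E}'_\epsilon$ the partial derivative in $\epsilon$. Parameters: $\hat\epsilon\in(0,\infty)$, $r\in(0,1)$, $\hat r\in(0,\infty)$, $\hat\eta\in(0,1)$ with $\delta:=\sqrt2\max\{r\hat\epsilon,\hat\eta\}<1$, $\rho\in(0,1)$, $\sigma\in(0,1/2)$, $\tau\in(0,1]$. Define $\zeta(\epsilon,X,y,Z)=r\min\{1,\|\widehat{\mathcal{E}}(\epsilon,X,y,Z)\|^{1+\tau}\}$ and $\eta(\epsilon,X,y,Z)=\min\{1,\hat r\|\widehat{\mathcal{E}}(\epsilon,X,y,Z)\|^{\tau}\}$. Algorithm SSN (squared smoothing Newton method). Start with $\epsilon^0=\hat\epsilon$ and any $(X^0,y^0,Z^0)\in\mathbb{X}$. For $k\ge0$, write $w^k=(\epsilon^k,X^k,y^k,Z^k)$. If $\widehat{\mathcal{E}}(w^k)=0$, stop and output $w^k$. Otherwise: (1) set $\eta_k=\eta(w^k)$, $\zeta_k=\zeta(w^k)$; (2) set $\Delta\epsilon^k=-\epsilon^k+\zeta_k\hat\epsilon$ and compute $\Delta w^k=(\Delta\epsilon^k,\Delta X^k,\Delta y^k,\Delta Z^k)$ solving approximately $\widehat{\mathcal{E}}(w^k)+\widehat{\mathcal{E}}'(w^k)\Delta w^k=(\zeta_k\hat\epsilon,0,0,0)$, in the sense that the residual $\mathcal{R}_k:=\mathcal{E}(w^k)+\mathcal{E}'(w^k)\Delta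 w^k$ satisfies $$\|\mathcal{R}_k\|\le\min\{\eta_k\|\mathcal{E}(w^k)+\mathcal{E}'_\epsilon(w^k)\Delta\epsilon^k\|,\ \hat\eta\|\widehat{\mathcal{E}}(w^k)\|\};$$ (3) let $\ell_k$ be the smallest nonnegative integer $\ell$ with $\psi(w^k+\rho^\ell\Delta w^k)\le[1-2\sigma(1-\delta)\rho^\ell]\psi(w^k)$; (4) set $w^{k+1}=w^k+\rho^{\ell_k}\Delta w^k$. *)

theory Defs
  imports "HOL-Analysis.Analysis" "HOL-Library.Landau_Symbols"
begin

section \<open>The Euclidean space of symmetric matrices\<close>

typedef 'n symmat = "{A :: real ^ 'n ^ 'n. transpose A = A}"
  morphisms mat_of Symmat
  by (rule exI [of _ 0]) (simp add: transpose_def vec_eq_iff)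

setup_lifting type_definition_symmat

lemma transpose_mat_of [simp]: "transpose (mat_of X) = mat_of X"
  using mat_of [of X] by simp

lemma mat_of_sym: "mat_of X $ i $ j = mat_of X $ j $ i"
proof -
  have "transpose (mat_of X) $ j $ i = mat_of X $ j $ i" by simp
  then show ?thesis unfolding transpose_def by simp
qed

lemma trace_mat_of_mult: "trace (mat_of X ** mat_of Y) = mat_of X \<bullet> mat_of Y"
  unfolding trace_def matrix_matrix_mult_def inner_vec_def
  by (simp add: mat_of_sym [of Y])

instantiation symmat :: (finite) real_inner
begin

lift_definition zero_symmat :: "'a symmat" is 0
  by (simp add: transpose_def vec_eq_iff)

lift_definition plus_symmat :: "'a symmat \<Rightarrow> 'a symmat \<Rightarrow> 'a symmat" is "(+)"
  by (simp add: transpose_def vec_eq_iff)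

lift_definition minus_symmat :: "'a symmat \<Rightarrow> 'a symmat \<Rightarrow> 'a symmat" is "(-)"
  by (simp add: transpose_def vec_eq_iff)

lift_definition uminus_symmat :: "'a symmat \<Rightarrow> 'a symmat" is uminus
  by (simp add: transpose_def vec_eq_iff)

lift_definition scaleR_symmat :: "real \<Rightarrow> 'a symmat \<Rightarrow> 'a symmat" is scaleR
  by (simp add: transpose_def vec_eq_iff)

definition inner_symmat :: "'a symmat \<Rightarrow> 'a symmat \<Rightarrow> real"
  where "inner_symmat X Y = trace (mat_of X ** mat_of Y)"

definition norm_symmat :: "'a symmat \<Rightarrow> real"
  where "norm_symmat X = sqrt (inner X X)"

definition sgn_symmat :: "'a symmat \<Rightarrow> 'a symmat"
  where "sgn_symmat X = scaleR (inverse (norm X)) X"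

definition dist_symmat :: "'a symmat \<Rightarrow> 'a symmat \<Rightarrow> real"
  where "dist_symmat X Y = norm (X - Y)"

definition [code del]:
  "(uniformity :: ('a symmat \<times> 'a symmat) filter) = (INF e\<in>{0 <..}. principal {(X, Y). dist X Y < e})"

definition open_symmat :: "'a symmat set \<Rightarrow> bool"
  where [code del]: "open_symmat S = (\<forall>X\<in>S. \<forall>\<^sub>F (X', Y) in uniformity. X' = X \<longrightarrow> Y \<in> S)"

instance
proof
  fix a b :: real and X Y Z :: "'a symmat"
  show "X + Y + Z = X + (Y + Z)" by transfer simp
  show "X + Y = Y + X" by transfer simp
  show "0 + X = X" by transfer simp
  show "- X + X = 0" by transfer simp
  show "X - Y = X + - Y" by transfer simp
  show "a *\<^sub>R (X + Y) = a *\<^sub>R X + a *\<^sub>R Y" by transfer (simp add: scaleR_add_right)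
  show "(a + b) *\<^sub>R X = a *\<^sub>R X + b *\<^sub>R X" by transfer (simp add: scaleR_add_left)
  show "a *\<^sub>R b *\<^sub>R X = (a * b) *\<^sub>R X" by transfer simp
  show "1 *\<^sub>R X = X" by transfer simp
  show "dist X Y = norm (X - Y)" by (rule dist_symmat_def)
  show "sgn X = inverse (norm X) *\<^sub>R X" by (rule sgn_symmat_def)
  show "inner X Y = inner Y X" unfolding inner_symmat_def trace_mat_of_mult by (simp add: inner_commute)
  show "inner (X + Y) Z = inner X Z + inner Y Z"
    unfolding inner_symmat_def trace_mat_of_mult by (simp add: plus_symmat.rep_eq inner_add_left)
  show "inner (a *\<^sub>R X) Y = a * inner X Y"
    unfolding inner_symmat_def trace_mat_of_mult by (simp add: scaleR_symmat.rep_eq)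
  show "0 \<le> inner X X" unfolding inner_symmat_def trace_mat_of_mult by simp
  show "(inner X X = 0) = (X = 0)"
    unfolding inner_symmat_def trace_mat_of_mult by (simp add: zero_symmat.rep_eq flip: mat_of_inject)
  show "norm X = sqrt (inner X X)" by (rule norm_symmat_def)
qed (rule uniformity_symmat_def open_symmat_def)+

end

lemma inner_mat_of: "X \<bullet> Y = mat_of X \<bullet> mat_of Y" for X Y :: "('n::finite) symmat"
  by (simp add: inner_symmat_def trace_mat_of_mult)

lemma norm_mat_of: "norm (mat_of X) = norm X"
  by (simp add: norm_eq_sqrt_inner inner_mat_of)

lemma linear_mat_of: "linear mat_of"
  by (rule linearI) (simp_all add: plus_symmat.rep_eq scaleR_symmat.rep_eq)

instantiation symmat :: (finite) euclidean_space
begin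

lemma exists_orthonormal_symmat:
  "\<exists>B :: 'a symmat set. B \<noteq> {} \<and> finite B \<and>
     (\<forall>U\<in>B. \<forall>V\<in>B. inner U V = (if U = V then 1 else 0)) \<and>
     (\<forall>X. (\<forall>U\<in>B. inner X U = 0) \<longleftrightarrow> X = 0)"
proof -
  let ?S = "range (mat_of :: 'a symmat \<Rightarrow> _)"
  have S: "subspace ?S"
    by (intro linear_subspace_image linear_mat_of) simp
  obtain B where B: "B \<subseteq> ?S" "pairwise orthogonal B" "\<And>x. x \<in> B \<Longrightarrow> norm x = 1"
    "independent B" "span B = ?S"
    using orthonormal_basis_subspace [OF S] by metis
  have Sy: "mat_of (Symmat (mat 1 :: real^'a^'a)) = mat 1"
    by (rule Symmat_inverse) (simp add: transpose_mat)
  have "(mat 1 :: real^'a^'a) \<noteq> 0" by (simp add: vec_eq_iff mat_def)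
  then have "B \<noteq> {}"
    using B(5) Sy by (metis rangeI singletonD span_empty)
  have finB: "finite B" using B(4) by (rule independent_imp_finite)
  let ?B = "mat_of -` B"
  have im: "mat_of ` ?B = B" using B(1) by blast
  have inj: "inj (mat_of :: 'a symmat \<Rightarrow> _)" by (simp add: inj_def mat_of_inject)
  have 1: "?B \<noteq> {}" using im \<open>B \<noteq> {}\<close> by blast
  have 2: "finite ?B" by (rule finite_vimageI [OF finB inj])
  have 3: "inner U V = (if U = V then 1 else 0)" if "U \<in> ?B" "V \<in> ?B" for U V
  proof (cases "U = V")
    case True
    have "norm (mat_of U) = 1" using B(3) that by simp
    then show ?thesis using True by (simp add: inner_mat_of norm_eq_1)
  next
    case False
    then have "orthogonal (mat_of U) (mat_of V)"
      using B(2) that unfolding pairwise_def by (simp add: mat_of_inject)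
    then show ?thesis using False by (simp add: inner_mat_of orthogonal_def)
  qed
  have 4: "X = 0" if X: "\<forall>U\<in>?B. inner X U = 0" for X
  proof -
    have "orthogonal (mat_of X) (mat_of X)"
    proof (rule orthogonal_to_span)
      show "mat_of X \<in> span B" using B(5) by simp
      fix V assume "V \<in> B"
      then obtain U where "V = mat_of U" "U \<in> ?B" using im by blast
      then show "orthogonal (mat_of X) V"
        using X by (simp add: inner_mat_of orthogonal_def)
    qed
    then show "X = 0"
      by (simp add: orthogonal_def zero_symmat.rep_eq flip: mat_of_inject)
  qed
  show ?thesis
    by (rule exI [of _ ?B]) (use 1 2 3 4 in auto)
qed

definition Basis_symmat :: "'a symmat set"
  where "Basis_symmat = (SOME B. B \<noteq> {} \<and> finite B \<and>
     (\<forall>U\<in>B. \<forall>V\<in>B. inner U V = (if U = V then 1 else 0)) \<and>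
     (\<forall>X. (\<forall>U\<in>B. inner X U = 0) \<longleftrightarrow> X = 0))"

instance
  by standard (use someI_ex [OF exists_orthonormal_symmat, folded Basis_symmat_def] in auto)

end

definition psd :: "('n::finite) symmat set"
  where "psd = {X. \<forall>v. 0 \<le> v \<bullet> (mat_of X *v v)}"

definition pd :: "('n::finite) symmat set"
  where "pd = {X. \<forall>v. v \<noteq> 0 \<longrightarrow> 0 < v \<bullet> (mat_of X *v v)}"


section \<open>Spectral functions\<close>

definition diag_mat :: "real ^ 'n::finite \<Rightarrow> real ^ 'n ^ 'n"
  where "diag_mat d = (\<chi> i j. if i = j then d $ i else 0)"

definition is_spectral_image :: "(real \<Rightarrow> real) \<Rightarrow> ('n::finite) symmat \<Rightarrow> 'n symmat \<Rightarrow> bool"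
  where "is_spectral_image f W V \<longleftrightarrow>
    (\<exists>P d. orthogonal_matrix P \<and> mat_of W = P ** diag_mat d ** transpose P \<and>
       mat_of V = P ** diag_mat (\<chi> i. f (d $ i)) ** transpose P)"

text \<open>The image is determined by \<open>W\<close> although \<open>P\<close> and \<open>d\<close> are not:
  see \<open>is_spectral_image_unique\<close> and, for existence, \<open>spectral_fun_eq\<close> below.\<close>

definition spectral_fun :: "(real \<Rightarrow> real) \<Rightarrow> ('n::finite) symmat \<Rightarrow> 'n symmat"
  where "spectral_fun f W = (THE V. is_spectral_image f W V)"

lemma is_spectral_image_unique:
  assumes "is_spectral_image f W V" "is_spectral_image f W V'"
  shows "V = V'"
proof -
  obtain P d where P: "orthogonal_matrix P" "mat_of W = P ** diag_mat d ** transpose P"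
    "mat_of V = P ** diag_mat (\<chi> i. f (d $ i)) ** transpose P"
    using assms(1) unfolding is_spectral_image_def by blast
  obtain Q e where Q: "orthogonal_matrix Q" "mat_of W = Q ** diag_mat e ** transpose Q"
    "mat_of V' = Q ** diag_mat (\<chi> i. f (e $ i)) ** transpose Q"
    using assms(2) unfolding is_spectral_image_def by blast
  have PP: "transpose P ** P = mat 1" "P ** transpose P = mat 1"
    and QQ: "transpose Q ** Q = mat 1" "Q ** transpose Q = mat 1"
    using P(1) Q(1) by (auto simp: orthogonal_matrix_def)
  define R where "R = transpose Q ** P"
  have R: "Q ** R = P" "R ** transpose P = transpose Q"
    unfolding R_def using PP QQ by (metis matrix_mul_assoc matrix_mul_lid matrix_mul_rid)+
  have mulr: "(R ** diag_mat x) $ i $ j = R $ i $ j * x $ j" for x i j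
    by (simp add: matrix_matrix_mult_def diag_mat_def if_distrib cong: if_cong)
  have mull: "(diag_mat x ** R) $ i $ j = x $ i * R $ i $ j" for x i j
    by (simp add: matrix_matrix_mult_def diag_mat_def if_distrib if_distribR cong: if_cong)
  have "R ** diag_mat d = transpose Q ** mat_of W ** P"
    unfolding P(2) R_def using PP by (simp flip: matrix_mul_assoc)
  also have "\<dots> = diag_mat e ** R"
    unfolding Q(2) R_def using QQ by (simp add: matrix_mul_assoc)
  finally have "R $ i $ j * d $ j = e $ i * R $ i $ j" for i j
    by (metis mulr mull)
  then have "R $ i $ j = 0 \<or> d $ j = e $ i" for i j by (simp add: mult.commute)
  then have eq: "R ** diag_mat (\<chi> i. f (d $ i)) = diag_mat (\<chi> i. f (e $ i)) ** R"
    unfolding vec_eq_iff mulr mull by (metis mult.commute mult_zero_left vec_lambda_beta)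
  have "mat_of V = Q ** (R ** diag_mat (\<chi> i. f (d $ i))) ** transpose P"
    using P(3) R(1) by (simp add: matrix_mul_assoc)
  also have "\<dots> = mat_of V'"
    unfolding eq Q(3) by (metis R(2) matrix_mul_assoc)
  finally show ?thesis by (simp add: mat_of_inject)
qed

lemma orthonormal_eigenbasis:
  fixes M :: "real ^ 'n::finite ^ 'n"
  assumes M: "transpose M = M" and S: "subspace S" "(*v) M ` S \<subseteq> S"
  shows "\<exists>B. finite B \<and> B \<subseteq> S \<and> span B = S \<and> pairwise orthogonal B \<and>
     (\<forall>v\<in>B. norm v = 1 \<and> (\<exists>c. M *v v = c *\<^sub>R v))"
  using S
proof (induction "dim S" arbitrary: S rule: less_induct)
  case less
  have sym: "u \<bullet> (M *v v) = (M *v u) \<bullet> v" for u v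
    by (metis M dot_lmul_matrix vector_transpose_matrix)
  show ?case
  proof (cases "S = {0}")
    case True
    then show ?thesis by (intro exI [of _ "{}"]) auto
  next
    case False
    let ?K = "S \<inter> sphere 0 1"
    obtain x where x: "x \<in> S" "x \<noteq> 0" using False less.prems(1) subspace_0 by blast
    then have "x /\<^sub>R norm x \<in> ?K" using less.prems(1) by (simp add: subspace_scale)
    then have "?K \<noteq> {}" by blast
    moreover have "compact ?K"
      using closed_Int_compact [OF closed_subspace [OF less.prems(1)] compact_sphere] .
    moreover have "continuous_on ?K (\<lambda>x. x \<bullet> (M *v x))"
      by (intro continuous_intros linear_continuous_on_compose [OF continuous_on_id] matrix_vector_mul_linear)
    ultimately obtain v where v: "v \<in> ?K" "\<forall>y\<in>?K. y \<bullet> (M *v y) \<le> v \<bullet> (M *v v)"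
      using continuous_attains_sup by blast
    define c where "c = v \<bullet> (M *v v)"
    have vS: "v \<in> S" and nv: "norm v = 1" using v(1) by auto
    have pos: "0 \<le> c * (y \<bullet> y) - y \<bullet> (M *v y)" if "y \<in> S" for y
    proof (cases "y = 0")
      case False
      have "y /\<^sub>R norm y \<in> ?K" using that False less.prems(1) by (simp add: subspace_scale)
      then have "(y /\<^sub>R norm y) \<bullet> (M *v (y /\<^sub>R norm y)) \<le> c" using v(2) c_def by blast
      then have "(y \<bullet> (M *v y)) / (norm y)\<^sup>2 \<le> c"
        by (simp add: matrix_vector_mult_scaleR power2_eq_square divide_inverse mult_ac)
      then show ?thesis using False
        by (simp add: divide_le_eq dot_square_norm)
    qed simp
    define z where "z = c *\<^sub>R v - M *v v"
    have zS: "z \<in> S"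
      unfolding z_def using vS less.prems by (auto intro!: subspace_diff subspace_scale)
    have vv: "v \<bullet> v = 1" using nv by (simp add: norm_eq_1)
    have "z \<bullet> z = 0"
    proof (rule ccontr)
      assume "z \<bullet> z \<noteq> 0"
      define q where "q = c * (z \<bullet> z) - z \<bullet> (M *v z)"
      have q: "0 \<le> 2 * t * (z \<bullet> z) + t\<^sup>2 * q" for t
      proof -
        have "v + t *\<^sub>R z \<in> S" using vS zS less.prems(1) by (simp add: subspace_add subspace_scale)
        then have "0 \<le> c * ((v + t *\<^sub>R z) \<bullet> (v + t *\<^sub>R z)) - (v + t *\<^sub>R z) \<bullet> (M *v (v + t *\<^sub>R z))"
          by (rule pos)
        also have "\<dots> = 2 * t * (c * (v \<bullet> z) - (M *v v) \<bullet> z) + t\<^sup>2 * q"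
          using vv sym [of v z]
          by (simp add: q_def c_def [symmetric] matrix_vector_right_distrib matrix_vector_mult_scaleR
              inner_add_left inner_add_right inner_commute power2_eq_square algebra_simps)
        also have "c * (v \<bullet> z) - (M *v v) \<bullet> z = z \<bullet> z"
          unfolding z_def by (simp add: inner_diff_left)
        finally show ?thesis .
      qed
      have q0: "0 \<le> q" using pos [OF zS] by (simp add: q_def)
      have zz: "0 < z \<bullet> z" using \<open>z \<bullet> z \<noteq> 0\<close> by (metis inner_gt_zero_iff inner_zero_left)
      show False
      proof -
        define s where "s = 1 / (q + 1)"
        have s: "0 < s" "s * q = 1 - s" using q0 by (simp_all add: s_def field_simps)
        let ?t = "- s * (z \<bullet> z)"
        have "2 * ?t * (z \<bullet> z) + ?t\<^sup>2 * q = s * (z \<bullet> z)\<^sup>2 * (s * q - 2)"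
          by (simp add: power2_eq_square algebra_simps)
        also have "\<dots> < 0" using s zz
          by (intro mult_pos_neg mult_pos_pos zero_less_power) auto
        finally show False using q [of ?t] by linarith
      qed
    qed
    then have ev: "M *v v = c *\<^sub>R v" by (simp add: z_def)
    define T where "T = {y \<in> S. v \<bullet> y = 0}"
    have T: "subspace T"
      using less.prems(1) unfolding T_def subspace_def by (auto simp: inner_add_right)
    have MT: "(*v) M ` T \<subseteq> T"
      using less.prems(2) by (auto simp: T_def sym ev)
    have "v \<notin> T" using vv by (simp add: T_def)
    then have "T \<subset> S" using vS T_def by blast
    then have "dim T < dim S"
      by (metis T dim_psubset less.prems(1) span_eq_iff)
    from less.hyps [OF this T MT] obtain B where B: "finite B" "B \<subseteq> T" "span B = T"
      "pairwise orthogonal B" "\<forall>v\<in>B. norm v = 1 \<and> (\<exists>c. M *v v = c *\<^sub>R v)" by blast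
    have "span (insert v B) = S"
    proof
      show "span (insert v B) \<subseteq> S"
        using B(2) vS less.prems(1) by (intro span_minimal) (auto simp: T_def)
      show "S \<subseteq> span (insert v B)"
      proof
        fix y assume y: "y \<in> S"
        have "y - (v \<bullet> y) *\<^sub>R v \<in> T"
          using y vS less.prems(1) vv by (simp add: T_def subspace_diff subspace_scale inner_diff_right)
        then show "y \<in> span (insert v B)" unfolding B(3) [symmetric]
          by (auto simp: span_insert)
      qed
    qed
    moreover have "pairwise orthogonal (insert v B)"
      using B(2,4) by (auto simp: pairwise_insert orthogonal_def T_def inner_commute)
    ultimately show ?thesis
      using B nv ev vS by (intro exI [of _ "insert v B"]) (auto simp: T_def)
  qed
qed

lemma spectral_decomposition:
  fixes W :: "('n::finite) symmat"
  obtains P d where "orthogonal_matrix P" "mat_of W = P ** diag_mat d ** transpose P"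
proof -
  obtain B where B: "finite B" "span B = (UNIV :: (real^'n) set)" "pairwise orthogonal B"
    "\<forall>v\<in>B. norm v = 1 \<and> (\<exists>c. mat_of W *v v = c *\<^sub>R v)"
    using orthonormal_eigenbasis [of "mat_of W" UNIV] by auto
  have "0 \<notin> B" using B(4) by fastforce
  then have "independent B" using B(3) by (rule pairwise_orthogonal_independent [rotated])
  then have "card B = CARD('n)"
    using dim_eq_card [of B UNIV] B(2) by simp
  then obtain p where p: "bij_betw p (UNIV :: 'n set) B"
    using B(1) by (metis finite_same_card_bij finite)
  then have pB: "p i \<in> B" for i by (auto simp: bij_betw_def)
  from B(4) obtain g where g: "\<And>v. v \<in> B \<Longrightarrow> mat_of W *v v = g v *\<^sub>R v" by metis
  define P where "P = (\<chi> i j. p j $ i)"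
  define d where "d = (\<chi> j. g (p j))"
  have col: "column j P = p j" for j by (simp add: column_def P_def vec_eq_iff)
  have P: "orthogonal_matrix P"
    unfolding orthogonal_matrix_orthonormal_columns col
  proof (intro conjI allI impI)
    show "norm (p i) = 1" for i using B(4) pB by blast
    show "orthogonal (p i) (p j)" if "i \<noteq> j" for i j
      using B(3) pB that p by (metis bij_betw_def injD pairwiseD)
  qed
  have "mat_of W ** P = P ** diag_mat d"
  proof -
    have "(mat_of W ** P) $ i $ j = (P ** diag_mat d) $ i $ j" for i j
    proof -
      have "(mat_of W ** P) $ i $ j = (mat_of W *v p j) $ i"
        by (simp add: matrix_matrix_mult_def matrix_vector_mult_def P_def)
      also have "\<dots> = (P ** diag_mat d) $ i $ j"
        by (simp add: g [OF pB] matrix_matrix_mult_def diag_mat_def P_def d_def if_distrib cong: if_cong)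
      finally show ?thesis .
    qed
    then show ?thesis by (simp add: vec_eq_iff)
  qed
  then have "mat_of W = P ** diag_mat d ** transpose P"
    using P by (metis matrix_mul_assoc matrix_mul_rid orthogonal_matrix_def)
  with P that show thesis by blast
qed

lemma spectral_fun_eq:
  assumes "orthogonal_matrix P" "mat_of W = P ** diag_mat d ** transpose P"
  shows "mat_of (spectral_fun f W) = P ** diag_mat (\<chi> i. f (d $ i)) ** transpose P"
proof -
  let ?V = "P ** diag_mat (\<chi> i. f (d $ i)) ** transpose P"
  have "transpose (diag_mat x) = diag_mat x" for x :: "real^'a"
    by (simp add: diag_mat_def transpose_def vec_eq_iff)
  then have "transpose ?V = ?V"
    by (simp add: matrix_transpose_mul matrix_mul_assoc)
  then have V: "mat_of (Symmat ?V) = ?V" by (simp add: Symmat_inverse)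
  then have "is_spectral_image f W (Symmat ?V)"
    unfolding is_spectral_image_def using assms by blast
  then have "spectral_fun f W = Symmat ?V"
    unfolding spectral_fun_def by (blast intro: is_spectral_image_unique)
  with V show ?thesis by simp
qed

definition huber :: "real \<Rightarrow> real \<Rightarrow> real"
  where "huber e t =
    (if e = 0 then max 0 t
     else if t > \<bar>e\<bar> then t - \<bar>e\<bar> / 2
     else if 0 \<le> t then t\<^sup>2 / (2 * \<bar>e\<bar>)
     else 0)"

definition Phi :: "real \<Rightarrow> ('n::finite) symmat \<Rightarrow> 'n symmat"
  where "Phi e W = spectral_fun (huber e) W"


section \<open>Semidefinite programs and constraint nondegeneracy\<close>

definition op_A :: "(('m::finite) \<Rightarrow> ('n::finite) symmat) \<Rightarrow> 'n symmat \<Rightarrow> real ^ 'm"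
  where "op_A A X = (\<chi> i. A i \<bullet> X)"

definition op_A_adj :: "(('m::finite) \<Rightarrow> ('n::finite) symmat) \<Rightarrow> real ^ 'm \<Rightarrow> 'n symmat"
  where "op_A_adj A y = (\<Sum>i\<in>UNIV. y $ i *\<^sub>R A i)"

lemma adjoint_op_A: "adjoint (op_A A) = op_A_adj A"
  by (rule adjoint_unique)
    (simp add: op_A_def op_A_adj_def inner_vec_def inner_sum_right inner_commute mult.commute)

definition primal_feasible :: "(('m::finite) \<Rightarrow> ('n::finite) symmat) \<Rightarrow> real ^ 'm \<Rightarrow> 'n symmat \<Rightarrow> bool"
  where "primal_feasible A b X \<longleftrightarrow> op_A A X = b \<and> X \<in> psd"

definition primal_optimal :: "(('m::finite) \<Rightarrow> ('n::finite) symmat) \<Rightarrow> real ^ 'm \<Rightarrow> 'n symmat \<Rightarrow> 'n symmat \<Rightarrow> bool"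
  where "primal_optimal A b C X \<longleftrightarrow> is_arg_min (\<lambda>X. C \<bullet> X) (primal_feasible A b) X"

text \<open>The contingent cone; empty if \<open>x\<close> does not lie in the closure of \<open>K\<close>.\<close>

definition tangent_cone :: "'a::real_normed_vector set \<Rightarrow> 'a \<Rightarrow> 'a set"
  where "tangent_cone K x =
    {d. \<exists>ds t. (\<forall>k::nat. 0 < t k \<and> x + t k *\<^sub>R ds k \<in> K) \<and> t \<longlonglongrightarrow> 0 \<and> ds \<longlonglongrightarrow> d}"

text \<open>Meaningful when a largest linear subspace exists, in particular for every convex cone
  containing 0 (where it is \<open>K \<inter> - K\<close>), such as the tangent cone to a convex set at one of its points.\<close>

definition lin :: "'a::real_vector set \<Rightarrow> 'a set"
  where "lin K = (GREATEST S. subspace S \<and> S \<subseteq> K)"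

text \<open>Both conditions are meant at feasible points. Dual nondegeneracy at \<open>(y, Z)\<close> depends on \<open>Z\<close> only.\<close>

definition primal_nondegenerate :: "(('m::finite) \<Rightarrow> ('n::finite) symmat) \<Rightarrow> 'n symmat \<Rightarrow> bool"
  where "primal_nondegenerate A X \<longleftrightarrow>
    {(op_A A H, H) | H. True} + {0} \<times> lin (tangent_cone psd X) = UNIV"

definition dual_nondegenerate :: "(('m::finite) \<Rightarrow> ('n::finite) symmat) \<Rightarrow> 'n symmat \<Rightarrow> bool"
  where "dual_nondegenerate A Z \<longleftrightarrow>
    {(op_A_adj A y + S, S) | y S. True} + {0} \<times> lin (tangent_cone psd Z) = UNIV"


section \<open>The squared smoothing Newton method\<close>

text \<open>The suffix \<open>h\<close> stands for a hat: \<open>eh\<close>, \<open>rh\<close> and \<open>\<eta>h\<close> are the constants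
  \<open>\<epsilon>\<close>-hat (initial smoothing parameter), \<open>r\<close>-hat and \<open>\<eta>\<close>-hat.\<close>

type_synonym ('m, 'n) point = "real \<times> 'n symmat \<times> (real ^ 'm) \<times> 'n symmat"

definition E_map :: "(('m::finite) \<Rightarrow> ('n::finite) symmat) \<Rightarrow> real ^ 'm \<Rightarrow> 'n symmat \<Rightarrow> real \<Rightarrow> real \<Rightarrow>
    ('m, 'n) point \<Rightarrow> (real ^ 'm) \<times> 'n symmat \<times> 'n symmat"
  where "E_map A b C \<kappa>p \<kappa>c = (\<lambda>(e, X, y, Z).
    (op_A A X + (\<kappa>p * \<bar>e\<bar>) *\<^sub>R y - b,
     - op_A_adj A y - Z + C,
     (1 + \<kappa>c * \<bar>e\<bar>) *\<^sub>R X - Phi e (X - Z)))"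

definition E_hat :: "(('m::finite) \<Rightarrow> ('n::finite) symmat) \<Rightarrow> real ^ 'm \<Rightarrow> 'n symmat \<Rightarrow> real \<Rightarrow> real \<Rightarrow>
    ('m, 'n) point \<Rightarrow> real \<times> (real ^ 'm) \<times> 'n symmat \<times> 'n symmat"
  where "E_hat A b C \<kappa>p \<kappa>c w = (fst w, E_map A b C \<kappa>p \<kappa>c w)"

definition merit :: "(('m::finite) \<Rightarrow> ('n::finite) symmat) \<Rightarrow> real ^ 'm \<Rightarrow> 'n symmat \<Rightarrow> real \<Rightarrow> real \<Rightarrow>
    ('m, 'n) point \<Rightarrow> real"
  where "merit A b C \<kappa>p \<kappa>c w = (norm (E_hat A b C \<kappa>p \<kappa>c w))\<^sup>2"

definition E_map_eps_deriv :: "(('m::finite) \<Rightarrow> ('n::finite) symmat) \<Rightarrow> real ^ 'm \<Rightarrow> 'n symmat \<Rightarrow> real \<Rightarrow> real \<Rightarrow>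
    ('m, 'n) point \<Rightarrow> (real ^ 'm) \<times> 'n symmat \<times> 'n symmat"
  where "E_map_eps_deriv A b C \<kappa>p \<kappa>c w =
    vector_derivative (\<lambda>e. E_map A b C \<kappa>p \<kappa>c (e, snd w)) (at (fst w))"

text \<open>In the next two definitions \<open>x\<close> stands for \<open>norm (E_hat \<dots> w)\<close>.\<close>

definition zeta :: "real \<Rightarrow> real \<Rightarrow> real \<Rightarrow> real"
  where "zeta r \<tau> x = r * min 1 (x powr (1 + \<tau>))"

definition eta :: "real \<Rightarrow> real \<Rightarrow> real \<Rightarrow> real"
  where "eta rh \<tau> x = min 1 (rh * x powr \<tau>)"

definition inexact_newton_direction ::
    "(('m::finite) \<Rightarrow> ('n::finite) symmat) \<Rightarrow> real ^ 'm \<Rightarrow> 'n symmat \<Rightarrow> real \<Rightarrow> real \<Rightarrow>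
     real \<Rightarrow> real \<Rightarrow> real \<Rightarrow> real \<Rightarrow> real \<Rightarrow> ('m, 'n) point \<Rightarrow> ('m, 'n) point \<Rightarrow> bool"
  where "inexact_newton_direction A b C \<kappa>p \<kappa>c eh r rh \<eta>h \<tau> w dw \<longleftrightarrow>
    (let F = E_map A b C \<kappa>p \<kappa>c;
         n = norm (E_hat A b C \<kappa>p \<kappa>c w);
         R = F w + frechet_derivative F (at w) dw
     in fst dw = - fst w + zeta r \<tau> n * eh \<and>
        norm R \<le> min (eta rh \<tau> n * norm (F w + fst dw *\<^sub>R E_map_eps_deriv A b C \<kappa>p \<kappa>c w)) (\<eta>h * n))"

definition line_search_accepts ::
    "(('m::finite) \<Rightarrow> ('n::finite) symmat) \<Rightarrow> real ^ 'm \<Rightarrow> 'n symmat \<Rightarrow> real \<Rightarrow> real \<Rightarrow>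
     real \<Rightarrow> real \<Rightarrow> real \<Rightarrow> ('m, 'n) point \<Rightarrow> ('m, 'n) point \<Rightarrow> nat \<Rightarrow> bool"
  where "line_search_accepts A b C \<kappa>p \<kappa>c \<rho> \<sigma> \<delta> w dw l \<longleftrightarrow>
    merit A b C \<kappa>p \<kappa>c (w + \<rho> ^ l *\<^sub>R dw)
      \<le> (1 - 2 * \<sigma> * (1 - \<delta>) * \<rho> ^ l) * merit A b C \<kappa>p \<kappa>c w"

text \<open>An infinite run: the stopping test \<open>E_hat = 0\<close> never succeeds and every line search terminates.\<close>

definition ssn_sequence ::
    "(('m::finite) \<Rightarrow> ('n::finite) symmat) \<Rightarrow> real ^ 'm \<Rightarrow> 'n symmat \<Rightarrow> real \<Rightarrow> real \<Rightarrow>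
     real \<Rightarrow> real \<Rightarrow> real \<Rightarrow> real \<Rightarrow> real \<Rightarrow> real \<Rightarrow> real \<Rightarrow> (nat \<Rightarrow> ('m, 'n) point) \<Rightarrow> bool"
  where "ssn_sequence A b C \<kappa>p \<kappa>c eh r rh \<eta>h \<rho> \<sigma> \<tau> w \<longleftrightarrow>
    (let \<delta> = sqrt 2 * max (r * eh) \<eta>h in
     fst (w 0) = eh \<and>
     (\<forall>k. E_hat A b C \<kappa>p \<kappa>c (w k) \<noteq> 0 \<and>
      (\<exists>dw l. inexact_newton_direction A b C \<kappa>p \<kappa>c eh r rh \<eta>h \<tau> (w k) dw \<and>
         line_search_accepts A b C \<kappa>p \<kappa>c \<rho> \<sigma> \<delta> (w k) dw l \<and>
         (\<forall>j<l. \<not> line_search_accepts A b C \<kappa>p \<kappa>c \<rho> \<sigma> \<delta> (w k) dw j) \<and>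
         w (Suc k) = w k + \<rho> ^ l *\<^sub>R dw)))"

end

theory Submission
  imports Defs
begin

text \<open>For \<open>\<epsilon> > 0\<close> the map \<open>E_hat\<close> is continuously differentiable, and the iterates keep \<open>\<epsilon>\<^sub>k > 0\<close>.
The theorem is thus a question about \<open>E_hat\<close> and its Jacobian in the half space \<open>\<epsilon> > 0\<close>, close to the
accumulation point \<open>w\<close>.

One identity gives control of the smoothing function \<open>Phi\<close>. If \<open>V = P diag(d) P\<^sup>T\<close> and
\<open>W = Q diag(e) Q\<^sup>T\<close>, then \<open>P\<^sup>T (f(V) - f(W)) Q\<close> is the entrywise product of the matrix of divided
differences \<open>f[d\<^sub>i, e\<^sub>j]\<close> with \<open>P\<^sup>T (V - W) Q\<close> (lemma \<open>spectral_fun_diff\<close>). The operator that performs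
this multiplication does not depend on the decompositions chosen, and it is jointly continuous in \<open>V\<close>,
\<open>W\<close> and the function of two variables, because the orthogonal matrices form a compact set. Continuity
gives the derivative of \<open>Phi\<close> at \<open>\<epsilon> > 0\<close> and the continuity of that derivative; the bounds
\<open>0 \<le> f[x, y] \<le> 1\<close>, valid for the Huber function, give Lipschitz continuity of \<open>Phi\<close> up to \<open>\<epsilon> = 0\<close>.

\<^bold>\<open>The accumulation point is a solution\<close> (\<open>accumulation_point_solves\<close>). The merit function decreases. If its
limit were positive, then so would be \<open>\<epsilon>\<close> at \<open>w\<close>, because \<open>\<epsilon>\<^sub>k\<close> stays above a quantity that is
monotone in the merit function. At \<open>\<epsilon> > 0\<close> the regularization terms make the Jacobian nonsingular.
Near \<open>w\<close> the directions are therefore bounded and a fixed step length is accepted, so that infinitely many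
steps shrink the merit function by a fixed factor, a contradiction.

\<^bold>\<open>The local rate.\<close> Hence \<open>\<epsilon> = 0\<close> at \<open>w\<close>, where \<open>E_hat\<close> need not be differentiable. Two facts replace
differentiability. First, the inverse Jacobians are bounded on the part \<open>\<epsilon> > 0\<close> of a neighbourhood of \<open>w\<close>
(\<open>J_invertible_near_solution\<close>): otherwise unit vectors that the Jacobians almost annihilate would converge
to a nonzero solution of a limiting linear system, and primal and dual nondegeneracy exclude this. Second,
the error of the linearization, taken at the nearby point and evaluated at \<open>w\<close>, is quadratic in the distance
(\<open>Phi_strongly_semismooth\<close>). Together they bound the error after a full inexact Newton step by a constant
times the power \<open>1 + \<tau>\<close> of the error before it. As the norm of \<open>E_hat\<close> is comparable to the distance from
\<open>w\<close>, the full step passes the line search close to \<open>w\<close>; an iterate that gets there is therefore followed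
by full steps only, and these at least halve the error.\<close>

section \<open>The Huber function and its divided differences\<close>

text \<open>For \<open>e > 0\<close> this is the derivative of \<open>huber e\<close> at \<open>t\<close>. It is also the maximizer in the representation
\<open>huber e t = max {s t - e s\<^sup>2 / 2 | s \<in> [0, 1]}\<close>, which holds for all \<open>e \<ge> 0\<close> and replaces the case
distinction in what follows: the upper bound is \<open>huber_ge\<close>, attainment is \<open>huber_slope\<close>.\<close>

definition slope :: "real \<Rightarrow> real \<Rightarrow> real"
  where "slope e t = (if e = 0 then (if t > 0 then 1 else 0) else max 0 (min 1 (t / e)))"

lemma slope_range: "0 \<le> slope e t" "slope e t \<le> 1"
  by (auto simp: slope_def)

lemma huber_slope: "0 \<le> e \<Longrightarrow> huber e t = slope e t * t - e * (slope e t)\<^sup>2 / 2"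
  by (auto simp: huber_def slope_def field_simps power2_eq_square max_def min_def)

lemma huber_ge:
  assumes "0 \<le> e" "0 \<le> s" "s \<le> 1"
  shows "s * t - e * s\<^sup>2 / 2 \<le> huber e t"
proof (cases "e = 0")
  case True
  then show ?thesis using assms
    by (auto simp: huber_def max_def mult_left_le_one_le mult_nonneg_nonpos)
next
  case False
  then have e: "0 < e" using assms by simp
  have "0 \<le> e * (s - t / e)\<^sup>2" using e by simp
  also have "\<dots> = 2 * (t\<^sup>2 / (2 * e) - (s * t - e * s\<^sup>2 / 2))"
    using e by (simp add: field_simps power2_eq_square)
  finally have mid: "s * t - e * s\<^sup>2 / 2 \<le> t\<^sup>2 / (2 * e)" by simp
  have hi: "s * t - e * s\<^sup>2 / 2 \<le> t - e / 2" if "e < t"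
  proof -
    have "e * (1 - s\<^sup>2) / 2 = (1 - s) * (e * (1 + s) / 2)" by (simp add: field_simps power2_eq_square)
    also have "\<dots> \<le> (1 - s) * t"
    proof (rule mult_left_mono)
      have "e * (1 + s) \<le> e * 2" using e assms by (intro mult_left_mono) auto
      then show "e * (1 + s) / 2 \<le> t" using that by simp
    qed (use assms in simp)
    finally show ?thesis by (simp add: field_simps)
  qed
  have lo: "s * t - e * s\<^sup>2 / 2 \<le> 0" if "t < 0"
    using mult_nonneg_nonpos [OF assms(2) less_imp_le [OF that]] mult_nonneg_nonneg [OF assms(1) zero_le_power2 [of s]] by linarith
  show ?thesis using mid hi lo e False by (auto simp: huber_def)
qed

text \<open>As a maximum of functions that are linear in \<open>(e, t)\<close>, the Huber function lies above its
linearization, whose coefficients are \<open>slope\<close> and \<open>- slope\<^sup>2 / 2\<close>. Used at both end points this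
encloses every difference quotient between values of the derivative.\<close>

lemma huber_diff_ge:
  assumes "0 \<le> e" "0 \<le> e'"
  shows "slope e t * (t' - t) - (slope e t)\<^sup>2 / 2 * (e' - e) \<le> huber e' t' - huber e t"
  using huber_ge [OF assms(2) slope_range [of e t], of t'] huber_slope [OF assms(1), of t]
  by (simp add: field_simps)

text \<open>The divided differences in \<open>t\<close> and in \<open>e\<close>, with the derivatives as values on the diagonal.\<close>

definition huber_dd :: "real \<Rightarrow> real \<Rightarrow> real \<Rightarrow> real"
  where "huber_dd e a b = (if a = b then slope e a else (huber e a - huber e b) / (a - b))"

definition eps_dd :: "real \<Rightarrow> real \<Rightarrow> real \<Rightarrow> real"
  where "eps_dd e e' t = (if e = e' then - (slope e t)\<^sup>2 / 2 else (huber e t - huber e' t) / (e - e'))"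

lemma huber_dd_mult: "huber e a - huber e b = huber_dd e a b * (a - b)"
  by (simp add: huber_dd_def)

lemma eps_dd_mult: "huber e t - huber e' t = eps_dd e e' t * (e - e')"
  by (simp add: eps_dd_def)

lemma huber_dd_commute: "huber_dd e a b = huber_dd e b a"
  by (auto simp: huber_dd_def) (metis minus_diff_eq minus_divide_divide)

lemma eps_dd_commute: "eps_dd e e' t = eps_dd e' e t"
  by (auto simp: eps_dd_def) (metis minus_diff_eq minus_divide_divide)

lemma huber_dd_between:
  assumes "0 \<le> e"
  shows "min (slope e a) (slope e b) \<le> huber_dd e a b" "huber_dd e a b \<le> max (slope e a) (slope e b)"
proof -
  have *: "slope e x \<le> huber_dd e x y \<and> huber_dd e x y \<le> slope e y" if "x < y" for x y
    using huber_diff_ge [OF assms assms, of x y] huber_diff_ge [OF assms assms, of y x] that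
    by (auto simp: huber_dd_commute [of e x y] huber_dd_def field_simps)
  have "min (slope e a) (slope e b) \<le> huber_dd e a b \<and> huber_dd e a b \<le> max (slope e a) (slope e b)"
    using * [of a b] * [of b a] huber_dd_commute [of e a b]
    by (cases a b rule: linorder_cases) (auto simp: huber_dd_def)
  then show "min (slope e a) (slope e b) \<le> huber_dd e a b" "huber_dd e a b \<le> max (slope e a) (slope e b)"
    by auto
qed

lemma huber_dd_range:
  assumes "0 \<le> e" shows "0 \<le> huber_dd e a b" "huber_dd e a b \<le> 1"
  using huber_dd_between [OF assms, of a b] slope_range [of e a] slope_range [of e b] by linarith+

text \<open>The argument for \<open>huber_dd_between\<close>, now in the smoothing parameter: the derivative of
\<open>\<lambda>e. huber e t\<close> is \<open>- slope\<^sup>2 / 2\<close>.\<close>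

lemma eps_dd_between:
  assumes "0 \<le> e" "0 \<le> e'"
  shows "min (- (slope e t)\<^sup>2 / 2) (- (slope e' t)\<^sup>2 / 2) \<le> eps_dd e e' t"
    "eps_dd e e' t \<le> max (- (slope e t)\<^sup>2 / 2) (- (slope e' t)\<^sup>2 / 2)"
proof -
  have *: "- (slope x t)\<^sup>2 / 2 \<le> eps_dd x y t \<and> eps_dd x y t \<le> - (slope y t)\<^sup>2 / 2"
    if "x < y" "0 \<le> x" for x y
    using huber_diff_ge [of x y t t] huber_diff_ge [of y x t t] that
    by (auto simp: eps_dd_commute [of x y] eps_dd_def field_simps)
  have "min (- (slope e t)\<^sup>2 / 2) (- (slope e' t)\<^sup>2 / 2) \<le> eps_dd e e' t \<and>
    eps_dd e e' t \<le> max (- (slope e t)\<^sup>2 / 2) (- (slope e' t)\<^sup>2 / 2)"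
    using * [of e e'] * [of e' e] eps_dd_commute [of e e'] assms
    by (cases e e' rule: linorder_cases) (auto simp: eps_dd_def)
  then show "min (- (slope e t)\<^sup>2 / 2) (- (slope e' t)\<^sup>2 / 2) \<le> eps_dd e e' t"
    "eps_dd e e' t \<le> max (- (slope e t)\<^sup>2 / 2) (- (slope e' t)\<^sup>2 / 2)"
    by auto
qed

lemma eps_dd_abs_le:
  assumes "0 \<le> e" "0 \<le> e'" shows "\<bar>eps_dd e e' t\<bar> \<le> 1 / 2"
proof -
  have "(slope x t)\<^sup>2 \<le> 1" "0 \<le> (slope x t)\<^sup>2" for x using slope_range [of x t] by (auto simp: power_le_one)
  from this [of e] this [of e'] show ?thesis using eps_dd_between [OF assms, of t] by linarith
qed

lemma isCont_slope: "0 < e \<Longrightarrow> isCont (\<lambda>(e, t). slope e t) (e, t)"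
proof -
  assume e: "0 < e"
  have "\<forall>\<^sub>F p in nhds (e, t). fst p \<in> {0<..}"
    by (rule eventually_compose_filterlim [OF eventually_nhds_in_open])
      (use e in \<open>auto intro: tendsto_eq_intros filterlim_ident\<close>)
  then have ev: "\<forall>\<^sub>F p in nhds (e, t). (\<lambda>(e, t). slope e t) p = (\<lambda>(e, t). max 0 (min 1 (t / e))) p"
    by eventually_elim (auto simp: slope_def)
  show ?thesis
    unfolding isCont_cong [OF ev]
    using e by (simp add: case_prod_unfold) (intro continuous_intros; simp)
qed

lemma tendsto_slope:
  assumes "(x \<longlongrightarrow> e) F" "(y \<longlongrightarrow> t) F" "0 < e"
  shows "((\<lambda>k. slope (x k) (y k)) \<longlongrightarrow> slope e t) F"
  using isCont_tendsto_compose [OF isCont_slope [OF assms(3), of t] tendsto_Pair [OF assms(1,2)]] by simp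

lemma eventually_pos: "(x \<longlongrightarrow> e) F \<Longrightarrow> 0 < e \<Longrightarrow> \<forall>\<^sub>F k in F. 0 \<le> x k" for e :: real
  using order_tendstoD(1) by (metis (mono_tags, lifting) eventually_mono less_imp_le)

lemma tendsto_huber:
  assumes x: "(x \<longlongrightarrow> e) F" and y: "(y \<longlongrightarrow> t) F" and e: "0 < e"
  shows "((\<lambda>k. huber (x k) (y k)) \<longlongrightarrow> huber e t) F"
proof -
  have "((\<lambda>k. slope (x k) (y k) * y k - x k * (slope (x k) (y k))\<^sup>2 / 2) \<longlongrightarrow> huber e t) F"
    unfolding huber_slope [OF less_imp_le [OF e]]
    by (intro tendsto_intros tendsto_slope x y e) simp
  moreover have "\<forall>\<^sub>F k in F. slope (x k) (y k) * y k - x k * (slope (x k) (y k))\<^sup>2 / 2 = huber (x k) (y k)"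
    using eventually_pos [OF x e] by eventually_elim (simp add: huber_slope)
  ultimately show ?thesis by (rule Lim_transform_eventually)
qed

text \<open>Continuity on the diagonal is the point: there the quotient is squeezed between two slopes.\<close>

lemma tendsto_huber_dd:
  assumes x: "(x \<longlongrightarrow> e) F" and y: "(y \<longlongrightarrow> a) F" and z: "(z \<longlongrightarrow> b) F" and e: "0 < e"
  shows "((\<lambda>k. huber_dd (x k) (y k) (z k)) \<longlongrightarrow> huber_dd e a b) F"
proof (cases "a = b")
  case True
  have s: "((\<lambda>k. slope (x k) (y k)) \<longlongrightarrow> huber_dd e a b) F" "((\<lambda>k. slope (x k) (z k)) \<longlongrightarrow> huber_dd e a b) F"
    using tendsto_slope [OF x y e] tendsto_slope [OF x z e] True by (auto simp: huber_dd_def)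
  show ?thesis
  proof (rule tendsto_sandwich)
    show "((\<lambda>k. min (slope (x k) (y k)) (slope (x k) (z k))) \<longlongrightarrow> huber_dd e a b) F"
      "((\<lambda>k. max (slope (x k) (y k)) (slope (x k) (z k))) \<longlongrightarrow> huber_dd e a b) F"
      using tendsto_min [OF s] tendsto_max [OF s] by auto
  qed (use eventually_pos [OF x e] in \<open>eventually_elim, simp add: huber_dd_between\<close>)+
next
  case False
  have "\<forall>\<^sub>F k in F. y k - z k \<noteq> 0"
    using tendsto_diff [OF y z] False by (intro tendsto_imp_eventually_ne) auto
  then have "\<forall>\<^sub>F k in F. (huber (x k) (y k) - huber (x k) (z k)) / (y k - z k) = huber_dd (x k) (y k) (z k)"
    by eventually_elim (auto simp: huber_dd_def)
  moreover have "((\<lambda>k. (huber (x k) (y k) - huber (x k) (z k)) / (y k - z k)) \<longlongrightarrow> huber_dd e a b) F"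
    using False by (auto simp: huber_dd_def intro!: tendsto_intros tendsto_huber x y z e)
  ultimately show ?thesis by (rule Lim_transform_eventually [rotated])
qed

lemma tendsto_eps_dd:
  assumes x: "(x \<longlongrightarrow> e) F" and x': "(x' \<longlongrightarrow> e) F" and y: "(y \<longlongrightarrow> t) F" and e: "0 < e"
  shows "((\<lambda>k. eps_dd (x k) (x' k) (y k)) \<longlongrightarrow> eps_dd e e t) F"
proof -
  have s: "((\<lambda>k. - (slope (x k) (y k))\<^sup>2 / 2) \<longlongrightarrow> eps_dd e e t) F"
    "((\<lambda>k. - (slope (x' k) (y k))\<^sup>2 / 2) \<longlongrightarrow> eps_dd e e t) F"
    unfolding eps_dd_def if_True simp_thms
    by (intro tendsto_intros tendsto_slope x x' y e; simp)+
  have ev: "\<forall>\<^sub>F k in F. 0 \<le> x k \<and> 0 \<le> x' k"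
    using eventually_pos [OF x e] eventually_pos [OF x' e] by eventually_elim simp
  show ?thesis
  proof (rule tendsto_sandwich)
    show "((\<lambda>k. min (- (slope (x k) (y k))\<^sup>2 / 2) (- (slope (x' k) (y k))\<^sup>2 / 2)) \<longlongrightarrow> eps_dd e e t) F"
      "((\<lambda>k. max (- (slope (x k) (y k))\<^sup>2 / 2) (- (slope (x' k) (y k))\<^sup>2 / 2)) \<longlongrightarrow> eps_dd e e t) F"
      using tendsto_min [OF s] tendsto_max [OF s] by auto
  qed (use ev in \<open>eventually_elim, use eps_dd_between in blast\<close>)+
qed

lemma huber_near_pos_part:
  assumes "0 \<le> e" shows "\<bar>huber e t - max 0 t\<bar> \<le> e / 2"
proof -
  have "\<bar>eps_dd e 0 t\<bar> * e \<le> 1 / 2 * e"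
    using eps_dd_abs_le [OF assms order_refl] assms by (intro mult_right_mono) auto
  moreover have "huber e t - max 0 t = eps_dd e 0 t * e"
    using eps_dd_mult [of e t 0] by (simp add: huber_def)
  ultimately show ?thesis using assms by (simp add: abs_mult)
qed

text \<open>Letting the smoothing vanish one obtains the divided differences of \<open>max 0\<close>. If both arguments tend
to 0 there need not be a limit, because the slope depends on the ratio of \<open>t\<close> and \<open>e\<close>; this is why
\<open>E_hat\<close> may fail to be differentiable at a solution.\<close>

lemma tendsto_huber_dd_zero:
  assumes x: "(x \<longlongrightarrow> 0) F" "\<forall>\<^sub>F k in F. 0 < x k" and y: "(y \<longlongrightarrow> a) F" and z: "(z \<longlongrightarrow> b) F"
    and ab: "a \<noteq> 0 \<or> b \<noteq> 0"
  shows "((\<lambda>k. huber_dd (x k) (y k) (z k)) \<longlongrightarrow>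
    (if a = b then (if a > 0 then 1 else 0) else (max 0 a - max 0 b) / (a - b))) F"
proof (cases "a = b")
  case True
  have s: "((\<lambda>k. slope (x k) (u k)) \<longlongrightarrow> (if a > 0 then 1 else 0)) F" if u: "(u \<longlongrightarrow> a) F" for u
  proof (rule tendsto_eventually)
    have a: "a \<noteq> 0" using True ab by simp
    have "((\<lambda>k. \<bar>u k\<bar> - x k) \<longlongrightarrow> \<bar>a\<bar> - 0) F" by (intro tendsto_intros u x)
    then have "\<forall>\<^sub>F k in F. 0 < \<bar>u k\<bar> - x k" by (rule order_tendstoD) (use a in simp)
    moreover have "\<forall>\<^sub>F k in F. 0 < u k * a"
      by (rule order_tendstoD(1) [OF tendsto_mult [OF u tendsto_const]])
        (use a in \<open>auto simp: zero_less_mult_iff\<close>)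
    ultimately show "\<forall>\<^sub>F k in F. slope (x k) (u k) = (if a > 0 then 1 else 0)"
      using x(2)
      by eventually_elim (auto simp: slope_def min_def max_def field_simps zero_less_mult_iff split: if_splits)
  qed
  have ev: "\<forall>\<^sub>F k in F. 0 \<le> x k" using x(2) by eventually_elim simp
  have "((\<lambda>k. huber_dd (x k) (y k) (z k)) \<longlongrightarrow> (if a > 0 then 1 else 0)) F"
  proof (rule tendsto_sandwich)
    show "((\<lambda>k. min (slope (x k) (y k)) (slope (x k) (z k))) \<longlongrightarrow> (if a > 0 then 1 else 0)) F"
      "((\<lambda>k. max (slope (x k) (y k)) (slope (x k) (z k))) \<longlongrightarrow> (if a > 0 then 1 else 0)) F"
      using tendsto_min [OF s [OF y] s [OF z [folded True]]] tendsto_max [OF s [OF y] s [OF z [folded True]]]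
      by auto
  qed (use ev in \<open>eventually_elim, simp add: huber_dd_between\<close>)+
  then show ?thesis using True by simp
next
  case False
  have h: "((\<lambda>k. huber (x k) (u k)) \<longlongrightarrow> max 0 c) F" if u: "(u \<longlongrightarrow> c) F" for u c
  proof -
    have "((\<lambda>k. huber (x k) (u k) - max 0 (u k)) \<longlongrightarrow> 0) F"
    proof (rule Lim_null_comparison)
      show "\<forall>\<^sub>F k in F. norm (huber (x k) (u k) - max 0 (u k)) \<le> x k / 2"
        using x(2) by eventually_elim (use huber_near_pos_part in \<open>auto simp del: le_divide_eq_numeral1\<close>)
      show "((\<lambda>k. x k / 2) \<longlongrightarrow> 0) F" using tendsto_divide [OF x(1) tendsto_const, of 2] by simp
    qed
    from tendsto_add [OF this tendsto_max [OF tendsto_const [of 0] u]] show ?thesis by simp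
  qed
  have "\<forall>\<^sub>F k in F. y k - z k \<noteq> 0"
    using tendsto_diff [OF y z] False by (intro tendsto_imp_eventually_ne) auto
  then have "\<forall>\<^sub>F k in F. (huber (x k) (y k) - huber (x k) (z k)) / (y k - z k) = huber_dd (x k) (y k) (z k)"
    by eventually_elim (auto simp: huber_dd_def)
  moreover have "((\<lambda>k. (huber (x k) (y k) - huber (x k) (z k)) / (y k - z k)) \<longlongrightarrow> (max 0 a - max 0 b) / (a - b)) F"
    using False by (auto intro!: tendsto_divide tendsto_diff h y z)
  ultimately have "((\<lambda>k. huber_dd (x k) (y k) (z k)) \<longlongrightarrow> (max 0 a - max 0 b) / (a - b)) F"
    by (rule Lim_transform_eventually [rotated])
  then show ?thesis using False by simp
qed

section \<open>Orthogonal conjugation and limits of matrices\<close>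

lemma tendsto_matrix_mult:
  fixes A :: "'a \<Rightarrow> real^'n::finite^'m::finite" and B :: "'a \<Rightarrow> real^'p::finite^'n"
  assumes "(A \<longlongrightarrow> a) F" "(B \<longlongrightarrow> b) F"
  shows "((\<lambda>k. A k ** B k) \<longlongrightarrow> a ** b) F"
  unfolding matrix_matrix_mult_def
  by (intro vec_tendstoI, simp) (intro tendsto_intros tendsto_vec_nth assms)

lemma tendsto_transpose:
  fixes A :: "'a \<Rightarrow> real^'n::finite^'m::finite"
  assumes "(A \<longlongrightarrow> a) F"
  shows "((\<lambda>k. transpose (A k)) \<longlongrightarrow> transpose a) F"
  unfolding transpose_def
  by (intro vec_tendstoI, simp) (intro tendsto_vec_nth assms)

lemma tendsto_diag_mat:
  assumes "(d \<longlongrightarrow> c) F" shows "((\<lambda>k. diag_mat (d k)) \<longlongrightarrow> diag_mat c) F"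
  unfolding diag_mat_def
  by (intro vec_tendstoI, simp) (intro tendsto_vec_nth assms conjI impI)

lemma linear_sandwich: "linear (\<lambda>M. P ** M ** Q)" for P :: "real^'n::finite^'m::finite"
  by (rule linearI)
    (simp_all add: vec_eq_iff matrix_matrix_mult_def sum_distrib_left sum_distrib_right
      sum.distrib algebra_simps)

lemma inner_eq_trace: "A \<bullet> B = trace (transpose A ** B)" for A B :: "real^'n::finite^'n"
  unfolding inner_vec_def trace_def matrix_matrix_mult_def transpose_def
  by simp (rule sum.swap)

text \<open>Orthogonal changes of basis on either side preserve the trace inner product, so that all estimates
may be made on the entries in eigenbases.\<close>

lemma inner_orthogonal_conj:
  fixes P Q A B :: "real^'n::finite^'n"
  assumes "orthogonal_matrix P" "orthogonal_matrix Q"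
  shows "(P ** A ** Q) \<bullet> (P ** B ** Q) = A \<bullet> B"
proof -
  have "(P ** A ** Q) \<bullet> (P ** B ** Q) = trace (transpose Q ** (transpose A ** (transpose P ** P) ** B ** Q))"
    by (simp add: inner_eq_trace matrix_transpose_mul matrix_mul_assoc)
  also have "\<dots> = trace (transpose A ** B ** (Q ** transpose Q))"
    using assms(1) by (subst trace_mul_sym) (simp add: orthogonal_matrix_def matrix_mul_assoc)
  finally show ?thesis using assms(2) by (simp add: orthogonal_matrix_def inner_eq_trace)
qed

lemma norm_orthogonal_conj:
  fixes P Q A :: "real^'n::finite^'n"
  assumes "orthogonal_matrix P" "orthogonal_matrix Q"
  shows "norm (P ** A ** Q) = norm A"
  by (simp add: norm_eq_sqrt_inner inner_orthogonal_conj assms)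

lemma orthogonal_matrix_transpose_iff: "orthogonal_matrix (transpose P) = orthogonal_matrix P"
  by (auto simp: orthogonal_matrix_def)

lemma mat_entry_le: "\<bar>M $ i $ j\<bar> \<le> norm M" for M :: "real^'n::finite^'m::finite"
  by (rule order_trans [OF component_le_norm_cart Finite_Cartesian_Product.norm_nth_le])

lemma norm_mat_mono:
  fixes M N :: "real^'n::finite^'m::finite"
  assumes "\<And>i j. \<bar>M $ i $ j\<bar> \<le> \<bar>N $ i $ j\<bar>"
  shows "norm M \<le> norm N"
  using assms by (intro norm_le_componentwise_cart) simp

lemma norm_mat_le_sum: "norm M \<le> (\<Sum>i\<in>UNIV. \<Sum>j\<in>UNIV. \<bar>M $ i $ j\<bar>)"
  for M :: "real^'n::finite^'m::finite"
proof -
  have "norm M \<le> (\<Sum>i\<in>UNIV. norm (M $ i))" unfolding norm_vec_def by (rule L2_set_le_sum) simp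
  also have "\<dots> \<le> (\<Sum>i\<in>UNIV. \<Sum>j\<in>UNIV. \<bar>M $ i $ j\<bar>)"
    by (intro sum_mono norm_le_l1_cart)
  finally show ?thesis .
qed

lemma mult_diag_entry: "(R ** diag_mat x) $ i $ j = R $ i $ j * x $ j"
  by (simp add: matrix_matrix_mult_def diag_mat_def if_distrib cong: if_cong)

lemma diag_mult_entry: "(diag_mat x ** R) $ i $ j = x $ i * R $ i $ j"
  by (simp add: matrix_matrix_mult_def diag_mat_def if_distrib if_distribR cong: if_cong)

lemma tendsto_mat_of:
  assumes "(W \<longlongrightarrow> V) F" shows "((\<lambda>k. mat_of (W k)) \<longlongrightarrow> mat_of V) F"
  using assms unfolding tendsto_iff dist_norm
  by (simp add: norm_mat_of flip: minus_symmat.rep_eq)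

section \<open>Double operator integrals\<close>

definition eigdec :: "'n::finite symmat \<Rightarrow> real^'n^'n \<Rightarrow> real^'n \<Rightarrow> bool"
  where "eigdec W P d \<longleftrightarrow> orthogonal_matrix P \<and> mat_of W = P ** diag_mat d ** transpose P"

lemma eigdec_exists: "\<exists>P d. eigdec W P d"
  unfolding eigdec_def by (metis spectral_decomposition)

text \<open>The double operator integral of \<open>g\<close>: in the eigenbases \<open>P\<close> and \<open>Q\<close>, the entry \<open>(i, j)\<close> is multiplied by
\<open>g (d\<^sub>i) (e\<^sub>j)\<close>. In terms of the spectral projections \<open>E\<close> of \<open>V\<close> and \<open>F\<close> of \<open>W\<close> it is the sum of
\<open>g \<lambda> \<mu> *\<^sub>R (E \<lambda> ** H ** F \<mu>)\<close> over the eigenvalues, hence independent of the bases; that justifies the choice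
made in \<open>double_op\<close>.\<close>

definition schur_conj :: "(real \<Rightarrow> real \<Rightarrow> real) \<Rightarrow> real^'n^'n \<Rightarrow> real^'n \<Rightarrow> real^'n^'n \<Rightarrow> real^'n \<Rightarrow>
    real^'n^'n \<Rightarrow> real^'n::finite^'n"
  where "schur_conj g P d Q e H =
    P ** (\<chi> i j. g (d $ i) (e $ j) * (transpose P ** H ** Q) $ i $ j) ** transpose Q"

definition double_op :: "(real \<Rightarrow> real \<Rightarrow> real) \<Rightarrow> 'n::finite symmat \<Rightarrow> 'n symmat \<Rightarrow> real^'n^'n \<Rightarrow> real^'n^'n"
  where "double_op g V W H = (SOME M. \<exists>P d Q e. eigdec V P d \<and> eigdec W Q e \<and> M = schur_conj g P d Q e H)"

lemma orthogonalD:
  assumes "orthogonal_matrix P"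
  shows "transpose P ** P = mat 1" "P ** transpose P = mat 1"
    "transpose P ** (P ** M) = M" "P ** (transpose P ** M) = M"
    "M ** P ** transpose P = M" "M ** transpose P ** P = M"
  using assms by (auto simp: orthogonal_matrix_def matrix_mul_assoc) (auto simp flip: matrix_mul_assoc)

text \<open>Two eigenbases of the same matrix differ by a matrix that only links equal eigenvalues.\<close>

lemma eigdec_intertwine:
  assumes "eigdec W P d" "eigdec W P' d'"
  shows "(transpose P ** P') $ i $ j = 0 \<or> d $ i = d' $ j"
proof -
  have P: "orthogonal_matrix P" "mat_of W = P ** diag_mat d ** transpose P"
    and P': "orthogonal_matrix P'" "mat_of W = P' ** diag_mat d' ** transpose P'"
    using assms by (auto simp: eigdec_def)
  have "diag_mat d ** (transpose P ** P') = transpose P ** mat_of W ** P'"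
    unfolding P(2) by (simp add: matrix_mul_assoc orthogonalD [OF P(1)])
  also have "\<dots> = (transpose P ** P') ** diag_mat d'"
    unfolding P'(2) by (simp add: matrix_mul_assoc orthogonalD [OF P'(1)])
  finally have "(diag_mat d ** (transpose P ** P')) $ i $ j = ((transpose P ** P') ** diag_mat d') $ i $ j" by simp
  then show ?thesis by (simp add: mult_diag_entry diag_mult_entry)
qed

text \<open>The matrices of change of basis link equal eigenvalues only, so they commute with the entrywise
multiplication by \<open>g (d\<^sub>i) (e\<^sub>j)\<close>.\<close>

lemma schur_conj_unique:
  assumes V: "eigdec V P d" "eigdec V P' d'" and W: "eigdec W Q e" "eigdec W Q' e'"
  shows "schur_conj g P d Q e H = schur_conj g P' d' Q' e' H"
proof -
  have o: "orthogonal_matrix P" "orthogonal_matrix P'" "orthogonal_matrix Q" "orthogonal_matrix Q'"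
    using V W by (auto simp: eigdec_def)
  define R S where "R = transpose P ** P'" and "S = transpose Q ** Q'"
  have R: "R $ i $ j = 0 \<or> d $ i = d' $ j" and S: "S $ i $ j = 0 \<or> e $ i = e' $ j" for i j
    using eigdec_intertwine [OF V] eigdec_intertwine [OF W] by (auto simp: R_def S_def)
  define G where "G x y N = (\<chi> i j. g (x $ i) (y $ j) * N $ i $ j)" for x y and N :: "real^'a^'a"
  have *: "R $ i $ k * (g (d' $ k) (e' $ j) * N $ k $ j) = g (d $ i) (e' $ j) * (R $ i $ k * N $ k $ j)"
    for i j k and N :: "real^'a^'a"
    using R [of i k] by auto
  have RG: "R ** G d' e' N = G d e' (R ** N)" for N
    unfolding G_def matrix_matrix_mult_def vec_eq_iff
    by (simp only: vec_lambda_beta sum_distrib_left) (intro allI sum.cong refl *)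
  have **: "(g (d $ i) (e' $ k) * N $ i $ k) * S $ j $ k = g (d $ i) (e $ j) * (N $ i $ k * S $ j $ k)"
    for i j k and N :: "real^'a^'a"
    using S [of j k] by auto
  have GS: "G d e' N ** transpose S = G d e (N ** transpose S)" for N
    unfolding G_def matrix_matrix_mult_def vec_eq_iff transpose_def
    by (simp only: vec_lambda_beta sum_distrib_left) (intro allI sum.cong refl **)
  have PR: "P' = P ** R" and QS: "Q' = Q ** S"
    unfolding R_def S_def using orthogonalD(4) [OF o(1)] orthogonalD(4) [OF o(3)] by simp_all
  have oR: "orthogonal_matrix R" "orthogonal_matrix S"
    unfolding R_def S_def by (simp_all add: o orthogonal_matrix_mul orthogonal_matrix_transpose_iff)
  have "schur_conj g P' d' Q' e' H = P ** (R ** G d' e' (transpose P' ** H ** Q') ** transpose S) ** transpose Q"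
    unfolding schur_conj_def G_def [symmetric] by (simp add: PR QS matrix_transpose_mul matrix_mul_assoc)
  also have "R ** G d' e' (transpose P' ** H ** Q') ** transpose S
      = G d e (R ** (transpose P' ** H ** Q') ** transpose S)"
    by (simp add: RG GS)
  also have "R ** (transpose P' ** H ** Q') ** transpose S
      = (R ** transpose R) ** (transpose P ** H ** Q) ** (S ** transpose S)"
    by (simp add: PR QS matrix_transpose_mul matrix_mul_assoc)
  also have "\<dots> = transpose P ** H ** Q" by (simp add: orthogonalD(2) oR)
  finally show ?thesis by (simp add: schur_conj_def G_def)
qed

lemma double_op_eq:
  assumes "eigdec V P d" "eigdec W Q e"
  shows "double_op g V W H = schur_conj g P d Q e H"
proof -
  have "\<exists>P d Q e. eigdec V P d \<and> eigdec W Q e \<and> double_op g V W H = schur_conj g P d Q e H"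
    unfolding double_op_def by (rule someI_ex) (use assms in blast)
  then obtain P' d' Q' e' where PQ: "eigdec V P' d'" "eigdec W Q' e'"
    and eq: "double_op g V W H = schur_conj g P' d' Q' e' H" by blast
  show ?thesis unfolding eq by (rule schur_conj_unique [OF PQ(1) assms(1) PQ(2) assms(2)])
qed

lemma linear_double_op: "linear (double_op g V W)"
proof -
  obtain P d where PQ: "eigdec V P d" using eigdec_exists by blast
  obtain Q e where PQ': "eigdec W Q e" using eigdec_exists by blast
  note PQ = PQ PQ'
  have L: "linear (\<lambda>M. (\<chi> i j. g (d $ i) (e $ j) * M $ i $ j) :: real^'a^'a)"
    by (rule linearI) (simp_all add: vec_eq_iff algebra_simps)
  have "double_op g V W = (\<lambda>M. P ** M ** transpose Q) \<circ> (\<lambda>M. \<chi> i j. g (d $ i) (e $ j) * M $ i $ j) \<circ>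
      (\<lambda>M. transpose P ** M ** Q)"
    by (simp add: fun_eq_iff double_op_eq [OF PQ] schur_conj_def)
  then show ?thesis by (simp add: linear_compose [OF linear_compose [OF linear_sandwich L] linear_sandwich] comp_assoc)
qed

lemma norm_double_op_le:
  assumes "\<And>x y. \<bar>g x y\<bar> \<le> c"
  shows "norm (double_op g V W H) \<le> c * norm H"
proof -
  obtain P d where PQ: "eigdec V P d" using eigdec_exists by blast
  obtain Q e where PQ': "eigdec W Q e" using eigdec_exists by blast
  note PQ = PQ PQ'
  have c: "0 \<le> c" using assms [of 0 0] by simp
  have "norm (double_op g V W H) = norm (\<chi> i j. g (d $ i) (e $ j) * (transpose P ** H ** Q) $ i $ j)"
    using PQ by (simp add: double_op_eq [OF PQ] schur_conj_def eigdec_def norm_orthogonal_conj orthogonal_matrix_transpose_iff)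
  also have "\<dots> \<le> norm (c *\<^sub>R (transpose P ** H ** Q))"
    by (rule norm_mat_mono) (use assms c in \<open>auto simp: abs_mult intro!: mult_right_mono\<close>)
  also have "\<dots> = c * norm H"
    using PQ c by (simp add: eigdec_def norm_orthogonal_conj orthogonal_matrix_transpose_iff)
  finally show ?thesis .
qed

lemma transpose_double_op:
  assumes "\<And>x y. g x y = g y x" "transpose H = H"
  shows "transpose (double_op g W W H) = double_op g W W H"
proof -
  obtain P d where P: "eigdec W P d" using eigdec_exists by blast
  define N where "N = transpose P ** H ** P"
  have "transpose N = N" unfolding N_def using assms(2) by (simp add: matrix_transpose_mul matrix_mul_assoc)
  then have "N $ i $ j = N $ j $ i" for i j by (simp add: transpose_def vec_eq_iff)
  then have "transpose (\<chi> i j. g (d $ i) (d $ j) * N $ i $ j) = (\<chi> i j. g (d $ i) (d $ j) * N $ i $ j)"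
    using assms(1) by (simp add: transpose_def vec_eq_iff)
  then show ?thesis
    by (simp add: double_op_eq [OF P P] schur_conj_def matrix_transpose_mul matrix_mul_assoc flip: N_def)
qed

lemma mat_of_spectral_fun: "eigdec W P d \<Longrightarrow>
    mat_of (spectral_fun f W) = P ** diag_mat (\<chi> i. f (d $ i)) ** transpose P"
  by (simp add: eigdec_def spectral_fun_eq)

lemma spectral_fun_double_op: "mat_of (spectral_fun f W) = double_op (\<lambda>x y. f x) W W (mat 1)"
proof -
  obtain P d where P: "eigdec W P d" using eigdec_exists by blast
  then have "transpose P ** mat 1 ** P = mat 1" by (simp add: eigdec_def orthogonalD)
  then have "(\<chi> i j. f (d $ i) * (transpose P ** mat 1 ** P) $ i $ j) = diag_mat (\<chi> i. f (d $ i))"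
    by (simp add: diag_mat_def mat_def vec_eq_iff)
  then show ?thesis by (simp add: double_op_eq [OF P P] mat_of_spectral_fun [OF P] schur_conj_def)
qed

text \<open>The basic identity. With \<open>R = P\<^sup>T Q\<close>, the entries of \<open>P\<^sup>T (f(V) - f(W)) Q\<close> and \<open>P\<^sup>T (V - W) Q\<close> are
\<open>(f (d\<^sub>i) - f (e\<^sub>j)) R\<^sub>i\<^sub>j\<close> and \<open>(d\<^sub>i - e\<^sub>j) R\<^sub>i\<^sub>j\<close>. The use of a separate eigenbasis for each matrix makes the
formula exact at any distance.\<close>

lemma spectral_fun_diff:
  assumes "\<And>x y. f x - f y = g x y * (x - y)"
  shows "mat_of (spectral_fun f V) - mat_of (spectral_fun f W) = double_op g V W (mat_of V - mat_of W)"
proof -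
  obtain P d where PQ: "eigdec V P d" using eigdec_exists by blast
  obtain Q e where PQ': "eigdec W Q e" using eigdec_exists by blast
  note PQ = PQ PQ'
  have o: "orthogonal_matrix P" "orthogonal_matrix Q" using PQ by (auto simp: eigdec_def)
  define R where "R = transpose P ** Q"
  have conj: "transpose P ** (P ** diag_mat x ** transpose P - Q ** diag_mat y ** transpose Q) ** Q
      = (\<chi> i j. (x $ i - y $ j) * R $ i $ j)" for x y
  proof -
    have "transpose P ** (P ** diag_mat x ** transpose P - Q ** diag_mat y ** transpose Q) ** Q
      = diag_mat x ** R - R ** diag_mat y"
      using linear_diff [OF linear_sandwich [of "transpose P" Q]]
      by (simp add: R_def matrix_mul_assoc orthogonalD o)
    then show ?thesis by (simp add: vec_eq_iff mult_diag_entry diag_mult_entry algebra_simps)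
  qed
  have V: "mat_of V = P ** diag_mat d ** transpose P" and W: "mat_of W = Q ** diag_mat e ** transpose Q"
    using PQ by (auto simp: eigdec_def)
  let ?D = "mat_of (spectral_fun f V) - mat_of (spectral_fun f W)"
  have "transpose P ** ?D ** Q = (\<chi> i j. (f (d $ i) - f (e $ j)) * R $ i $ j)"
    unfolding mat_of_spectral_fun [OF PQ(1)] mat_of_spectral_fun [OF PQ(2)] conj by simp
  also have "\<dots> = (\<chi> i j. g (d $ i) (e $ j) * (transpose P ** (mat_of V - mat_of W) ** Q) $ i $ j)"
    unfolding V W conj by (simp add: assms mult.assoc)
  finally have "transpose P ** ?D ** Q =
    (\<chi> i j. g (d $ i) (e $ j) * (transpose P ** (mat_of V - mat_of W) ** Q) $ i $ j)" .
  moreover have "?D = P ** (transpose P ** ?D ** Q) ** transpose Q"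
    by (simp add: matrix_mul_assoc orthogonalD o)
  ultimately show ?thesis by (simp add: double_op_eq [OF PQ] schur_conj_def)
qed

lemma eigdec_bounded:
  fixes W :: "'n::finite symmat"
  assumes "eigdec W P d"
  shows "norm P \<le> norm (mat 1 :: real^'n^'n)" "norm d \<le> norm W"
proof -
  have o: "orthogonal_matrix P" using assms by (simp add: eigdec_def)
  show "norm P \<le> norm (mat 1 :: real^'n^'n)"
    using norm_orthogonal_conj [OF o, of "mat 1" "mat 1"] by (simp add: orthogonal_matrix_def transpose_mat)
  have "norm d \<le> norm (diag_mat d)"
  proof (rule norm_le_componentwise_cart)
    show "norm (d $ i) \<le> norm (diag_mat d $ i)" for i
      using component_le_norm_cart [of "diag_mat d $ i" i] by (simp add: diag_mat_def)
  qed
  also have "\<dots> = norm W"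
    using assms norm_orthogonal_conj [of P "transpose P" "diag_mat d"]
    by (simp add: eigdec_def orthogonal_matrix_transpose_iff flip: norm_mat_of)
  finally show "norm d \<le> norm W" .
qed

lemma eigdec_limit:
  assumes "W \<longlonglongrightarrow> W0" "\<And>k. eigdec (W k) (P k) (d k)" "P \<longlonglongrightarrow> P0" "d \<longlonglongrightarrow> d0"
  shows "eigdec W0 P0 d0"
  unfolding eigdec_def orthogonal_matrix_def
proof (intro conjI)
  have "(\<lambda>k. transpose (P k) ** P k) \<longlonglongrightarrow> transpose P0 ** P0" "(\<lambda>k. P k ** transpose (P k)) \<longlonglongrightarrow> P0 ** transpose P0"
    "(\<lambda>k. P k ** diag_mat (d k) ** transpose (P k)) \<longlonglongrightarrow> P0 ** diag_mat d0 ** transpose P0"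
    by (intro tendsto_matrix_mult tendsto_transpose tendsto_diag_mat assms)+
  moreover have "transpose (P k) ** P k = mat 1" "P k ** transpose (P k) = mat 1"
    "P k ** diag_mat (d k) ** transpose (P k) = mat_of (W k)" for k
    using assms(2) [of k] by (auto simp: eigdec_def orthogonal_matrix_def)
  moreover have "(\<lambda>k. mat_of (W k)) \<longlonglongrightarrow> mat_of W0" using assms(1) by (rule tendsto_mat_of)
  ultimately show "transpose P0 ** P0 = mat 1" "P0 ** transpose P0 = mat 1"
    "mat_of W0 = P0 ** diag_mat d0 ** transpose P0"
    using LIMSEQ_unique by (auto simp: LIMSEQ_const_iff)
qed

lemma eigdec_choice:
  fixes U :: "'k \<Rightarrow> 'n::finite symmat"
  obtains P d where "\<And>k. eigdec (U k) (P k) (d k)"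
proof -
  have "\<forall>k. \<exists>x. eigdec (U k) (fst x) (snd x)"
    using eigdec_exists by fastforce
  then obtain f where "\<And>k. eigdec (U k) (fst (f k)) (snd (f k))"
    using choice [of "\<lambda>k x. eigdec (U k) (fst x) (snd x)"] by blast
  then show thesis by (rule that)
qed

text \<open>Eigenbases cannot be chosen continuously. Compactness offers the substitute: along a subsequence they
converge, and the limit is an eigenbasis of the limit matrix.\<close>

lemma eigdec_subseq:
  fixes W :: "nat \<Rightarrow> 'n::finite symmat"
  assumes W: "W \<longlonglongrightarrow> W0" and ed: "\<And>k. eigdec (W k) (P k) (d k)"
  obtains r P0 d0 where "strict_mono r" "eigdec W0 P0 d0" "(P \<circ> r) \<longlonglongrightarrow> P0" "(d \<circ> r) \<longlonglongrightarrow> d0"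
proof -
  obtain B where B: "\<And>k. norm (W k) \<le> B"
    using convergent_imp_Bseq [OF convergentI [OF W]] by (auto simp: Bseq_def)
  have "bounded (range (\<lambda>k. (P k, d k)))"
    unfolding bounded_iff
  proof (intro exI ballI)
    fix x assume "x \<in> range (\<lambda>k. (P k, d k))"
    then obtain k where "x = (P k, d k)" by blast
    then show "norm x \<le> norm (mat 1 :: real^'n^'n) + B"
      using norm_Pair_le [of "P k" "d k"] eigdec_bounded [OF ed [of k]] B [of k] by simp
  qed
  then obtain l r where r: "strict_mono r" "((\<lambda>k. (P k, d k)) \<circ> r) \<longlonglongrightarrow> l"
    using bounded_imp_convergent_subsequence by blast
  have lim: "(P \<circ> r) \<longlonglongrightarrow> fst l" "(d \<circ> r) \<longlonglongrightarrow> snd l"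
    using tendsto_fst [OF r(2)] tendsto_snd [OF r(2)] by (simp_all add: o_def)
  have "eigdec W0 (fst l) (snd l)"
    using LIMSEQ_subseq_LIMSEQ [OF W r(1)] _ lim by (rule eigdec_limit) (use ed in simp)
  with r(1) lim show ?thesis using that by blast
qed

lemma LIMSEQ_from_subsequences:
  fixes f :: "nat \<Rightarrow> 'a::metric_space"
  assumes "\<And>r. strict_mono (r :: nat \<Rightarrow> nat) \<Longrightarrow> \<exists>s. strict_mono s \<and> (f \<circ> r \<circ> s) \<longlonglongrightarrow> l"
  shows "f \<longlonglongrightarrow> l"
proof (rule ccontr)
  assume "\<not> ?thesis"
  then obtain e where e: "0 < e" "\<not> (\<forall>\<^sub>F k in sequentially. dist (f k) l < e)"
    by (auto simp: tendsto_iff)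
  then obtain r :: "nat \<Rightarrow> nat" where r: "strict_mono r" "\<And>n. \<not> dist (f (r n)) l < e"
    using not_eventually_sequentiallyD by blast
  then obtain s where "(f \<circ> r \<circ> s) \<longlonglongrightarrow> l" using assms by blast
  then have "\<forall>\<^sub>F n in sequentially. dist (f (r (s n))) l < e" using e(1) by (auto simp: tendsto_iff)
  then show False using r(2) by simp
qed

text \<open>Every subsequence has a further one along which the eigenbases converge, and then all factors in
\<open>schur_conj\<close> converge. The limit does not depend on the subsequence, because the double operator integral
does not depend on the eigenbases.\<close>

lemma double_op_tendsto_sequentially:
  fixes V W :: "nat \<Rightarrow> 'n::finite symmat"
  assumes p: "p \<longlonglongrightarrow> p0" and V: "V \<longlonglongrightarrow> V0" and W: "W \<longlonglongrightarrow> W0" and H: "H \<longlonglongrightarrow> H0"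
    and G: "\<And>q u v x y. q \<longlonglongrightarrow> p0 \<Longrightarrow> u \<longlonglongrightarrow> x \<Longrightarrow> v \<longlonglongrightarrow> y \<Longrightarrow> (\<lambda>k. G (q k) (u k) (v k)) \<longlonglongrightarrow> G p0 x y"
  shows "(\<lambda>k. double_op (G (p k)) (V k) (W k) (H k)) \<longlonglongrightarrow> double_op (G p0) V0 W0 H0"
proof (rule LIMSEQ_from_subsequences)
  fix r :: "nat \<Rightarrow> nat" assume r: "strict_mono r"
  obtain P d where ed1: "\<And>k. eigdec (V k) (P k) (d k)" using eigdec_choice [of V] by blast
  obtain Q e where ed2: "\<And>k. eigdec (W k) (Q k) (e k)" using eigdec_choice [of W] by blast
  note ed = ed1 ed2
  have Vr: "(V \<circ> r) \<longlonglongrightarrow> V0" and Wr: "(W \<circ> r) \<longlonglongrightarrow> W0"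
    using V W r by (simp_all add: LIMSEQ_subseq_LIMSEQ)
  obtain s P0 d0 where s: "strict_mono s" "eigdec V0 P0 d0" "((P \<circ> r) \<circ> s) \<longlonglongrightarrow> P0" "((d \<circ> r) \<circ> s) \<longlonglongrightarrow> d0"
    by (rule eigdec_subseq [OF Vr, of "P \<circ> r" "d \<circ> r"]) (use ed in auto)
  have Ws: "(W \<circ> r \<circ> s) \<longlonglongrightarrow> W0" using Wr s(1) by (rule LIMSEQ_subseq_LIMSEQ)
  obtain t Q0 e0 where t: "strict_mono t" "eigdec W0 Q0 e0" "((Q \<circ> r \<circ> s) \<circ> t) \<longlonglongrightarrow> Q0" "((e \<circ> r \<circ> s) \<circ> t) \<longlonglongrightarrow> e0"
    by (rule eigdec_subseq [OF Ws, of "Q \<circ> r \<circ> s" "e \<circ> r \<circ> s"]) (use ed in auto)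
  define k where "k n = r (s (t n))" for n
  have k: "strict_mono k" unfolding k_def using r s(1) t(1) by (simp add: strict_mono_def)
  have lims: "(\<lambda>n. P (k n)) \<longlonglongrightarrow> P0" "(\<lambda>n. d (k n)) \<longlonglongrightarrow> d0" "(\<lambda>n. Q (k n)) \<longlonglongrightarrow> Q0" "(\<lambda>n. e (k n)) \<longlonglongrightarrow> e0"
    using LIMSEQ_subseq_LIMSEQ [OF s(3) t(1)] LIMSEQ_subseq_LIMSEQ [OF s(4) t(1)] t(3,4)
    by (simp_all add: k_def o_def)
  have lims': "(\<lambda>n. H (k n)) \<longlonglongrightarrow> H0" "(\<lambda>n. p (k n)) \<longlonglongrightarrow> p0"
    using LIMSEQ_subseq_LIMSEQ [OF H k] LIMSEQ_subseq_LIMSEQ [OF p k] by (simp_all add: o_def)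
  have "(\<lambda>n. schur_conj (G (p (k n))) (P (k n)) (d (k n)) (Q (k n)) (e (k n)) (H (k n)))
      \<longlonglongrightarrow> schur_conj (G p0) P0 d0 Q0 e0 H0"
    unfolding schur_conj_def
    by (intro tendsto_matrix_mult tendsto_transpose lims vec_tendstoI; simp)
      (intro tendsto_mult G tendsto_vec_nth lims lims' tendsto_matrix_mult tendsto_transpose)
  then have "(\<lambda>n. double_op (G (p (k n))) (V (k n)) (W (k n)) (H (k n))) \<longlonglongrightarrow> double_op (G p0) V0 W0 H0"
    by (simp add: double_op_eq [OF ed(1) ed(2)] double_op_eq [OF s(2) t(2)])
  moreover have "strict_mono (s \<circ> t)" using s(1) t(1) by (simp add: strict_mono_o)
  ultimately show "\<exists>s. strict_mono s \<and> ((\<lambda>k. double_op (G (p k)) (V k) (W k) (H k)) \<circ> r \<circ> s) \<longlonglongrightarrow> double_op (G p0) V0 W0 H0"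
    by (intro exI [of _ "s \<circ> t"]) (simp add: k_def o_def)
qed

section \<open>The derivative of the smoothing function\<close>

lemma tendsto_symmatI:
  assumes "((\<lambda>k. mat_of (W k)) \<longlongrightarrow> mat_of V) F" shows "(W \<longlongrightarrow> V) F"
  using assms unfolding tendsto_iff dist_norm
  by (simp add: norm_mat_of flip: minus_symmat.rep_eq)

text \<open>The partial derivatives of \<open>Phi\<close>: the Loewner operator acting on \<open>H\<close>, and the derivative in the
smoothing parameter.\<close>

definition lowner :: "real \<Rightarrow> 'n::finite symmat \<Rightarrow> 'n symmat \<Rightarrow> 'n symmat"
  where "lowner e W H = Symmat (double_op (huber_dd e) W W (mat_of H))"

definition Phi_eps :: "real \<Rightarrow> 'n::finite symmat \<Rightarrow> 'n symmat"
  where "Phi_eps e W = spectral_fun (eps_dd e e) W"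

lemma mat_of_lowner: "mat_of (lowner e W H) = double_op (huber_dd e) W W (mat_of H)"
  unfolding lowner_def
  by (rule Symmat_inverse) (simp add: transpose_double_op huber_dd_commute)

lemma linear_lowner: "linear (lowner e W)"
proof -
  have L: "linear (\<lambda>H. double_op (huber_dd e) W W (mat_of H))"
    using linear_compose [OF linear_mat_of linear_double_op] by (simp add: o_def)
  show ?thesis
    by (rule linearI)
      (simp_all add: mat_of_lowner plus_symmat.rep_eq scaleR_symmat.rep_eq
        linear_add [OF linear_double_op] linear_scale [OF linear_double_op] flip: mat_of_inject)
qed

lemma norm_spectral_fun_le:
  fixes W :: "'n::finite symmat"
  assumes "\<And>t. \<bar>f t\<bar> \<le> c"
  shows "norm (spectral_fun f W) \<le> c * norm (mat 1 :: real^'n^'n)"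
  using norm_double_op_le [of "\<lambda>x y. f x" c W W "mat 1"] assms
  by (simp add: norm_mat_of flip: spectral_fun_double_op)

lemma norm_Phi_eps_le:
  fixes W :: "'n::finite symmat"
  assumes "0 \<le> e" shows "norm (Phi_eps e W) \<le> norm (mat 1 :: real^'n^'n)"
proof -
  have "norm (Phi_eps e W) \<le> 1 / 2 * norm (mat 1 :: real^'n^'n)"
    unfolding Phi_eps_def by (rule norm_spectral_fun_le) (rule eps_dd_abs_le [OF assms assms])
  then show ?thesis using norm_ge_zero [of "Phi_eps e W"] by linarith
qed

lemma spectral_fun_diff_scale:
  assumes "\<And>t. f t - f' t = g t * c"
  shows "spectral_fun f V - spectral_fun f' V = c *\<^sub>R spectral_fun g V"
proof -
  obtain P d where P: "eigdec V P d" using eigdec_exists by blast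
  have "diag_mat (\<chi> i. f (d $ i)) - diag_mat (\<chi> i. f' (d $ i)) = c *\<^sub>R diag_mat (\<chi> i. g (d $ i))"
    by (simp add: diag_mat_def vec_eq_iff assms mult.commute)
  then have "P ** (diag_mat (\<chi> i. f (d $ i)) - diag_mat (\<chi> i. f' (d $ i))) ** transpose P
      = P ** (c *\<^sub>R diag_mat (\<chi> i. g (d $ i))) ** transpose P" by simp
  then show ?thesis
    unfolding linear_diff [OF linear_sandwich] linear_scale [OF linear_sandwich]
    by (simp add: minus_symmat.rep_eq scaleR_symmat.rep_eq mat_of_spectral_fun [OF P] flip: mat_of_inject)
qed

text \<open>The basic identity for a simultaneous change of the matrix and of the smoothing parameter. The factor
\<open>double_op (huber_dd e')\<close> tends to the Loewner operator and the spectral function tends to \<open>Phi_eps\<close>, so this exact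
formula contains the derivative; with the bounds on the divided differences it also contains the Lipschitz
estimate.\<close>

lemma Phi_diff:
  "mat_of (Phi e V - Phi e' W) =
    double_op (huber_dd e') V W (mat_of (V - W)) + (e - e') *\<^sub>R mat_of (spectral_fun (eps_dd e e') V)"
proof -
  have "Phi e V - Phi e' W = (Phi e' V - Phi e' W) + (Phi e V - Phi e' V)" by simp
  also have "Phi e V - Phi e' V = (e - e') *\<^sub>R spectral_fun (eps_dd e e') V"
    unfolding Phi_def by (rule spectral_fun_diff_scale) (simp add: eps_dd_mult)
  finally show ?thesis
    using spectral_fun_diff [of "huber e'" "huber_dd e'" V W]
    by (simp add: Phi_def huber_dd_mult plus_symmat.rep_eq minus_symmat.rep_eq scaleR_symmat.rep_eq)
qed

lemma Phi_lipschitz: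
  fixes V W :: "'n::finite symmat"
  assumes "0 \<le> e" "0 \<le> e'"
  shows "norm (Phi e V - Phi e' W) \<le> norm (V - W) + \<bar>e - e'\<bar> * norm (mat 1 :: real^'n^'n)"
proof -
  have "norm (Phi e V - Phi e' W) \<le> norm (double_op (huber_dd e') V W (mat_of (V - W)))
      + norm ((e - e') *\<^sub>R mat_of (spectral_fun (eps_dd e e') V))"
    unfolding norm_mat_of [of "Phi e V - Phi e' W", symmetric] Phi_diff by (rule norm_triangle_ineq)
  also have "norm (double_op (huber_dd e') V W (mat_of (V - W))) \<le> norm (V - W)"
    using norm_double_op_le [of "huber_dd e'" 1 V W "mat_of (V - W)"] huber_dd_range [OF assms(2)] by (simp add: norm_mat_of)
  also have "norm ((e - e') *\<^sub>R mat_of (spectral_fun (eps_dd e e') V)) \<le> \<bar>e - e'\<bar> * norm (mat 1 :: real^'n^'n)"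
  proof -
    have "norm (spectral_fun (eps_dd e e') V) \<le> 1 / 2 * norm (mat 1 :: real^'n^'n)"
      by (rule norm_spectral_fun_le) (rule eps_dd_abs_le [OF assms])
    then have "norm (spectral_fun (eps_dd e e') V) \<le> norm (mat 1 :: real^'n^'n)"
      using norm_ge_zero [of "spectral_fun (eps_dd e e') V"] by linarith
    then show ?thesis by (simp add: norm_mat_of mult_left_mono)
  qed
  finally show ?thesis by simp
qed

text \<open>In finite dimension pointwise convergence of linear maps on a basis is convergence in operator norm.\<close>

lemma eventually_opnorm_le:
  fixes T :: "'a \<Rightarrow> 'b::euclidean_space \<Rightarrow> 'c::real_normed_vector"
  assumes T: "\<And>p. linear (T p)" and T0: "linear T0"
    and lim: "\<And>B. B \<in> Basis \<Longrightarrow> ((\<lambda>p. T p B) \<longlongrightarrow> T0 B) F" and c: "0 < c"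
  shows "\<forall>\<^sub>F p in F. \<forall>H. norm (T p H - T0 H) \<le> c * norm H"
proof -
  have "((\<lambda>p. \<Sum>B\<in>Basis. norm (T p B - T0 B)) \<longlongrightarrow> (\<Sum>B\<in>(Basis :: 'b set). norm (T0 B - T0 B))) F"
    by (intro tendsto_intros lim)
  then have "\<forall>\<^sub>F p in F. (\<Sum>B\<in>Basis. norm (T p B - T0 B)) < c"
    by (rule order_tendstoD) (use c in simp)
  then show ?thesis
  proof eventually_elim
    case (elim p)
    show ?case
    proof
      fix H
      have L: "linear (\<lambda>H. T p H - T0 H)" by (intro linear_compose_sub T T0)
      have "T p H - T0 H = (\<Sum>B\<in>Basis. (H \<bullet> B) *\<^sub>R (T p B - T0 B))"
        using linear_sum [OF L, of "\<lambda>B. (H \<bullet> B) *\<^sub>R B" Basis] linear_scale [OF L]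
        by (simp add: euclidean_representation)
      also have "norm \<dots> \<le> (\<Sum>B\<in>Basis. norm H * norm (T p B - T0 B))"
        by (intro sum_norm_le) (auto simp: Basis_le_norm intro!: mult_right_mono)
      also have "\<dots> \<le> norm H * c"
        using elim by (simp add: mult_left_mono flip: sum_distrib_left)
      finally show "norm (T p H - T0 H) \<le> c * norm H" by (simp add: mult.commute)
    qed
  qed
qed

lemma tendsto_lowner:
  fixes W :: "nat \<Rightarrow> 'n::finite symmat"
  assumes "e \<longlonglongrightarrow> e0" "W \<longlonglongrightarrow> W0" "H \<longlonglongrightarrow> H0" "0 < e0"
  shows "(\<lambda>k. lowner (e k) (W k) (H k)) \<longlonglongrightarrow> lowner e0 W0 H0"
  by (rule tendsto_symmatI, unfold mat_of_lowner)
    (intro double_op_tendsto_sequentially assms tendsto_mat_of tendsto_huber_dd; assumption?)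

lemma tendsto_Phi_eps:
  fixes W :: "nat \<Rightarrow> 'n::finite symmat"
  assumes "e \<longlonglongrightarrow> e0" "W \<longlonglongrightarrow> W0" "0 < e0"
  shows "(\<lambda>k. Phi_eps (e k) (W k)) \<longlonglongrightarrow> Phi_eps e0 W0"
  by (rule tendsto_symmatI, unfold Phi_eps_def spectral_fun_double_op)
    (intro double_op_tendsto_sequentially [where G = "\<lambda>e x y. eps_dd e e x"] assms tendsto_const tendsto_eps_dd; assumption?)

lemma Phi_has_derivative:
  fixes W :: "'n::finite symmat"
  assumes e: "0 < e"
  shows "((\<lambda>p. Phi (fst p) (snd p)) has_derivative
    (\<lambda>q. lowner e W (snd q) + fst q *\<^sub>R Phi_eps e W)) (at (e, W))"
    (is "(?f has_derivative ?D) _")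
  unfolding has_derivative_within_alt2
proof (intro conjI allI impI)
  have "linear ?D"
    using linear_lowner [of e W]
    by (auto intro!: linearI simp: linear_add linear_scale algebra_simps)
  then show "bounded_linear ?D" by (rule linear_conv_bounded_linear [THEN iffD1])
  fix c :: real assume c: "0 < c"
  let ?T = "\<lambda>(p :: real \<times> 'n symmat). double_op (huber_dd e) (snd p) W" and ?U = "double_op (huber_dd e) W W"
  have "\<forall>\<^sub>F p in at (e, W). \<forall>H. norm (?T p H - ?U H) \<le> c / 2 * norm H"
  proof (rule eventually_opnorm_le)
    show "((\<lambda>p. ?T p B) \<longlongrightarrow> ?U B) (at (e, W))" for B
      unfolding tendsto_at_iff_sequentially o_def
    proof (intro allI impI)
      fix X assume "X \<longlonglongrightarrow> (e, W)"
      then have "(\<lambda>k. snd (X k)) \<longlonglongrightarrow> W" using tendsto_snd by fastforce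
      then show "(\<lambda>k. ?T (X k) B) \<longlonglongrightarrow> ?U B"
        by (intro double_op_tendsto_sequentially [where p = "\<lambda>_. e"] tendsto_huber_dd tendsto_const e)
    qed
  qed (use c linear_double_op in auto)
  moreover
  let ?S = "\<lambda>(p :: real \<times> 'n symmat). spectral_fun (eps_dd (fst p) e) (snd p)"
  have "(?S \<longlongrightarrow> Phi_eps e W) (at (e, W))"
    unfolding tendsto_at_iff_sequentially o_def
  proof (intro allI impI)
    fix X assume X: "X \<longlonglongrightarrow> (e, W)"
    have "(\<lambda>k. fst (X k)) \<longlonglongrightarrow> e" "(\<lambda>k. snd (X k)) \<longlonglongrightarrow> W"
      using tendsto_snd [OF X] tendsto_fst [OF X] by auto
    then have "(\<lambda>k. double_op (\<lambda>x y. eps_dd (fst (X k)) e x) (snd (X k)) (snd (X k)) (mat 1)) \<longlonglongrightarrow> double_op (\<lambda>x y. eps_dd e e x) W W (mat 1)"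
      by (intro double_op_tendsto_sequentially [where G = "\<lambda>e' x y. eps_dd e' e x"] tendsto_const tendsto_eps_dd e)
    then show "(\<lambda>k. ?S (X k)) \<longlonglongrightarrow> Phi_eps e W"
      unfolding Phi_eps_def by (intro tendsto_symmatI) (simp add: spectral_fun_double_op)
  qed
  then have "\<forall>\<^sub>F p in at (e, W). dist (?S p) (Phi_eps e W) < c / 2"
    by (rule tendstoD) (use c in simp)
  ultimately show "\<forall>\<^sub>F p in at (e, W). norm (?f p - ?f (e, W) - ?D (p - (e, W))) \<le> c * norm (p - (e, W))"
  proof eventually_elim
    case (elim p)
    let ?H = "snd p - W" and ?t = "fst p - e"
    have "mat_of (?f p - ?f (e, W) - ?D (p - (e, W)))
      = (?T p (mat_of ?H) - ?U (mat_of ?H)) + ?t *\<^sub>R mat_of (?S p - Phi_eps e W)"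
      using Phi_diff [of "fst p" "snd p" e W]
      by (simp add: minus_symmat.rep_eq plus_symmat.rep_eq scaleR_symmat.rep_eq mat_of_lowner algebra_simps)
    then have "norm (mat_of (?f p - ?f (e, W) - ?D (p - (e, W))))
      \<le> norm (?T p (mat_of ?H) - ?U (mat_of ?H)) + norm (?t *\<^sub>R mat_of (?S p - Phi_eps e W))"
      by (simp only: norm_triangle_ineq)
    then have "norm (?f p - ?f (e, W) - ?D (p - (e, W)))
      \<le> norm (?T p (mat_of ?H) - ?U (mat_of ?H)) + \<bar>?t\<bar> * norm (?S p - Phi_eps e W)"
      by (simp only: norm_mat_of norm_scaleR real_norm_def)
    also have "\<dots> \<le> c / 2 * norm ?H + \<bar>?t\<bar> * (c / 2)"
      using elim by (intro add_mono mult_left_mono) (auto simp: dist_norm norm_mat_of [symmetric])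
    also have "norm ?H \<le> norm (p - (e, W))" using norm_snd_le [of "snd p - W" "fst p - e"] by (simp add: minus_prod_def)
    also have "\<bar>?t\<bar> \<le> norm (p - (e, W))" using norm_fst_le [of "fst p - e" "snd p - W"] by (simp add: minus_prod_def)
    finally show ?case using c by simp
  qed
qed

section \<open>The Jacobian of the smoothed optimality conditions\<close>

lemma linear_op_A: "linear (op_A A)"
  by (rule linearI) (simp_all add: op_A_def vec_eq_iff inner_add_right)

lemma linear_op_A_adj: "linear (op_A_adj A)"
  by (rule linearI) (simp_all add: op_A_adj_def scaleR_add_left sum.distrib scaleR_sum_right)

lemma inner_op_A: "op_A A X \<bullet> y = X \<bullet> op_A_adj A y"
  by (simp add: op_A_def op_A_adj_def inner_vec_def inner_sum_right inner_commute mult.commute)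

lemma tendsto_linear:
  fixes f :: "'a::euclidean_space \<Rightarrow> 'b::real_normed_vector"
  assumes "linear f" "(x \<longlongrightarrow> a) F" shows "((\<lambda>k. f (x k)) \<longlongrightarrow> f a) F"
  using assms bounded_linear.tendsto linear_conv_bounded_linear by blast

definition E_jac :: "('m::finite \<Rightarrow> 'n::finite symmat) \<Rightarrow> real \<Rightarrow> real \<Rightarrow> ('m, 'n) point \<Rightarrow> ('m, 'n) point \<Rightarrow>
    (real^'m) \<times> 'n symmat \<times> 'n symmat"
  where "E_jac A \<kappa>p \<kappa>c = (\<lambda>(e, X, y, Z) (e', X', y', Z').
    (op_A A X' + ((\<kappa>p * e) *\<^sub>R y' + (\<kappa>p * e') *\<^sub>R y),
     - op_A_adj A y' - Z',
     ((1 + \<kappa>c * e) *\<^sub>R X' + (\<kappa>c * e') *\<^sub>R X)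
       - (lowner e (X - Z) (X' - Z') + e' *\<^sub>R Phi_eps e (X - Z))))"

lemma linear_E_jac: "linear (E_jac A \<kappa>p \<kappa>c w)"
  by (cases w, rule linearI)
    (simp_all add: E_jac_def case_prod_unfold linear_add [OF linear_op_A] linear_add [OF linear_op_A_adj]
      linear_scale [OF linear_op_A] linear_scale [OF linear_op_A_adj]
      linear_diff [OF linear_lowner] linear_add [OF linear_lowner] linear_scale [OF linear_lowner]
      algebra_simps)

lemma E_map_has_derivative:
  fixes A :: "'m::finite \<Rightarrow> 'n::finite symmat"
  assumes "0 < fst w"
  shows "(E_map A b C \<kappa>p \<kappa>c has_derivative E_jac A \<kappa>p \<kappa>c w) (at w)"
proof -
  obtain e X y Z where w: "w = (e, X, y, Z)" by (cases w)
  let ?X = "\<lambda>v :: ('m, 'n) point. fst (snd v)" and ?y = "\<lambda>v :: ('m, 'n) point. fst (snd (snd v))"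
    and ?Z = "\<lambda>v :: ('m, 'n) point. snd (snd (snd v))"
  let ?f = "\<lambda>v. (op_A A (?X v) + (\<kappa>p * fst v) *\<^sub>R ?y v - b, - op_A_adj A (?y v) - ?Z v + C,
     (1 + \<kappa>c * fst v) *\<^sub>R ?X v - Phi (fst v) (?X v - ?Z v))"
  have f: "((\<lambda>v. fst v) has_derivative (\<lambda>v. fst v)) (at w)" and X: "(?X has_derivative ?X) (at w)"
    and y: "(?y has_derivative ?y) (at w)" and Z: "(?Z has_derivative ?Z) (at w)"
    by (intro bounded_linear_imp_has_derivative bounded_linear_intros)+
  have p: "((\<lambda>v. (fst v, ?X v - ?Z v)) has_derivative (\<lambda>v. (fst v, ?X v - ?Z v))) (at w)"
    by (intro has_derivative_Pair has_derivative_diff f X Z)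
  have Ph: "((\<lambda>v. Phi (fst v) (?X v - ?Z v)) has_derivative
      (\<lambda>q. lowner e (X - Z) (?X q - ?Z q) + fst q *\<^sub>R Phi_eps e (X - Z))) (at w)"
  proof -
    have "((\<lambda>p. Phi (fst p) (snd p)) has_derivative
        (\<lambda>q. lowner e (X - Z) (snd q) + fst q *\<^sub>R Phi_eps e (X - Z))) (at (fst w, ?X w - ?Z w))"
      using Phi_has_derivative [of e "X - Z"] assms by (simp add: w)
    from has_derivative_compose [OF p this] show ?thesis by simp
  qed
  have lA: "((\<lambda>v. op_A A (?X v)) has_derivative (\<lambda>v. op_A A (?X v))) (at w)"
    by (rule bounded_linear.has_derivative [OF linear_op_A [THEN linear_conv_bounded_linear [THEN iffD1]] X])
  have lB: "((\<lambda>v. op_A_adj A (?y v)) has_derivative (\<lambda>v. op_A_adj A (?y v))) (at w)"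
    by (rule bounded_linear.has_derivative [OF linear_op_A_adj [THEN linear_conv_bounded_linear [THEN iffD1]] y])
  have 1: "((\<lambda>v. op_A A (?X v) + (\<kappa>p * fst v) *\<^sub>R ?y v - b) has_derivative
      (\<lambda>q. op_A A (?X q) + ((\<kappa>p * e) *\<^sub>R ?y q + (\<kappa>p * fst q) *\<^sub>R y))) (at w)"
    using has_derivative_diff [OF has_derivative_add [OF lA has_derivative_scaleR [OF has_derivative_mult_right [OF f, of \<kappa>p] y]]
        has_derivative_const [of b]] by (simp add: w)
  have 2: "((\<lambda>v. - op_A_adj A (?y v) - ?Z v + C) has_derivative (\<lambda>q. - op_A_adj A (?y q) - ?Z q)) (at w)"
    using has_derivative_add [OF has_derivative_diff [OF has_derivative_minus [OF lB] Z] has_derivative_const [of C]] by simp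
  have "((\<lambda>v. (1 + \<kappa>c * fst v) *\<^sub>R ?X v) has_derivative (\<lambda>q. (1 + \<kappa>c * e) *\<^sub>R ?X q + (\<kappa>c * fst q) *\<^sub>R X)) (at w)"
    using has_derivative_scaleR [OF has_derivative_add [OF has_derivative_const [of 1] has_derivative_mult_right [OF f, of \<kappa>c]] X]
    by (simp add: w)
  from has_derivative_diff [OF this Ph]
  have 3: "((\<lambda>v. (1 + \<kappa>c * fst v) *\<^sub>R ?X v - Phi (fst v) (?X v - ?Z v)) has_derivative
      (\<lambda>q. ((1 + \<kappa>c * e) *\<^sub>R ?X q + (\<kappa>c * fst q) *\<^sub>R X) -
        (lowner e (X - Z) (?X q - ?Z q) + fst q *\<^sub>R Phi_eps e (X - Z)))) (at w)" .
  have "(?f has_derivative E_jac A \<kappa>p \<kappa>c w) (at w)"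
    using has_derivative_Pair [OF 1 has_derivative_Pair [OF 2 3]]
    by (simp add: E_jac_def w case_prod_unfold)
  then show ?thesis
  proof (rule has_derivative_transform_within_open)
    show "open {v :: ('m, 'n) point. 0 < fst v}"
      by (intro open_Collect_less continuous_intros)
    show "?f v = E_map A b C \<kappa>p \<kappa>c v" if "v \<in> {v. 0 < fst v}" for v
      using that by (auto simp: E_map_def case_prod_unfold)
  qed (use assms in auto)
qed

lemma tendsto_E_jac:
  fixes A :: "'m::finite \<Rightarrow> 'n::finite symmat"
  assumes w: "w \<longlonglongrightarrow> w0" and d: "d \<longlonglongrightarrow> d0" and pos: "0 < fst w0"
  shows "(\<lambda>k. E_jac A \<kappa>p \<kappa>c (w k) (d k)) \<longlonglongrightarrow> E_jac A \<kappa>p \<kappa>c w0 d0"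
  unfolding E_jac_def case_prod_unfold
  by (intro tendsto_intros tendsto_linear [OF linear_op_A] tendsto_linear [OF linear_op_A_adj]
      tendsto_lowner tendsto_Phi_eps w d pos)

lemma E_map_eps_deriv_eq:
  fixes A :: "'m::finite \<Rightarrow> 'n::finite symmat"
  assumes "0 < fst w"
  shows "E_map_eps_deriv A b C \<kappa>p \<kappa>c w = E_jac A \<kappa>p \<kappa>c w (1, 0, 0, 0)"
proof -
  have E: "(E_map A b C \<kappa>p \<kappa>c has_derivative E_jac A \<kappa>p \<kappa>c w) (at (fst w, snd w))"
    using E_map_has_derivative [OF assms] by simp
  have i: "((\<lambda>e. (e, snd w)) has_derivative (\<lambda>t. (t, 0))) (at (fst w))"
    by (auto intro!: derivative_eq_intros)
  have "((\<lambda>e. E_map A b C \<kappa>p \<kappa>c (e, snd w)) has_derivative (\<lambda>t. E_jac A \<kappa>p \<kappa>c w (t, 0))) (at (fst w))"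
    by (rule has_derivative_compose [OF i E])
  moreover have "E_jac A \<kappa>p \<kappa>c w (t, 0) = t *\<^sub>R E_jac A \<kappa>p \<kappa>c w (1, 0, 0, 0)" for t
    using linear_scale [OF linear_E_jac, of A \<kappa>p \<kappa>c w t "(1, 0, 0, 0)"] by (simp add: zero_prod_def)
  ultimately have "((\<lambda>e. E_map A b C \<kappa>p \<kappa>c (e, snd w)) has_vector_derivative E_jac A \<kappa>p \<kappa>c w (1, 0, 0, 0)) (at (fst w))"
    by (simp add: has_vector_derivative_def)
  then show ?thesis unfolding E_map_eps_deriv_def by (rule vector_derivative_at)
qed

lemma tendsto_Phi:
  fixes W :: "'k \<Rightarrow> 'n::finite symmat"
  assumes e: "(e \<longlongrightarrow> e0) F" and W: "(W \<longlongrightarrow> W0) F" and pos: "\<And>k. 0 \<le> e k" "0 \<le> e0"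
  shows "((\<lambda>k. Phi (e k) (W k)) \<longlongrightarrow> Phi e0 W0) F"
proof (rule LIM_zero_cancel, rule Lim_null_comparison)
  show "\<forall>\<^sub>F k in F. norm (Phi (e k) (W k) - Phi e0 W0)
      \<le> norm (W k - W0) + \<bar>e k - e0\<bar> * norm (mat 1 :: real^'n^'n)"
    using Phi_lipschitz pos by (intro always_eventually allI) blast
  have "((\<lambda>k. norm (W k - W0) + \<bar>e k - e0\<bar> * norm (mat 1 :: real^'n^'n)) \<longlongrightarrow>
      norm (W0 - W0) + \<bar>e0 - e0\<bar> * norm (mat 1 :: real^'n^'n)) F"
    by (intro tendsto_intros e W)
  then show "((\<lambda>k. norm (W k - W0) + \<bar>e k - e0\<bar> * norm (mat 1 :: real^'n^'n)) \<longlongrightarrow> 0) F" by simp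
qed

lemma tendsto_E_hat:
  fixes A :: "'m::finite \<Rightarrow> 'n::finite symmat"
  assumes w: "(w \<longlongrightarrow> w0) F" and pos: "\<And>k. 0 \<le> fst (w k)" "0 \<le> fst w0"
  shows "((\<lambda>k. E_hat A b C \<kappa>p \<kappa>c (w k)) \<longlongrightarrow> E_hat A b C \<kappa>p \<kappa>c w0) F"
  unfolding E_hat_def E_map_def case_prod_unfold
  by (intro tendsto_intros tendsto_linear [OF linear_op_A] tendsto_linear [OF linear_op_A_adj]
      tendsto_Phi w pos)

section \<open>Nonsingularity for positive smoothing parameters\<close>

definition conj_entry :: "real^'n^'n \<Rightarrow> 'n::finite symmat \<Rightarrow> 'n \<Rightarrow> 'n \<Rightarrow> real"
  where "conj_entry P X i j = (transpose P ** mat_of X ** P) $ i $ j"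

lemma inner_conj_entry:
  assumes "orthogonal_matrix P"
  shows "X \<bullet> Y = (\<Sum>i\<in>UNIV. \<Sum>j\<in>UNIV. conj_entry P X i j * conj_entry P Y i j)"
proof -
  have "X \<bullet> Y = (transpose P ** mat_of X ** P) \<bullet> (transpose P ** mat_of Y ** P)"
    using assms by (simp add: inner_mat_of inner_orthogonal_conj orthogonal_matrix_transpose_iff)
  then show ?thesis by (simp add: inner_vec_def conj_entry_def)
qed

lemma conj_entry_eqI:
  assumes "orthogonal_matrix P" "\<And>i j. conj_entry P X i j = conj_entry P Y i j"
  shows "X = Y"
proof -
  have "P ** (transpose P ** mat_of X ** P) ** transpose P = P ** (transpose P ** mat_of Y ** P) ** transpose P"
  proof -
    have "transpose P ** mat_of X ** P = transpose P ** mat_of Y ** P"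
      using assms(2) by (simp add: conj_entry_def vec_eq_iff)
    then show ?thesis by (simp only:)
  qed
  then show ?thesis by (simp add: matrix_mul_assoc orthogonalD [OF assms(1)] mat_of_inject)
qed

lemma conj_entry_linear:
  "conj_entry P (X + Y) i j = conj_entry P X i j + conj_entry P Y i j"
  "conj_entry P (X - Y) i j = conj_entry P X i j - conj_entry P Y i j"
  "conj_entry P (c *\<^sub>R X) i j = c * conj_entry P X i j"
  "conj_entry P (- X) i j = - conj_entry P X i j"
  "conj_entry P 0 i j = 0"
  by (simp_all add: conj_entry_def plus_symmat.rep_eq minus_symmat.rep_eq uminus_symmat.rep_eq zero_symmat.rep_eq
      scaleR_symmat.rep_eq linear_add [OF linear_sandwich] linear_diff [OF linear_sandwich] linear_neg [OF linear_sandwich]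
      linear_scale [OF linear_sandwich] linear_0 [OF linear_sandwich])

lemma conj_entry_lowner:
  assumes "eigdec W P d"
  shows "conj_entry P (lowner e W H) i j = huber_dd e (d $ i) (d $ j) * conj_entry P H i j"
proof -
  have o: "orthogonal_matrix P" using assms by (simp add: eigdec_def)
  show ?thesis
    by (simp add: conj_entry_def mat_of_lowner double_op_eq [OF assms assms] schur_conj_def matrix_mul_assoc orthogonalD [OF o])
qed

text \<open>The sign argument behind both nonsingularity results. The third block of a Jacobian equation reads, in
an eigenbasis, \<open>c u = \<omega> (u - v)\<close> for the entries \<open>u\<close> of \<open>\<Delta>X\<close> and \<open>v\<close> of \<open>\<Delta>Z\<close>; it forces them to have
opposite signs, whereas the first two blocks make the inner product of \<open>\<Delta>X\<close> and \<open>\<Delta>Z\<close> nonnegative.\<close>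

lemma complementary_sign:
  fixes u v \<omega> c :: real
  assumes "c * u = \<omega> * (u - v)" "0 \<le> \<omega>" "\<omega> \<le> c" "0 < c"
  shows "u * v \<le> 0"
proof (cases "\<omega> = 0")
  case False
  then have w: "0 < \<omega>" using assms by simp
  have "\<omega> * (u * v) = - ((c - \<omega>) * u\<^sup>2)"
  proof -
    have "\<omega> * v = (\<omega> - c) * u" using assms(1) by (simp add: algebra_simps)
    then have "\<omega> * (u * v) = u * ((\<omega> - c) * u)" by (metis mult.left_commute)
    then show ?thesis by (simp add: algebra_simps power2_eq_square)
  qed
  also have "\<dots> \<le> 0" using assms by simp
  finally show ?thesis using w by (simp add: mult_le_0_iff)
qed (use assms in simp)

text \<open>The first two blocks give \<open>\<langle>\<Delta>X, \<Delta>Z\<rangle> = \<kappa>p \<epsilon> |\<Delta>y|\<^sup>2\<close>, the third gives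
\<open>\<langle>\<Delta>X, \<Delta>Z\<rangle> \<le> 0\<close>. Hence \<open>\<Delta>y = 0\<close> and \<open>\<Delta>Z = 0\<close>, and \<open>1 + \<kappa>c \<epsilon> > 1 \<ge> \<omega>\<close> then gives \<open>\<Delta>X = 0\<close>.\<close>

lemma E_jac_nonsingular:
  fixes A :: "'m::finite \<Rightarrow> 'n::finite symmat"
  assumes pos: "0 < fst w" "0 < \<kappa>p" "0 < \<kappa>c" and d: "fst d = 0" "E_jac A \<kappa>p \<kappa>c w d = 0"
  shows "d = 0"
proof -
  obtain e X y Z where w: "w = (e, X, y, Z)" by (cases w)
  obtain U v V where dd: "d = (0, U, v, V)" using d(1) by (cases d) auto
  have e: "0 < e" using pos w by simp
  have 1: "op_A A U + (\<kappa>p * e) *\<^sub>R v = 0" and 2: "- op_A_adj A v - V = 0"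
    and 3: "(1 + \<kappa>c * e) *\<^sub>R U - lowner e (X - Z) (U - V) = 0"
    using d(2) by (simp_all add: E_jac_def w dd zero_prod_def)
  have 2: "V = - op_A_adj A v" using 2 by simp
  obtain P l where P: "eigdec (X - Z) P l" using eigdec_exists by blast
  then have o: "orthogonal_matrix P" by (simp add: eigdec_def)
  define \<omega> where "\<omega> i j = huber_dd e (l $ i) (l $ j)" for i j
  have \<omega>: "0 \<le> \<omega> i j" "\<omega> i j \<le> 1" for i j using huber_dd_range e by (simp_all add: \<omega>_def)
  have c: "1 < 1 + \<kappa>c * e" using e pos by simp
  have ent: "(1 + \<kappa>c * e) * conj_entry P U i j = \<omega> i j * (conj_entry P U i j - conj_entry P V i j)" for i j
    using arg_cong [OF 3, of "\<lambda>M. conj_entry P M i j"]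
    by (simp del: add_uminus_conv_diff eq_iff_diff_eq_0 right_minus_eq add: conj_entry_lowner [OF P] conj_entry_linear \<omega>_def)
  have UV: "U \<bullet> V = - (op_A A U \<bullet> v)" by (simp add: 2 inner_op_A)
  have "op_A A U = - ((\<kappa>p * e) *\<^sub>R v)" using 1 by (simp only: eq_neg_iff_add_eq_0)
  then have "U \<bullet> V = \<kappa>p * e * (v \<bullet> v)" unfolding UV by simp
  moreover have "U \<bullet> V \<le> 0"
    unfolding inner_conj_entry [OF o]
    by (intro sum_nonpos complementary_sign [OF ent]) (use \<omega> c in \<open>auto intro: order_trans [OF \<omega>(2)]\<close>)
  ultimately have "\<kappa>p * e * (v \<bullet> v) \<le> 0" by simp
  moreover have "0 < \<kappa>p * e" using pos e by simp
  ultimately have "v \<bullet> v \<le> 0" by (metis mult_pos_pos not_le)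
  then have v: "v = 0" using inner_ge_zero [of v] inner_eq_zero_iff [of v] by linarith
  then have V: "V = 0" using 2 linear_0 [OF linear_op_A_adj] by simp
  have "conj_entry P U i j = 0" for i j
  proof -
    have "(1 + \<kappa>c * e - \<omega> i j) * conj_entry P U i j = 0"
      using ent [of i j] by (simp add: V conj_entry_linear algebra_simps)
    then show ?thesis using \<omega>(2) [of i j] c by auto
  qed
  then have "U = 0" using conj_entry_eqI [OF o, of U 0] by (simp add: conj_entry_linear)
  then show ?thesis by (simp add: dd v V zero_prod_def)
qed

section \<open>Sufficient decrease away from solutions\<close>

text \<open>The Armijo condition for an approximate zero of a linear model. Here \<open>a\<close> is the current residual, \<open>v\<close> its
directional derivative and \<open>a'\<close> the residual after a step of length \<open>t\<close>. Up to the two errors \<open>a'\<close> equals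
\<open>(1 - t) a\<close>, and \<open>\<sigma> < 1\<close> leaves room for both.\<close>

lemma sufficient_decrease:
  fixes a v a' :: "'a::real_normed_vector"
  assumes res: "norm (a + v) \<le> \<delta> * norm a"
    and err: "norm (a' - a - t *\<^sub>R v) \<le> t * ((1 - \<delta>) * (1 - \<sigma>) / 2 * norm a)"
    and t: "0 \<le> t" "t \<le> 1 - \<sigma>" and \<delta>: "0 \<le> \<delta>" "\<delta> < 1" and \<sigma>: "0 < \<sigma>" "\<sigma> < 1"
  shows "(norm a')\<^sup>2 \<le> (1 - 2 * \<sigma> * (1 - \<delta>) * t) * (norm a)\<^sup>2"
proof -
  define u where "u = t * (1 - \<delta>)"
  have u: "0 \<le> u" "u \<le> 1 - \<sigma>"
    using t \<delta> mult_left_le [of "1 - \<delta>" t] by (auto simp: u_def)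
  have "norm a' = norm ((1 - t) *\<^sub>R a + t *\<^sub>R (a + v) + (a' - a - t *\<^sub>R v))"
    by (simp add: algebra_simps)
  also have "\<dots> \<le> norm ((1 - t) *\<^sub>R a) + norm (t *\<^sub>R (a + v)) + norm (a' - a - t *\<^sub>R v)"
    by (meson norm_triangle_ineq norm_triangle_le add_right_mono order_trans)
  also have "\<dots> \<le> (1 - t) * norm a + t * (\<delta> * norm a) + t * ((1 - \<delta>) * (1 - \<sigma>) / 2 * norm a)"
    using t \<sigma> res err by (auto intro!: add_mono mult_left_mono)
  also have "\<dots> = (1 - (1 + \<sigma>) / 2 * u) * norm a"
    by (simp add: u_def field_simps)
  finally have "(norm a')\<^sup>2 \<le> ((1 - (1 + \<sigma>) / 2 * u) * norm a)\<^sup>2"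
    by (intro power_mono) auto
  also have "\<dots> = (1 - (1 + \<sigma>) * u + ((1 + \<sigma>) / 2 * u)\<^sup>2) * (norm a)\<^sup>2"
    by (simp add: power2_eq_square field_simps)
  also have "\<dots> \<le> (1 - 2 * \<sigma> * u) * (norm a)\<^sup>2"
  proof (rule mult_right_mono)
    have "((1 + \<sigma>) / 2 * u)\<^sup>2 \<le> u\<^sup>2"
      using u \<sigma> by (intro power_mono mult_left_le_one_le) auto
    also have "\<dots> \<le> (1 - \<sigma>) * u" using u by (simp add: power2_eq_square mult_right_mono)
    finally show "1 - (1 + \<sigma>) * u + ((1 + \<sigma>) / 2 * u)\<^sup>2 \<le> 1 - 2 * \<sigma> * u"
      by (simp add: algebra_simps)
  qed simp
  finally show ?thesis by (simp add: u_def mult_ac)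
qed

text \<open>In the locales \<open>F\<close> is \<open>E_hat\<close> and \<open>J\<close> is its derivative where the smoothing parameter is positive.\<close>

locale sdp =
  fixes A :: "'m::finite \<Rightarrow> 'n::finite symmat" and b :: "real ^ 'm" and C :: "'n symmat"
    and \<kappa>p \<kappa>c :: real
  assumes kappa: "0 < \<kappa>p" "0 < \<kappa>c"
begin

definition F :: "('m, 'n) point \<Rightarrow> real \<times> (real ^ 'm) \<times> 'n symmat \<times> 'n symmat"
  where "F = E_hat A b C \<kappa>p \<kappa>c"

definition J :: "('m, 'n) point \<Rightarrow> ('m, 'n) point \<Rightarrow> real \<times> (real ^ 'm) \<times> 'n symmat \<times> 'n symmat"
  where "J w d = (fst d, E_jac A \<kappa>p \<kappa>c w d)"

lemma linear_J: "linear (J w)"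
  by (rule linearI) (simp_all add: J_def linear_add [OF linear_E_jac] linear_scale [OF linear_E_jac])

lemma F_has_derivative: "0 < fst w \<Longrightarrow> (F has_derivative J w) (at w)"
  unfolding F_def J_def E_hat_def
  by (intro has_derivative_Pair E_map_has_derivative bounded_linear_imp_has_derivative bounded_linear_intros)

lemma tendsto_F:
  assumes "(w \<longlongrightarrow> w0) G" "\<And>k. 0 \<le> fst (w k)" "0 \<le> fst w0"
  shows "((\<lambda>k. F (w k)) \<longlongrightarrow> F w0) G"
  unfolding F_def using assms by (rule tendsto_E_hat)

lemma fst_F: "fst (F w) = fst w"
  by (simp add: F_def E_hat_def)

lemma J_eventually_close:
  assumes "0 < fst w" "0 < c"
  shows "\<forall>\<^sub>F v in nhds w. \<forall>d. norm (J v d - J w d) \<le> c * norm d"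
proof -
  have "\<forall>\<^sub>F v in at w. \<forall>d. norm (J v d - J w d) \<le> c * norm d"
  proof (rule eventually_opnorm_le)
    show "((\<lambda>v. J v B) \<longlongrightarrow> J w B) (at w)" for B
      unfolding tendsto_at_iff_sequentially o_def J_def
      by (intro allI impI tendsto_intros tendsto_E_jac assms)
  qed (use linear_J assms in auto)
  then show ?thesis using assms by (auto simp: eventually_at_filter elim!: eventually_mono)
qed

lemma J_locally_close:
  assumes w: "0 < fst w" and c: "0 < c"
  shows "\<exists>R>0. \<forall>v\<in>ball w R. 0 < fst v \<and> (\<forall>d. norm (J v d - J w d) \<le> c * norm d)"
proof -
  have "\<forall>\<^sub>F v in nhds w. 0 < fst v"
    using order_tendstoD(1) [OF tendsto_fst [OF filterlim_ident] w] .
  with J_eventually_close [OF w c]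
  have "\<forall>\<^sub>F v in nhds w. 0 < fst v \<and> (\<forall>d. norm (J v d - J w d) \<le> c * norm d)"
    by eventually_elim simp
  then show ?thesis
    unfolding eventually_nhds_metric Ball_def mem_ball dist_commute [of w] .
qed

text \<open>The linearization at any point \<open>u\<close> near \<open>w\<close> is accurate, with a constant that does not depend on \<open>u\<close>; this
uniformity is what the line search needs, since its base point moves.\<close>

lemma F_locally_linear:
  assumes w: "0 < fst w" and c: "0 < c"
  obtains R where "0 < R" "\<And>u v. u \<in> ball w R \<Longrightarrow> v \<in> ball w R \<Longrightarrow> norm (F v - F u - J u (v - u)) \<le> c * norm (v - u)"
proof -
  obtain R where R: "0 < R" "\<forall>v\<in>ball w R. 0 < fst v \<and> (\<forall>d. norm (J v d - J w d) \<le> c / 2 * norm d)"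
    using J_locally_close [OF w half_gt_zero [OF c]] by blast
  have pos: "0 < fst v" and close: "norm (J v d - J w d) \<le> c / 2 * norm d" if "v \<in> ball w R" for v d
    using R(2) that by blast+
  show thesis
  proof (rule that [OF R(1)])
    fix u v assume u: "u \<in> ball w R" and v: "v \<in> ball w R"
    have "norm (F v - F u - J u (v - u)) \<le> norm (v - u) * c"
    proof (rule differentiable_bound_linearization [where S = "ball w R"])
      show "u + t *\<^sub>R (v - u) \<in> ball w R" if "t \<in> {0..1}" for t
        using convexD_alt [OF convex_ball u v, of t] that by (simp add: algebra_simps)
      show "(F has_derivative J x) (at x within ball w R)" if "x \<in> ball w R" for x
        using F_has_derivative [OF pos [OF that]] by (rule has_derivative_at_withinI)
      show "onorm (J x - J u) \<le> c" if "x \<in> ball w R" for x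
        unfolding fun_diff_def
      proof (rule onorm_le)
        fix d
        have "J x d - J u d = (J x d - J w d) - (J u d - J w d)" by simp
        also have "norm \<dots> \<le> c / 2 * norm d + c / 2 * norm d"
          by (rule order_trans [OF norm_triangle_ineq4 add_mono [OF close [OF that] close [OF u]]])
        finally show "norm (J x d - J u d) \<le> c * norm d" by simp
      qed
    qed (rule u)
    then show "norm (F v - F u - J u (v - u)) \<le> c * norm (v - u)" by (simp add: mult.commute)
  qed
qed

lemma J_locally_invertible:
  assumes w: "0 < fst w"
  obtains R m where "0 < R" "0 < m" "\<And>v d. v \<in> ball w R \<Longrightarrow> norm d \<le> m * norm (J v d)"
proof -
  have "inj (J w)"
    unfolding linear_injective_0 [OF linear_J]
    using E_jac_nonsingular [OF w kappa] by (auto simp: J_def zero_prod_def)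
  then have "\<exists>B>0. \<forall>d. B * norm d \<le> norm (J w d)"
    by (rule linear_inj_bounded_below_pos [OF linear_J]) (intro exI conjI allI; assumption)
  then obtain B where B0: "0 < B" and B1: "\<forall>d. B * norm d \<le> norm (J w d)" by (elim exE conjE) (rule that)
  note B = B0 B1 [rule_format]
  obtain R where R: "0 < R" "\<forall>v\<in>ball w R. 0 < fst v \<and> (\<forall>d. norm (J v d - J w d) \<le> B / 2 * norm d)"
    using J_locally_close [OF w half_gt_zero [OF B0]] by blast
  show thesis
  proof (rule that [OF R(1), of "2 / B"])
    fix v d assume "v \<in> ball w R"
    have "norm (J w d) \<le> norm (J v d) + norm (J v d - J w d)"
      using norm_triangle_ineq4 [of "J v d" "J v d - J w d"] by simp
    moreover have "norm (J v d - J w d) \<le> B / 2 * norm d" using R(2) \<open>v \<in> ball w R\<close> by blast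
    ultimately have "B / 2 * norm d \<le> norm (J v d)" using B(2) [of d] by simp
    then show "norm d \<le> 2 / B * norm (J v d)" using B(1) by (simp add: field_simps)
  qed (use B in simp)
qed

text \<open>Near a point with positive smoothing parameter and nonzero residual, all approximate Newton directions
are bounded, and therefore all steps up to some common length \<open>t0\<close> are acceptable.\<close>

lemma local_decrease:
  assumes w: "0 < fst w" "F w \<noteq> 0" and \<delta>: "0 \<le> \<delta>" "\<delta> < 1" and \<sigma>: "0 < \<sigma>" "\<sigma> < 1"
  obtains R t0 where "0 < R" "0 < t0" "\<And>v d t. v \<in> ball w R \<Longrightarrow> norm (F v + J v d) \<le> \<delta> * norm (F v) \<Longrightarrow>
    0 \<le> t \<Longrightarrow> t \<le> t0 \<Longrightarrow> (norm (F (v + t *\<^sub>R d)))\<^sup>2 \<le> (1 - 2 * \<sigma> * (1 - \<delta>) * t) * (norm (F v))\<^sup>2"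
proof -
  define N where "N = norm (F w)"
  have N: "0 < N" using w(2) by (simp add: N_def)
  obtain R1 m where R1: "0 < R1" "0 < m" "\<And>v d. v \<in> ball w R1 \<Longrightarrow> norm d \<le> m * norm (J v d)"
    using J_locally_invertible [OF w(1)] by blast
  define D where "D = 4 * m * N"
  have D: "0 < D" using R1 N by (simp add: D_def)
  define c where "c = (1 - \<delta>) * (1 - \<sigma>) / 2 * (N / 2) / D"
  have c: "0 < c" using \<delta> \<sigma> N D by (simp add: c_def)
  obtain R2 where R2: "0 < R2"
    "\<And>u v. u \<in> ball w R2 \<Longrightarrow> v \<in> ball w R2 \<Longrightarrow> norm (F v - F u - J u (v - u)) \<le> c * norm (v - u)"
    using F_locally_linear [OF w(1) c] by blast
  have "isCont F w" using F_has_derivative [OF w(1)] by (rule has_derivative_continuous)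
  from this [unfolded continuous_at_eps_delta, rule_format, OF half_gt_zero [OF N]]
  obtain R3 where R3: "0 < R3" "\<And>v. dist v w < R3 \<Longrightarrow> dist (F v) (F w) < N / 2"
    by blast
  define R where "R = min R1 (min (R2 / 2) R3)"
  define t0 where "t0 = min (1 - \<sigma>) (R2 / (2 * D))"
  show thesis
  proof (rule that)
    show "0 < R" "0 < t0" using R1 R2 R3 \<sigma> D by (simp_all add: R_def t0_def)
    fix v d t assume v: "v \<in> ball w R" and res: "norm (F v + J v d) \<le> \<delta> * norm (F v)"
      and t: "0 \<le> t" "t \<le> t0"
    have "dist (F v) (F w) < N / 2" using R3 v by (simp add: R_def dist_commute)
    then have "\<bar>norm (F v) - N\<bar> < N / 2"
      using norm_triangle_ineq3 [of "F v" "F w"] unfolding dist_norm N_def by linarith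
    then have n: "N / 2 \<le> norm (F v)" "norm (F v) \<le> 2 * N"
      using N by linarith+
    have "norm (J v d) \<le> norm (F v + J v d) + norm (F v)"
      using norm_triangle_ineq4 [of "F v + J v d" "F v"] by simp
    also have "\<dots> \<le> 1 * norm (F v) + norm (F v)"
      by (intro add_mono order_trans [OF res] mult_right_mono) (use \<delta> in auto)
    also have "\<dots> \<le> 4 * N" using n by simp
    finally have "m * norm (J v d) \<le> D" using R1(2) by (simp add: D_def)
    then have d: "norm d \<le> D" using R1(3) [of v d] v by (simp add: R_def)
    have "t * norm d \<le> R2 / (2 * D) * D"
      by (rule mult_mono) (use t d D R2(1) in \<open>auto simp: t0_def\<close>)
    then have td: "norm (t *\<^sub>R d) \<le> R2 / 2" using D t by simp
    have vR: "v \<in> ball w R2" using v R2(1) by (simp add: R_def)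
    have "dist w (v + t *\<^sub>R d) \<le> dist w v + norm (t *\<^sub>R d)"
      using dist_triangle [of w "v + t *\<^sub>R d" v] by (simp add: dist_norm)
    also have "\<dots> < R2" using td v by (simp add: R_def)
    finally have "norm (F (v + t *\<^sub>R d) - F v - J v (t *\<^sub>R d)) \<le> c * norm (t *\<^sub>R d)"
      using R2(2) [OF vR, of "v + t *\<^sub>R d"] by simp
    also have "\<dots> = t * (c * norm d)" using t by simp
    also have "\<dots> \<le> t * (c * D)" using t d c by (intro mult_left_mono) auto
    also have "c * D = (1 - \<delta>) * (1 - \<sigma>) / 2 * (N / 2)" using D by (simp add: c_def)
    also have "t * \<dots> \<le> t * ((1 - \<delta>) * (1 - \<sigma>) / 2 * norm (F v))"
      using n t \<delta> \<sigma> by (intro mult_left_mono) auto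
    finally show "(norm (F (v + t *\<^sub>R d)))\<^sup>2 \<le> (1 - 2 * \<sigma> * (1 - \<delta>) * t) * (norm (F v))\<^sup>2"
      unfolding linear_scale [OF linear_J]
      by (rule sufficient_decrease [OF res _ _ _ \<delta> \<sigma>]) (use t in \<open>auto simp: t0_def\<close>)
  qed
qed

end

section \<open>Accumulation points of the Newton iterates\<close>

locale ssn = sdp A b C \<kappa>p \<kappa>c
  for A :: "'m::finite \<Rightarrow> 'n::finite symmat" and b C \<kappa>p \<kappa>c +
  fixes eh r rh \<eta>h \<rho> \<sigma> \<tau> :: real and w :: "nat \<Rightarrow> ('m, 'n) point"
  assumes params: "0 < eh" "0 < r" "r < 1" "0 < rh" "0 < \<eta>h" "\<eta>h < 1"
    "sqrt 2 * max (r * eh) \<eta>h < 1" "0 < \<rho>" "\<rho> < 1" "0 < \<sigma>" "\<sigma> < 1 / 2" "0 < \<tau>" "\<tau> \<le> 1"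
    and run: "ssn_sequence A b C \<kappa>p \<kappa>c eh r rh \<eta>h \<rho> \<sigma> \<tau> w"
begin

definition \<delta> :: real where "\<delta> = sqrt 2 * max (r * eh) \<eta>h"

lemma delta: "0 \<le> \<delta>" "\<delta> < 1"
  using params by (auto simp: \<delta>_def le_max_iff_disj)

definition direction :: "('m, 'n) point \<Rightarrow> ('m, 'n) point \<Rightarrow> bool"
  where "direction = inexact_newton_direction A b C \<kappa>p \<kappa>c eh r rh \<eta>h \<tau>"

definition accepts :: "('m, 'n) point \<Rightarrow> ('m, 'n) point \<Rightarrow> nat \<Rightarrow> bool"
  where "accepts v d l \<longleftrightarrow> (norm (F (v + \<rho> ^ l *\<^sub>R d)))\<^sup>2 \<le> (1 - 2 * \<sigma> * (1 - \<delta>) * \<rho> ^ l) * (norm (F v))\<^sup>2"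

lemma start: "fst (w 0) = eh" and F_nonzero: "F (w k) \<noteq> 0"
  using run by (auto simp: ssn_sequence_def Let_def F_def)

lemma step:
  obtains d l where "direction (w k) d" "accepts (w k) d l" "\<And>j. j < l \<Longrightarrow> \<not> accepts (w k) d j"
    "w (Suc k) = w k + \<rho> ^ l *\<^sub>R d"
proof -
  have "\<exists>d l. direction (w k) d \<and> accepts (w k) d l \<and> (\<forall>j<l. \<not> accepts (w k) d j) \<and>
      w (Suc k) = w k + \<rho> ^ l *\<^sub>R d"
    using run
    unfolding ssn_sequence_def Let_def direction_def accepts_def F_def line_search_accepts_def merit_def \<delta>_def
    by blast
  then show thesis using that by blast
qed

lemma direction_residual:
  assumes "0 < fst v" "direction v d"
  shows "fst (F v + J v d) = zeta r \<tau> (norm (F v)) * eh"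
    "norm (snd (F v + J v d)) \<le> eta rh \<tau> (norm (F v)) *
        norm (E_map A b C \<kappa>p \<kappa>c v + fst d *\<^sub>R E_jac A \<kappa>p \<kappa>c v (1, 0, 0, 0))"
    "norm (snd (F v + J v d)) \<le> \<eta>h * norm (F v)"
proof -
  have fd: "frechet_derivative (E_map A b C \<kappa>p \<kappa>c) (at v) = E_jac A \<kappa>p \<kappa>c v"
    using frechet_derivative_at [OF E_map_has_derivative [OF assms(1)]] by simp
  have raw: "fst d = - fst v + zeta r \<tau> (norm (F v)) * eh"
    "norm (E_map A b C \<kappa>p \<kappa>c v + E_jac A \<kappa>p \<kappa>c v d) \<le> eta rh \<tau> (norm (F v)) *
        norm (E_map A b C \<kappa>p \<kappa>c v + fst d *\<^sub>R E_jac A \<kappa>p \<kappa>c v (1, 0, 0, 0))"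
    "norm (E_map A b C \<kappa>p \<kappa>c v + E_jac A \<kappa>p \<kappa>c v d) \<le> \<eta>h * norm (F v)"
    using assms(2)
    unfolding direction_def inexact_newton_direction_def Let_def fd E_map_eps_deriv_eq [OF assms(1)] F_def [symmetric] min.bounded_iff
    by blast+
  have eq: "fst (F v + J v d) = fst v + fst d" "snd (F v + J v d) = E_map A b C \<kappa>p \<kappa>c v + E_jac A \<kappa>p \<kappa>c v d"
    by (simp_all add: F_def E_hat_def J_def)
  show "fst (F v + J v d) = zeta r \<tau> (norm (F v)) * eh" unfolding eq raw(1) by simp
  show "norm (snd (F v + J v d)) \<le> eta rh \<tau> (norm (F v)) *
        norm (E_map A b C \<kappa>p \<kappa>c v + fst d *\<^sub>R E_jac A \<kappa>p \<kappa>c v (1, 0, 0, 0))"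
    unfolding eq by (rule raw(2))
  show "norm (snd (F v + J v d)) \<le> \<eta>h * norm (F v)" unfolding eq by (rule raw(3))
qed

lemma zeta_bounds:
  assumes "0 < x" shows "0 < zeta r \<tau> x" "zeta r \<tau> x \<le> r" "zeta r \<tau> x \<le> r * x" "zeta r \<tau> x \<le> r * x powr (1 + \<tau>)"
proof -
  have "x powr (1 + \<tau>) \<le> x powr 1" if "x \<le> 1" using that assms params by (intro powr_mono') auto
  then have "min 1 (x powr (1 + \<tau>)) \<le> x" using assms by (cases "x \<le> 1") auto
  then show "zeta r \<tau> x \<le> r * x" using params by (simp add: zeta_def)
qed (use params assms in \<open>auto simp: zeta_def\<close>)

text \<open>Both blocks of the residual are at most \<open>max (r * eh) \<eta>h\<close> times the norm of \<open>F v\<close>; adding two squares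
costs the factor \<open>sqrt 2\<close> in \<open>\<delta>\<close>.\<close>

lemma residual_le:
  assumes "0 < fst v" "direction v d" "F v \<noteq> 0"
  shows "norm (F v + J v d) \<le> \<delta> * norm (F v)"
proof -
  define n where "n = norm (F v)"
  define M where "M = max (r * eh) \<eta>h"
  have n: "0 < n" using assms(3) by (simp add: n_def)
  have M: "0 \<le> M" using params by (simp add: M_def le_max_iff_disj)
  have "norm (fst (F v + J v d)) \<le> M * n"
  proof -
    have "zeta r \<tau> n * eh \<le> (r * n) * eh" using zeta_bounds(3) [OF n] params by (intro mult_right_mono) auto
    also have "\<dots> = (r * eh) * n" by simp
    also have "\<dots> \<le> M * n" using n by (intro mult_right_mono) (auto simp: M_def)
    finally show ?thesis
      using direction_residual(1) [OF assms(1,2)] zeta_bounds(1) [OF n] params by (simp add: n_def)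
  qed
  moreover have "norm (snd (F v + J v d)) \<le> M * n"
  proof -
    have "norm (snd (F v + J v d)) \<le> \<eta>h * n" using direction_residual(3) [OF assms(1,2)] by (simp add: n_def)
    also have "\<dots> \<le> M * n" using n by (intro mult_right_mono) (auto simp: M_def)
    finally show ?thesis .
  qed
  ultimately have "(norm (fst (F v + J v d)))\<^sup>2 + (norm (snd (F v + J v d)))\<^sup>2 \<le> (M * n)\<^sup>2 + (M * n)\<^sup>2"
    by (intro add_mono power_mono) auto
  then have "norm (F v + J v d) \<le> sqrt (2 * (M * n)\<^sup>2)"
    unfolding norm_prod_def by (intro real_sqrt_le_mono) simp
  also have "\<dots> = \<delta> * n" using M n by (simp add: \<delta>_def M_def real_sqrt_mult)
  finally show ?thesis by (simp add: n_def)
qed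

lemma decrease_factor: "0 \<le> 1 - 2 * \<sigma> * (1 - \<delta>) * \<rho> ^ l" "1 - 2 * \<sigma> * (1 - \<delta>) * \<rho> ^ l \<le> 1"
proof -
  have "2 * \<sigma> * (1 - \<delta>) * \<rho> ^ l \<le> 1 * 1 * 1"
    using params delta by (intro mult_mono power_le_one) auto
  then show "0 \<le> 1 - 2 * \<sigma> * (1 - \<delta>) * \<rho> ^ l" by simp
  show "1 - 2 * \<sigma> * (1 - \<delta>) * \<rho> ^ l \<le> 1" using params delta by simp
qed

lemma norm_F_decseq: "norm (F (w (Suc k))) \<le> norm (F (w k))"
proof -
  obtain d l where s: "accepts (w k) d l" "w (Suc k) = w k + \<rho> ^ l *\<^sub>R d" using step [of k] by metis
  then have "(norm (F (w (Suc k))))\<^sup>2 \<le> 1 * (norm (F (w k)))\<^sup>2"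
    unfolding accepts_def s(2) using decrease_factor(2) by (meson mult_right_mono order_trans zero_le_power2)
  then show ?thesis by (simp add: power2_le_iff_abs_le)
qed

text \<open>The step moves \<open>\<epsilon>\<close> towards the target \<open>\<zeta> \<epsilon>\<close>-hat without passing it, and the target decreases along with the
merit function. This keeps \<open>\<epsilon>\<close> positive, and bounded away from 0 as long as the merit function is.\<close>

lemma eps_lower: "zeta r \<tau> (norm (F (w k))) * eh \<le> fst (w k)"
proof (induction k)
  case 0
  have "zeta r \<tau> (norm (F (w 0))) * eh \<le> 1 * eh"
    using zeta_bounds(2) [of "norm (F (w 0))"] F_nonzero params by (intro mult_right_mono) auto
  then show ?case by (simp add: start)
next
  case (Suc k)
  define z where "z k = zeta r \<tau> (norm (F (w k))) * eh" for k
  have "0 < zeta r \<tau> (norm (F (w k))) * eh"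
    using zeta_bounds(1) [of "norm (F (w k))"] F_nonzero params by (intro mult_pos_pos) auto
  then have pos: "0 < fst (w k)" using Suc.IH by simp
  obtain d l where s: "direction (w k) d" "w (Suc k) = w k + \<rho> ^ l *\<^sub>R d" using step [of k] by metis
  have "fst d = z k - fst (w k)"
    using direction_residual(1) [OF pos s(1)] by (simp add: z_def J_def fst_F)
  then have "fst (w (Suc k)) = (1 - \<rho> ^ l) * fst (w k) + \<rho> ^ l * z k"
    unfolding s(2) by (simp add: right_diff_distrib left_diff_distrib)
  also have "\<dots> \<ge> (1 - \<rho> ^ l) * z k + \<rho> ^ l * z k"
    using Suc.IH params by (intro add_right_mono mult_left_mono) (auto simp: z_def power_le_one)
  finally have "z k \<le> fst (w (Suc k))" by (simp add: algebra_simps)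
  moreover have "z (Suc k) \<le> z k"
    unfolding z_def zeta_def using norm_F_decseq [of k] params
    by (intro mult_right_mono mult_left_mono min.mono powr_mono2) auto
  ultimately show ?case by (simp add: z_def)
qed

lemma eps_pos: "0 < fst (w k)"
proof -
  have "0 < zeta r \<tau> (norm (F (w k))) * eh"
    using zeta_bounds(1) [of "norm (F (w k))"] F_nonzero params by (intro mult_pos_pos) auto
  then show ?thesis using eps_lower [of k] by simp
qed

lemma step_residual: "direction (w k) d \<Longrightarrow> norm (F (w k) + J (w k) d) \<le> \<delta> * norm (F (w k))"
  by (rule residual_le [OF eps_pos _ F_nonzero])

text \<open>If the residual at the accumulation point were nonzero, the smoothing parameter there would be positive
by \<open>eps_lower\<close>. Then \<open>local_decrease\<close> bounds the accepted step lengths from below, and each of the infinitely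
many visits to the neighbourhood multiplies the merit function by at most some \<open>q < 1\<close>, although it
never falls below its positive limit.\<close>

lemma accumulation_point_solves:
  assumes s: "strict_mono s" and lim: "(w \<circ> s) \<longlonglongrightarrow> wb"
  shows "F wb = 0"
proof (rule ccontr)
  assume nz: "F wb \<noteq> 0"
  have eps0: "0 \<le> fst wb"
    using tendsto_fst [OF lim] by (rule LIMSEQ_le_const) (auto simp: o_def less_imp_le eps_pos)
  have Flim: "(\<lambda>k. norm (F (w (s k)))) \<longlonglongrightarrow> norm (F wb)"
    using tendsto_norm [OF tendsto_F [OF lim _ eps0]] eps_pos by (simp add: o_def less_imp_le)
  have mono: "decseq (\<lambda>k. norm (F (w k)))" by (rule decseq_SucI) (rule norm_F_decseq)
  have ge: "norm (F wb) \<le> norm (F (w k))" for k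
  proof (rule LIMSEQ_le_const2 [OF Flim], intro exI allI impI)
    fix j assume "k \<le> j"
    then have "k \<le> s j" using seq_suble [OF s, of j] by simp
    then show "norm (F (w (s j))) \<le> norm (F (w k))" using mono by (simp add: decseq_def)
  qed
  have zeta_mono: "zeta r \<tau> (norm (F wb)) \<le> zeta r \<tau> (norm (F (w k)))" for k
    unfolding zeta_def using ge [of k] params
    by (intro mult_left_mono min.mono powr_mono2) auto
  have pos: "0 < fst wb"
  proof -
    have "zeta r \<tau> (norm (F wb)) * eh \<le> fst (w k)" for k
      by (rule order_trans [OF mult_right_mono [OF zeta_mono] eps_lower]) (use params in simp)
    then have "zeta r \<tau> (norm (F wb)) * eh \<le> fst wb"
      using tendsto_fst [OF lim] by (intro LIMSEQ_le_const) (auto simp: o_def)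
    moreover have "0 < zeta r \<tau> (norm (F wb)) * eh"
      using zeta_bounds(1) [of "norm (F wb)"] nz params by (intro mult_pos_pos) auto
    ultimately show ?thesis by simp
  qed
  have \<sigma>: "0 < \<sigma>" "\<sigma> < 1" using params by auto
  obtain R t0 where R: "0 < R" "0 < t0" and dec: "\<And>v d t. v \<in> ball wb R \<Longrightarrow>
      norm (F v + J v d) \<le> \<delta> * norm (F v) \<Longrightarrow> 0 \<le> t \<Longrightarrow> t \<le> t0 \<Longrightarrow>
      (norm (F (v + t *\<^sub>R d)))\<^sup>2 \<le> (1 - 2 * \<sigma> * (1 - \<delta>) * t) * (norm (F v))\<^sup>2"
    by (rule local_decrease [OF pos nz delta \<sigma>]) (rule that)
  define q where "q = 1 - 2 * \<sigma> * (1 - \<delta>) * min 1 (\<rho> * t0)"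
  have q: "q < 1" using \<sigma> delta R params by (simp add: q_def)
  have contract: "(norm (F (w (Suc k))))\<^sup>2 \<le> q * (norm (F (w k)))\<^sup>2" if k: "w k \<in> ball wb R" for k
  proof -
    obtain d l where st: "direction (w k) d" "accepts (w k) d l" "\<And>j. j < l \<Longrightarrow> \<not> accepts (w k) d j"
      "w (Suc k) = w k + \<rho> ^ l *\<^sub>R d" using step [of k] by metis
    have "min 1 (\<rho> * t0) \<le> \<rho> ^ l"
    proof (cases l)
      case (Suc j)
      then have "\<not> accepts (w k) d j" using st(3) by simp
      then have "\<not> \<rho> ^ j \<le> t0"
        unfolding accepts_def using dec [OF k step_residual [OF st(1)], of "\<rho> ^ j"] params by auto
      then have "\<rho> * t0 \<le> \<rho> ^ l" using params Suc by simp
      then show ?thesis by simp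
    qed simp
    then have "2 * \<sigma> * (1 - \<delta>) * min 1 (\<rho> * t0) \<le> 2 * \<sigma> * (1 - \<delta>) * \<rho> ^ l"
      using \<sigma> delta by (intro mult_left_mono) auto
    then have "(1 - 2 * \<sigma> * (1 - \<delta>) * \<rho> ^ l) * (norm (F (w k)))\<^sup>2 \<le> q * (norm (F (w k)))\<^sup>2"
      unfolding q_def by (intro mult_right_mono) auto
    with st(2) show ?thesis unfolding accepts_def st(4) by simp
  qed
  have "\<forall>\<^sub>F k in sequentially. dist ((w \<circ> s) k) wb < R" using lim R(1) by (rule tendstoD)
  then have "\<forall>\<^sub>F k in sequentially. (norm (F wb))\<^sup>2 \<le> q * (norm (F (w (s k))))\<^sup>2"
  proof eventually_elim
    case (elim k)
    then have "w (s k) \<in> ball wb R" by (simp add: dist_commute)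
    from contract [OF this] show ?case
      by (rule order_trans [OF power_mono [OF ge [of "Suc (s k)"]], rotated]) simp
  qed
  moreover have "(\<lambda>k. q * (norm (F (w (s k))))\<^sup>2) \<longlonglongrightarrow> q * (norm (F wb))\<^sup>2"
    by (intro tendsto_intros Flim)
  ultimately have "(norm (F wb))\<^sup>2 \<le> q * (norm (F wb))\<^sup>2"
    using tendsto_lowerbound trivial_limit_sequentially by blast
  then show False using q nz by simp
qed

end

section \<open>Strong semismoothness at a vanishing smoothing parameter\<close>

text \<open>The core of strong semismoothness, in terms of numbers only. Here \<open>d\<close> and \<open>\<mu>\<close> are the eigenvalues of the
nearby matrix \<open>W\<close> and of the limit matrix, \<open>R\<close> is the matrix of change between their eigenbases and \<open>x\<close> is the
distance of the two matrices; the sum is an entry of the linearization error.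

Since \<open>(d\<^sub>i - \<mu>\<^sub>j) R\<^sub>i\<^sub>j\<close> is at most \<open>x\<close>, the entry \<open>R\<^sub>i\<^sub>j\<close> is of order \<open>x\<close> unless \<open>d\<^sub>i\<close> is near \<open>\<mu>\<^sub>j\<close>. Each \<open>d\<^sub>i\<close> is
classified as positive, negative or tiny, according to the eigenvalues \<open>\<mu>\<^sub>j\<close> that it can be close to. A summand
with nonzero \<open>\<mu>\<^sub>j\<close> is of second order if neither \<open>d\<^sub>i\<close> nor \<open>d\<^sub>l\<close> is in the class of \<open>\<mu>\<^sub>j\<close>. If both are, the bracket vanishes. If exactly one of
them is, one factor of \<open>R\<close> is small; if the other of \<open>d\<^sub>i\<close>, \<open>d\<^sub>l\<close> is tiny, the second small factor is the
bracket. There remains the case that \<open>d\<^sub>i\<close> is positive and \<open>d\<^sub>l\<close> negative. Then the summands are of first order only, but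
up to second order they are the multiples \<open>R\<^sub>i\<^sub>j R\<^sub>l\<^sub>j a\<close> of a single number \<open>a\<close>, so that they cancel by
orthogonality of the rows \<open>i\<close> and \<open>l\<close>.\<close>

lemma entry_estimate:
  fixes R :: "'n::finite \<Rightarrow> 'n \<Rightarrow> real" and d \<mu> :: "'n \<Rightarrow> real" and x c e B :: real
  assumes orth: "\<And>i l. (\<Sum>j\<in>UNIV. R i j * R l j) = (if i = l then 1 else 0)"
    and near: "\<And>i j. \<bar>(d i - \<mu> j) * R i j\<bar> \<le> x"
    and gap: "\<And>j. \<mu> j \<noteq> 0 \<Longrightarrow> 4 * c \<le> \<bar>\<mu> j\<bar>" and bnd: "\<And>j. \<bar>\<mu> j\<bar> \<le> B"
    and c: "0 < c" and e: "0 < e" "e \<le> c" and x: "2 * real CARD('n) * x \<le> c"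
  shows "\<bar>\<Sum>j\<in>UNIV. R i j * R l j * (huber_dd e (d i) (d l) * \<mu> j - max 0 (\<mu> j))\<bar>
    \<le> real CARD('n) * ((2 * real CARD('n) + 1) * B / c\<^sup>2 + 2 / c) * (x + e)\<^sup>2"
proof -
  define n where "n = real CARD('n)"
  define S where "S = x + e"
  define K where "K = (2 * n + 1) * B / c\<^sup>2 + 2 / c"
  have n: "1 \<le> n" by (simp add: n_def Suc_leI)
  have x0: "0 \<le> x" using near [of undefined undefined] by linarith
  have B: "0 \<le> B" using bnd [of undefined] by linarith
  have S: "x \<le> S" "e \<le> S" "0 < S" using x0 e by (simp_all add: S_def)
  have R1: "\<bar>R i j\<bar> \<le> 1" for i j
  proof -
    have "R i j * R i j \<le> (\<Sum>j\<in>UNIV. R i j * R i j)" by (rule member_le_sum) auto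
    then have "(R i j)\<^sup>2 \<le> 1\<^sup>2" by (simp add: orth power2_eq_square)
    then show ?thesis by (simp only: abs_le_square_iff [of "R i j" 1, symmetric] abs_one)
  qed
  have far: "\<bar>R i j\<bar> \<le> x / c" if "c \<le> \<bar>d i - \<mu> j\<bar>" for i j
  proof -
    have "c * \<bar>R i j\<bar> \<le> \<bar>d i - \<mu> j\<bar> * \<bar>R i j\<bar>" using that by (intro mult_right_mono) auto
    also have "\<dots> \<le> x" using near [of i j] by (simp add: abs_mult)
    finally show ?thesis using c by (simp add: field_simps)
  qed
  have far_pos: "\<bar>R i j\<bar> \<le> x / c" if "0 < \<mu> j" "d i \<le> 2 * c" for i j
    using far [of i j] gap [of j] that c by auto
  have far_neg: "\<bar>R i j\<bar> \<le> x / c" if "\<mu> j < 0" "- (2 * c) \<le> d i" for i j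
    using far [of i j] gap [of j] that c by auto
  have far_zero: "\<bar>R i j\<bar> \<le> x / c" if "\<mu> j = 0" "2 * c < \<bar>d i\<bar>" for i j
    using far [of i j] that c by auto
  (* The row of R belonging to l has norm 1, and each of its entries times d l is at most 2 x. *)
  have tiny: "\<bar>d l\<bar> \<le> 2 * n * x" if l: "\<bar>d l\<bar> \<le> 2 * c" for l
  proof -
    have "\<bar>d l * R l j\<bar> \<le> 2 * x" for j
    proof (cases "\<mu> j = 0")
      case True
      then show ?thesis using near [of l j] x0 by simp
    next
      case False
      then have "\<bar>R l j\<bar> \<le> x / c" using far_pos [of j l] far_neg [of j l] l by fastforce
      then have "\<bar>d l\<bar> * \<bar>R l j\<bar> \<le> (2 * c) * (x / c)" using l c by (intro mult_mono) auto
      then show ?thesis using c by (simp add: abs_mult)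
    qed
    then have "(d l * R l j)\<^sup>2 \<le> (2 * x)\<^sup>2" for j
      using power_mono [of "\<bar>d l * R l j\<bar>" "2 * x" 2] by simp
    then have "(\<Sum>j\<in>UNIV. (d l * R l j)\<^sup>2) \<le> (\<Sum>j\<in>(UNIV :: 'n set). (2 * x)\<^sup>2)"
      by (intro sum_mono) auto
    moreover have "(\<Sum>j\<in>UNIV. (d l * R l j)\<^sup>2) = (d l)\<^sup>2 * (\<Sum>j\<in>UNIV. R l j * R l j)"
      by (simp add: sum_distrib_left power_mult_distrib power2_eq_square mult_ac)
    ultimately have "(d l)\<^sup>2 \<le> n * (2 * x)\<^sup>2" by (simp add: orth n_def)
    also have "\<dots> \<le> n\<^sup>2 * (2 * x)\<^sup>2" using n by (intro mult_right_mono) (auto simp: power2_eq_square)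
    also have "\<dots> = (2 * n * x)\<^sup>2" by (simp add: power_mult_distrib)
    finally show ?thesis using n x0 by (simp add: abs_le_square_iff [symmetric])
  qed
  have K: "B / c\<^sup>2 \<le> K" "2 / c \<le> K" "(2 * n + 1) * B / c\<^sup>2 \<le> K"
    using B c n by (auto simp: K_def intro!: divide_right_mono add_increasing2 mult_left_le_one_le)
      (simp add: field_simps add_increasing2)
  have K0: "0 \<le> K" using K(2) c by (meson divide_nonneg_pos order_trans zero_le_numeral)
  have main: "\<bar>\<Sum>j\<in>UNIV. R i j * R l j * (huber_dd e (d i) (d l) * \<mu> j - max 0 (\<mu> j))\<bar> \<le> n * (K * S\<^sup>2)"
    if ord: "d l \<le> d i" for i l
  proof -
    define \<omega> where "\<omega> = huber_dd e (d i) (d l)"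
    have \<omega>: "0 \<le> \<omega>" "\<omega> \<le> 1" using huber_dd_range e by (simp_all add: \<omega>_def)
    define \<phi> where "\<phi> j = \<omega> * \<mu> j - max 0 (\<mu> j)" for j
    have \<phi>_pos: "\<phi> j = (\<omega> - 1) * \<mu> j" if "0 < \<mu> j" for j using that by (simp add: \<phi>_def algebra_simps)
    have \<phi>_neg: "\<phi> j = \<omega> * \<mu> j" if "\<mu> j < 0" for j using that by (simp add: \<phi>_def)
    have \<phi>_zero: "\<phi> j = 0" if "\<mu> j = 0" for j using that by (simp add: \<phi>_def)
    have \<phi>B: "\<bar>\<phi> j\<bar> \<le> B" for j
    proof -
      have "\<bar>\<phi> j\<bar> \<le> 1 * \<bar>\<mu> j\<bar>"
        using \<omega> \<phi>_pos [of j] \<phi>_neg [of j] \<phi>_zero [of j]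
        by (cases "\<mu> j" "0 :: real" rule: linorder_cases) (auto simp: abs_mult intro!: mult_right_mono)
      then show ?thesis using bnd [of j] by simp
    qed
    have both: "\<bar>R i j * R l j * \<phi> j\<bar> \<le> K * S\<^sup>2" if "\<bar>R i j\<bar> \<le> x / c" "\<bar>R l j\<bar> \<le> x / c" for j
    proof -
      have "\<bar>R i j * R l j * \<phi> j\<bar> \<le> (x / c) * (x / c) * B"
        unfolding abs_mult using that \<phi>B [of j] x0 c by (intro mult_mono) auto
      also have "\<dots> = B / c\<^sup>2 * x\<^sup>2" by (simp add: power2_eq_square)
      also have "\<dots> \<le> K * S\<^sup>2" using K K0 S x0 B c by (intro mult_mono power_mono) auto
      finally show ?thesis .
    qed
    have one: "\<bar>R i j * R l j * \<phi> j\<bar> \<le> K * S\<^sup>2"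
      if "\<bar>R i j\<bar> \<le> x / c \<or> \<bar>R l j\<bar> \<le> x / c" "\<bar>\<phi> j\<bar> \<le> (2 * n * x + e) / c * B" for j
    proof -
      have "\<bar>R i j * R l j\<bar> \<le> x / c"
        using that(1) mult_mono [of "\<bar>R i j\<bar>" "x / c" "\<bar>R l j\<bar>" 1] mult_mono [of "\<bar>R i j\<bar>" 1 "\<bar>R l j\<bar>" "x / c"]
          R1 x0 c by (auto simp: abs_mult)
      then have "\<bar>R i j * R l j\<bar> * \<bar>\<phi> j\<bar> \<le> (x / c) * ((2 * n * x + e) / c * B)"
        using that(2) x0 c by (intro mult_mono) auto
      also have "\<dots> \<le> (S / c) * (((2 * n + 1) * S) / c * B)"
      proof -
        have "2 * n * x + e \<le> (2 * n + 1) * S"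
          unfolding distrib_right mult_1 by (intro add_mono mult_left_mono S) (use n in auto)
        then show ?thesis using S x0 n c B e by (intro mult_mono divide_right_mono mult_right_mono) auto
      qed
      also have "\<dots> = (2 * n + 1) * B / c\<^sup>2 * S\<^sup>2" by (simp add: power2_eq_square)
      also have "\<dots> \<le> K * S\<^sup>2" using K by (intro mult_right_mono) auto
      finally show ?thesis by (simp add: abs_mult)
    qed
    have hpos: "huber e t = t - e / 2" if "2 * c < t" for t
      using that e c by (simp add: huber_def)
    have hneg: "huber e t = 0" if "t < 0" for t
      using that e by (simp add: huber_def)
    have hsmall: "\<bar>huber e t - max 0 t\<bar> \<le> e / 2" for t
      using e by (intro huber_near_pos_part) auto
    have \<omega>eq: "\<omega> * (d i - d l) = huber e (d i) - huber e (d l)"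
      by (simp add: \<omega>_def huber_dd_mult)
    have small_if: "z \<le> (2 * n * x + e) / c" if "0 \<le> z" "z * (d i - d l) \<le> 2 * n * x + e" "c \<le> d i - d l" for z
    proof -
      have "z * c \<le> z * (d i - d l)" using that by (intro mult_left_mono) auto
      with that(2) have "z * c \<le> 2 * n * x + e" by simp
      then show ?thesis using c by (simp add: field_simps)
    qed
    (* The number a is 0 except in the mixed case, where it is the common leading coefficient. *)
    have "\<exists>a. (i \<noteq> l \<or> a = 0) \<and> (\<forall>j. \<bar>R i j * R l j * \<phi> j - R i j * R l j * a\<bar> \<le> K * S\<^sup>2)"
    proof -
      have KS: "0 \<le> K * S\<^sup>2" using K0 by simp
      consider (pp) "2 * c < d l" "2 * c < d i" | (pz) "\<bar>d l\<bar> \<le> 2 * c" "2 * c < d i"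
        | (pn) "d l < - (2 * c)" "2 * c < d i" | (zz) "\<bar>d l\<bar> \<le> 2 * c" "\<bar>d i\<bar> \<le> 2 * c"
        | (zn) "d l < - (2 * c)" "\<bar>d i\<bar> \<le> 2 * c" | (nn) "d l < - (2 * c)" "d i < - (2 * c)"
        using ord by linarith
      then show ?thesis
      proof cases
        case pp
        have "\<omega> = 1" using hpos pp e c by (auto simp: \<omega>_def huber_dd_def slope_def)
        then have "\<bar>R i j * R l j * \<phi> j\<bar> \<le> K * S\<^sup>2" for j
          using both [of j] far_neg [of j i] far_neg [of j l] pp c KS \<phi>_pos [of j] \<phi>_zero [of j]
          by (cases "\<mu> j" "0 :: real" rule: linorder_cases) auto
        then show ?thesis by (intro exI [of _ 0]) simp
      next
        case nn
        have "\<omega> = 0" using hneg nn e c by (auto simp: \<omega>_def huber_dd_def slope_def min_def max_def field_simps)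
        then have "\<bar>R i j * R l j * \<phi> j\<bar> \<le> K * S\<^sup>2" for j
          using both [of j] far_pos [of j i] far_pos [of j l] nn c KS \<phi>_neg [of j] \<phi>_zero [of j]
          by (cases "\<mu> j" "0 :: real" rule: linorder_cases) auto
        then show ?thesis by (intro exI [of _ 0]) simp
      next
        case zz
        then have "\<bar>R i j * R l j * \<phi> j\<bar> \<le> K * S\<^sup>2" for j
          using both [of j] far_pos [of j i] far_pos [of j l] far_neg [of j i] far_neg [of j l] KS \<phi>_zero [of j]
          by (cases "\<mu> j" "0 :: real" rule: linorder_cases) auto
        then show ?thesis by (intro exI [of _ 0]) simp
      next
        case pz
        have dl: "\<bar>d l\<bar> \<le> 2 * n * x" using tiny pz by simp
        have "1 - \<omega> \<le> (2 * n * x + e) / c"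
        proof (rule small_if)
          have "(1 - \<omega>) * (d i - d l) = e / 2 + huber e (d l) - d l"
            using \<omega>eq hpos [OF pz(2)] by (simp add: algebra_simps)
          also have "\<dots> \<le> 2 * n * x + e" using hsmall [of "d l"] dl e(1) by linarith
          finally show "(1 - \<omega>) * (d i - d l) \<le> 2 * n * x + e" .
          show "c \<le> d i - d l" using dl x pz by (simp add: n_def)
        qed (use \<omega> in simp)
        then have "\<bar>\<phi> j\<bar> \<le> (2 * n * x + e) / c * B" if "0 < \<mu> j" for j
          using \<phi>_pos [OF that] bnd [of j] \<omega> unfolding abs_mult
          by (simp only: abs_mult) (intro mult_mono, auto)
        then have "\<bar>R i j * R l j * \<phi> j\<bar> \<le> K * S\<^sup>2" for j
          using both [of j] one [of j] far_pos [of j l] far_neg [of j i] far_neg [of j l] pz c KS \<phi>_zero [of j]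
          by (cases "\<mu> j" "0 :: real" rule: linorder_cases) auto
        then show ?thesis by (intro exI [of _ 0]) simp
      next
        case zn
        have di: "\<bar>d i\<bar> \<le> 2 * n * x" using tiny zn by simp
        have "\<omega> \<le> (2 * n * x + e) / c"
        proof (rule small_if)
          have "\<omega> * (d i - d l) = huber e (d i)"
            using \<omega>eq hneg [of "d l"] zn c by simp
          also have "\<dots> \<le> 2 * n * x + e"
            using hsmall [of "d i"] di e(1) by linarith
          finally show "\<omega> * (d i - d l) \<le> 2 * n * x + e" .
          show "c \<le> d i - d l" using di x zn by (simp add: n_def)
        qed (use \<omega> in simp)
        then have "\<bar>\<phi> j\<bar> \<le> (2 * n * x + e) / c * B" if "\<mu> j < 0" for j
          using \<phi>_neg [OF that] bnd [of j] \<omega> unfolding abs_mult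
          by (simp only: abs_mult) (intro mult_mono, auto)
        then have "\<bar>R i j * R l j * \<phi> j\<bar> \<le> K * S\<^sup>2" for j
          using both [of j] one [of j] far_neg [of j i] far_pos [of j i] far_pos [of j l] zn c KS \<phi>_zero [of j]
          by (cases "\<mu> j" "0 :: real" rule: linorder_cases) auto
        then show ?thesis by (intro exI [of _ 0]) simp
      next
        case pn
        have il: "i \<noteq> l" using pn c by auto
        (* The leading coefficients of the positive and of the negative part agree up to e / 2. *)
        have rel: "(\<omega> - 1) * d i = \<omega> * d l - e / 2"
          using \<omega>eq hpos [OF pn(2)] hneg [of "d l"] pn c by (simp add: algebra_simps)
        have xx: "x / c * x \<le> 1 / 2 * (K * S\<^sup>2)" "x / c * (e / 2) \<le> 1 / 2 * (K * S\<^sup>2)"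
        proof -
          have "e / 2 \<le> S" using S e(1) by linarith
          then have "x / c * x \<le> S / c * S" "x / c * (e / 2) \<le> S / c * S"
            by (intro mult_mono divide_right_mono; use S x0 e c in simp)+
          moreover have "S / c * S = 1 / 2 * (2 / c * S\<^sup>2)" by (simp add: power2_eq_square)
          moreover have "2 / c * S\<^sup>2 \<le> K * S\<^sup>2" using K by (intro mult_right_mono) auto
          ultimately show "x / c * x \<le> 1 / 2 * (K * S\<^sup>2)" "x / c * (e / 2) \<le> 1 / 2 * (K * S\<^sup>2)" by linarith+
        qed
        have "\<bar>R i j * R l j * \<phi> j - R i j * R l j * (\<omega> * d l)\<bar> \<le> K * S\<^sup>2" for j
        proof (cases "\<mu> j" "0 :: real" rule: linorder_cases)
          case equal
          have "\<bar>R i j * R l j * \<phi> j - R i j * R l j * (\<omega> * d l)\<bar> = \<bar>R i j\<bar> * (\<omega> * \<bar>(d l - \<mu> j) * R l j\<bar>)"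
            using equal \<omega> by (simp add: \<phi>_zero abs_mult)
          also have "\<dots> \<le> x / c * (1 * x)"
            using far_zero [OF equal, of i] near [of l j] pn \<omega> x0 c by (intro mult_mono) auto
          finally show ?thesis using xx KS unfolding mult_1 by linarith
        next
          case less
          have "\<bar>R i j * R l j * \<phi> j - R i j * R l j * (\<omega> * d l)\<bar> = \<bar>R i j * (\<omega> * ((\<mu> j - d l) * R l j))\<bar>"
            using less by (simp add: \<phi>_neg algebra_simps)
          also have "\<dots> = \<bar>R i j\<bar> * (\<omega> * \<bar>(d l - \<mu> j) * R l j\<bar>)"
            using \<omega> by (simp add: abs_mult abs_minus_commute)
          also have "\<dots> \<le> x / c * (1 * x)"
            using far_neg [OF less, of i] near [of l j] pn \<omega> x0 c by (intro mult_mono) auto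
          finally show ?thesis using xx KS unfolding mult_1 by linarith
        next
          case greater
          have "R i j * R l j * \<phi> j - R i j * R l j * (\<omega> * d l) =
              R l j * ((\<omega> - 1) * ((\<mu> j - d i) * R i j)) + R l j * R i j * ((\<omega> - 1) * d i - \<omega> * d l)"
            using greater by (simp add: \<phi>_pos algebra_simps)
          also have "\<bar>\<dots>\<bar> \<le> \<bar>R l j\<bar> * (\<bar>\<omega> - 1\<bar> * \<bar>(d i - \<mu> j) * R i j\<bar>) + \<bar>R l j\<bar> * \<bar>R i j\<bar> * (e / 2)"
            unfolding rel using e by (intro order_trans [OF abs_triangle_ineq]) (simp add: abs_mult abs_minus_commute)
          also have "\<dots> \<le> x / c * (1 * x) + x / c * 1 * (e / 2)"
            using far_pos [OF greater, of l] near [of i j] R1 [of i j] pn \<omega> x0 c e by (intro add_mono mult_mono) auto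
          finally show ?thesis using xx unfolding mult_1 mult_1_right by linarith
        qed
        then show ?thesis using il by blast
      qed
    qed
    then obtain a where a: "i \<noteq> l \<or> a = 0" "\<And>j. \<bar>R i j * R l j * \<phi> j - R i j * R l j * a\<bar> \<le> K * S\<^sup>2" by blast
    have "(\<Sum>j\<in>UNIV. R i j * R l j * a) = 0"
      using a(1) orth [of i l] by (auto simp flip: sum_distrib_right)
    then have "(\<Sum>j\<in>UNIV. R i j * R l j * \<phi> j) = (\<Sum>j\<in>UNIV. R i j * R l j * \<phi> j - R i j * R l j * a)"
      by (simp add: sum_subtractf)
    also have "\<bar>\<dots>\<bar> \<le> (\<Sum>j\<in>(UNIV :: 'n set). K * S\<^sup>2)" by (intro order_trans [OF sum_abs] sum_mono a(2))
    finally show ?thesis by (simp add: \<phi>_def \<omega>_def n_def)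
  qed
  have "\<bar>\<Sum>j\<in>UNIV. R i j * R l j * (huber_dd e (d i) (d l) * \<mu> j - max 0 (\<mu> j))\<bar> \<le> n * (K * S\<^sup>2)"
    using main [of l i] main [of i l] huber_dd_commute [of e "d i" "d l"]
    by (cases "d l \<le> d i") (simp_all add: mult.commute [of "R i _" "R l _"])
  then show ?thesis by (simp add: n_def K_def S_def mult.assoc)
qed

lemma norm_le_conj_entries:
  assumes "orthogonal_matrix P"
  shows "norm X \<le> (\<Sum>i\<in>UNIV. \<Sum>j\<in>UNIV. \<bar>conj_entry P X i j\<bar>)"
proof -
  have "norm X = norm (transpose P ** mat_of X ** P)"
    using assms by (simp add: norm_mat_of norm_orthogonal_conj orthogonal_matrix_transpose_iff)
  also have "\<dots> \<le> (\<Sum>i\<in>UNIV. \<Sum>j\<in>UNIV. \<bar>conj_entry P X i j\<bar>)"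
    unfolding conj_entry_def by (rule norm_mat_le_sum)
  finally show ?thesis .
qed

lemma conj_entry_spectral_fun_other:
  fixes P Q :: "real^'n::finite^'n"
  assumes "eigdec W Q \<mu>"
  shows "conj_entry P (spectral_fun f W) i l =
    (\<Sum>j\<in>UNIV. (transpose P ** Q) $ i $ j * (transpose P ** Q) $ l $ j * f (\<mu> $ j))"
proof -
  define R where "R = transpose P ** Q"
  have "transpose P ** mat_of (spectral_fun f W) ** P = (R ** diag_mat (\<chi> i. f (\<mu> $ i))) ** transpose R"
    by (simp add: mat_of_spectral_fun [OF assms] R_def matrix_mul_assoc matrix_transpose_mul)
  then have "conj_entry P (spectral_fun f W) i l = (\<Sum>j\<in>UNIV. (R $ i $ j * f (\<mu> $ j)) * R $ l $ j)"
    by (simp add: conj_entry_def matrix_matrix_mult_def [of "R ** diag_mat _"] mult_diag_entry transpose_def [of R])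
  then show ?thesis by (simp add: R_def mult_ac)
qed

lemma spectral_fun_ident: "spectral_fun (\<lambda>x. x) W = W"
proof -
  obtain P d where P: "eigdec W P d" using eigdec_exists by blast
  then show ?thesis
    by (simp add: mat_of_spectral_fun [OF P] eigdec_def flip: mat_of_inject)
qed

lemma conj_entry_spectral_fun:
  assumes P: "eigdec W P d"
  shows "conj_entry P (spectral_fun f W) i j = (if i = j then f (d $ i) else 0)"
proof -
  have "orthogonal_matrix P" using P by (simp add: eigdec_def)
  then have "transpose P ** mat_of (spectral_fun f W) ** P = diag_mat (\<chi> i. f (d $ i))"
    by (simp add: mat_of_spectral_fun [OF P] matrix_mul_assoc orthogonalD)
  then show ?thesis by (simp add: conj_entry_def diag_mat_def)
qed

text \<open>The Huber function is positively homogeneous of degree 1 in \<open>(e, t)\<close>; this is Euler's relation.\<close>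

lemma Phi_euler:
  assumes "0 < e"
  shows "Phi e W = lowner e W W + e *\<^sub>R Phi_eps e W"
proof -
  obtain P d where P: "eigdec W P d" using eigdec_exists by blast
  have o: "orthogonal_matrix P" using P by (simp add: eigdec_def)
  have W: "conj_entry P W i j = (if i = j then d $ i else 0)" for i j
    using conj_entry_spectral_fun [OF P, of "\<lambda>x. x"] by (simp add: spectral_fun_ident)
  show ?thesis
    by (rule conj_entry_eqI [OF o])
      (use assms in \<open>simp add: conj_entry_linear conj_entry_lowner [OF P] W Phi_def Phi_eps_def
        conj_entry_spectral_fun [OF P] huber_dd_def eps_dd_def huber_slope [of e]\<close>)
qed

lemma eigdec_diff_entry:
  assumes "eigdec V P d" "eigdec W Q \<mu>"
  shows "\<bar>(d $ i - \<mu> $ j) * (transpose P ** Q) $ i $ j\<bar> \<le> norm (V - W)"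
proof -
  have o: "orthogonal_matrix P" "orthogonal_matrix Q" using assms by (auto simp: eigdec_def)
  have eq: "transpose P ** (mat_of V - mat_of W) ** Q = diag_mat d ** (transpose P ** Q) - (transpose P ** Q) ** diag_mat \<mu>"
    using assms unfolding eigdec_def linear_diff [OF linear_sandwich]
    by (simp add: matrix_mul_assoc orthogonalD o)
  have "(d $ i - \<mu> $ j) * (transpose P ** Q) $ i $ j = (transpose P ** (mat_of V - mat_of W) ** Q) $ i $ j"
    unfolding eq by (simp add: mult_diag_entry diag_mult_entry algebra_simps)
  also have "\<bar>\<dots>\<bar> \<le> norm (transpose P ** (mat_of V - mat_of W) ** Q)" by (rule mat_entry_le)
  also have "\<dots> = norm (V - W)"
    by (simp add: norm_orthogonal_conj orthogonal_matrix_transpose_iff o norm_mat_of flip: minus_symmat.rep_eq)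
  finally show ?thesis .
qed

text \<open>By Euler's relation \<open>Phi e W\<close> cancels against \<open>lowner e W W\<close> and the derivative in \<open>e\<close>, which need not
converge. The error that remains is \<open>lowner e W W0 - Phi 0 W0\<close>; only the nonzero eigenvalues of \<open>W0\<close>
contribute to it, and it is bounded entry by entry.\<close>

lemma Phi_strongly_semismooth:
  fixes W0 :: "'n::finite symmat"
  obtains K s where "0 \<le> K" "0 < s" "\<And>e W. 0 < e \<Longrightarrow> norm (W - W0) + e \<le> s \<Longrightarrow>
    norm (Phi e W - Phi 0 W0 - (lowner e W (W - W0) + e *\<^sub>R Phi_eps e W)) \<le> K * (norm (W - W0) + e)\<^sup>2"
proof -
  obtain Q \<mu> where Q: "eigdec W0 Q \<mu>" using eigdec_exists by blast
  define n where "n = real CARD('n)"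
  have n: "1 \<le> n" by (simp add: n_def Suc_leI)
  (* Four times this number separates the nonzero eigenvalues of W0 from 0. *)
  define c where "c = Min (insert 1 ((\<lambda>j. \<bar>\<mu> $ j\<bar>) ` {j. \<mu> $ j \<noteq> 0})) / 4"
  have c: "0 < c" by (auto simp: c_def)
  have gap: "4 * c \<le> \<bar>\<mu> $ j\<bar>" if "\<mu> $ j \<noteq> 0" for j
    using that by (auto simp: c_def intro!: Min_le)
  define B where "B = norm \<mu>"
  define K where "K = n * ((2 * n + 1) * B / c\<^sup>2 + 2 / c)"
  have K: "0 \<le> K" using n c by (simp add: K_def B_def)
  show thesis
  proof (rule that [of "n * (n * K)" "c / (2 * n)"])
    show "0 \<le> n * (n * K)" "0 < c / (2 * n)" using n c K by simp_all
    fix e :: real and W :: "'n symmat"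
    assume e: "0 < e" and s: "norm (W - W0) + e \<le> c / (2 * n)"
    obtain P d where P: "eigdec W P d" using eigdec_exists by blast
    have o: "orthogonal_matrix P" "orthogonal_matrix Q" using P Q by (auto simp: eigdec_def)
    define R where "R = transpose P ** Q"
    define x where "x = norm (W - W0)"
    have small: "2 * n * (x + e) \<le> c" using s n by (simp add: x_def field_simps)
    have "2 * n * x \<le> 2 * n * (x + e)" by (rule mult_left_mono) (use e n in auto)
    then have x: "2 * n * x \<le> c" using small by linarith
    have ec: "e \<le> c"
    proof -
      have "1 * e \<le> 2 * n * (x + e)" using n e by (intro mult_mono) (auto simp: x_def)
      then show ?thesis using small by simp
    qed
    have "R ** transpose R = mat 1"
      by (simp add: R_def matrix_transpose_mul matrix_mul_assoc orthogonalD o)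
    then have orth: "(\<Sum>j\<in>UNIV. R $ i $ j * R $ l $ j) = (if i = l then 1 else 0)" for i l
      by (simp add: matrix_matrix_mult_def transpose_def vec_eq_iff mat_def)
    define G where "G = lowner e W W0 - Phi 0 W0"
    have h0: "huber 0 = max 0" by (simp add: huber_def fun_eq_iff)
    have G: "conj_entry P G i l =
        (\<Sum>j\<in>UNIV. R $ i $ j * R $ l $ j * (huber_dd e (d $ i) (d $ l) * \<mu> $ j - max 0 (\<mu> $ j)))" for i l
      using conj_entry_spectral_fun_other [OF Q, of P "\<lambda>x. x" i l]
      by (simp add: G_def conj_entry_linear conj_entry_lowner [OF P] spectral_fun_ident Phi_def h0
          conj_entry_spectral_fun_other [OF Q, of P] sum_distrib_left R_def algebra_simps flip: sum_subtractf)
    have "\<bar>conj_entry P G i l\<bar> \<le> K * (x + e)\<^sup>2" for i l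
      unfolding G K_def n_def
      by (rule entry_estimate [where R = "\<lambda>i j. R $ i $ j" and d = "\<lambda>i. d $ i" and \<mu> = "\<lambda>j. \<mu> $ j",
          OF orth _ gap _ c e ec])
        (use eigdec_diff_entry [OF P Q] x component_le_norm_cart in \<open>auto simp: R_def x_def B_def n_def\<close>)
    then have "(\<Sum>i\<in>UNIV. \<Sum>l\<in>UNIV. \<bar>conj_entry P G i l\<bar>) \<le> (\<Sum>i\<in>(UNIV :: 'n set). \<Sum>l\<in>(UNIV :: 'n set). K * (x + e)\<^sup>2)"
      by (intro sum_mono)
    then have "norm G \<le> n * (n * K) * (x + e)\<^sup>2"
      using norm_le_conj_entries [OF o(1), of G] by (simp add: n_def mult.assoc)
    moreover have "Phi e W - Phi 0 W0 - (lowner e W (W - W0) + e *\<^sub>R Phi_eps e W) = G"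
      by (simp add: G_def Phi_euler [OF e] linear_diff [OF linear_lowner])
    ultimately show "norm (Phi e W - Phi 0 W0 - (lowner e W (W - W0) + e *\<^sub>R Phi_eps e W))
        \<le> n * (n * K) * (norm (W - W0) + e)\<^sup>2"
      by (simp add: x_def)
  qed
qed

section \<open>Constraint nondegeneracy at the solution\<close>

lemma matrix_mult_entry: "(M ** N) $ i $ j = (\<Sum>k\<in>UNIV. M $ i $ k * N $ k $ j)"
  by (simp add: matrix_matrix_mult_def)

lemma transpose_entry: "transpose M $ i $ j = M $ j $ i"
  by (simp add: transpose_def)

lemma diag_mat_vec_entry: "(diag_mat x *v y) $ i = x $ i * y $ i"
  by (simp add: diag_mat_def matrix_vector_mult_def if_distribR if_distrib cong: if_cong)

lemma tangent_cone_zero: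
  assumes "x \<in> K" shows "0 \<in> tangent_cone K x"
  unfolding tangent_cone_def
  by (rule CollectI, rule exI [of _ "\<lambda>_. 0"], rule exI [of _ "\<lambda>k. inverse (real (Suc k))"])
    (use assms in \<open>intro conjI allI LIMSEQ_inverse_real_of_nat tendsto_const; simp\<close>)

lemma tangent_cone_scale:
  assumes "d \<in> tangent_cone K x" "0 < c" shows "c *\<^sub>R d \<in> tangent_cone K x"
proof -
  obtain ds t where *: "\<And>k :: nat. 0 < t k \<and> x + t k *\<^sub>R ds k \<in> K" "t \<longlonglongrightarrow> 0" "ds \<longlonglongrightarrow> d"
    using assms(1) unfolding tangent_cone_def by blast
  have "(\<lambda>k. t k / c) \<longlonglongrightarrow> 0" using tendsto_divide [OF *(2) tendsto_const, of c] assms(2) by simp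
  moreover have "(\<lambda>k. c *\<^sub>R ds k) \<longlonglongrightarrow> c *\<^sub>R d" by (intro tendsto_intros *)
  ultimately show ?thesis
    unfolding tangent_cone_def using *(1) assms(2)
    by (intro CollectI exI [of _ "\<lambda>k. c *\<^sub>R ds k"] exI [of _ "\<lambda>k. t k / c"]) auto
qed

lemma tangent_cone_add:
  assumes K: "convex K" "x \<in> K" and d: "d \<in> tangent_cone K x" "e \<in> tangent_cone K x"
  shows "d + e \<in> tangent_cone K x"
proof -
  obtain ds t where 1: "\<And>k :: nat. 0 < t k \<and> x + t k *\<^sub>R ds k \<in> K" "t \<longlonglongrightarrow> 0" "ds \<longlonglongrightarrow> d"
    using d(1) unfolding tangent_cone_def by blast
  obtain es u where 2: "\<And>k :: nat. 0 < u k \<and> x + u k *\<^sub>R es k \<in> K" "u \<longlonglongrightarrow> 0" "es \<longlonglongrightarrow> e"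
    using d(2) unfolding tangent_cone_def by blast
  define m where "m k = min (t k) (u k)" for k
  have m: "0 < m k" "m k \<le> t k" "m k \<le> u k" for k using 1(1) 2(1) by (auto simp: m_def)
  have shrink: "x + m' *\<^sub>R y \<in> K" if "x + s *\<^sub>R y \<in> K" "0 < m'" "m' \<le> s" for m' s y
  proof -
    have "(1 - m' / s) *\<^sub>R x + (m' / s) *\<^sub>R (x + s *\<^sub>R y) \<in> K"
      using that K by (intro convexD_alt) auto
    then show ?thesis using that by (simp add: algebra_simps)
  qed
  have "x + (m k / 2) *\<^sub>R (ds k + es k) \<in> K" for k
  proof -
    have "(1 / 2) *\<^sub>R (x + m k *\<^sub>R ds k) + (1 / 2) *\<^sub>R (x + m k *\<^sub>R es k) \<in> K"
      using shrink [of "t k" "ds k" "m k"] shrink [of "u k" "es k" "m k"] 1(1) 2(1) m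
      by (intro convexD [OF K(1)]) auto
    also have "(1 / 2) *\<^sub>R (x + m k *\<^sub>R ds k) + (1 / 2) *\<^sub>R (x + m k *\<^sub>R es k) = x + (m k / 2) *\<^sub>R (ds k + es k)"
      by (simp add: scaleR_add_right add.assoc add.left_commute flip: scaleR_add_left)
    finally show ?thesis .
  qed
  moreover have "(\<lambda>k. m k / 2) \<longlonglongrightarrow> 0"
    using tendsto_divide [OF tendsto_min [OF 1(2) 2(2)] tendsto_const, of 2] by (simp add: m_def)
  moreover have "(\<lambda>k. ds k + es k) \<longlonglongrightarrow> d + e" by (intro tendsto_intros 1 2)
  ultimately show ?thesis
    unfolding tangent_cone_def using m
    by (intro CollectI exI [of _ "\<lambda>k. ds k + es k"] exI [of _ "\<lambda>k. m k / 2"]) auto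
qed

text \<open>The contingent cone of a convex set is a convex cone, so that a largest subspace exists and consists
of the directions that are tangent together with their negatives.\<close>

lemma lin_tangent_cone:
  assumes K: "convex K" "x \<in> K"
  shows "lin (tangent_cone K x) = {d. d \<in> tangent_cone K x \<and> - d \<in> tangent_cone K x}" (is "_ = ?S")
  unfolding lin_def
proof (rule Greatest_equality)
  have "c *\<^sub>R d \<in> ?S" if "d \<in> ?S" for c d
    using that tangent_cone_scale [of d K x c] tangent_cone_scale [of "- d" K x c]
      tangent_cone_scale [of d K x "- c"] tangent_cone_scale [of "- d" K x "- c"] tangent_cone_zero [OF K(2)]
    by (cases c "0 :: real" rule: linorder_cases) auto
  moreover have "d + e \<in> ?S" if "d \<in> ?S" "e \<in> ?S" for d e
    using that tangent_cone_add [OF K, of d e] tangent_cone_add [OF K, of "- d" "- e"] by simp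
  ultimately have "subspace ?S"
    using tangent_cone_zero [OF K(2)] by (simp add: subspace_def)
  then show "subspace ?S \<and> ?S \<subseteq> tangent_cone K x" by blast
  fix S assume S: "subspace S \<and> S \<subseteq> tangent_cone K x"
  then show "S \<le> ?S" using subspace_neg by blast
qed

lemma convex_psd: "convex psd"
proof (rule convexI)
  fix X Y :: "'n::finite symmat" and u v :: real
  assume "X \<in> psd" "Y \<in> psd" "0 \<le> u" "0 \<le> v"
  then show "u *\<^sub>R X + v *\<^sub>R Y \<in> psd"
    by (simp add: psd_def plus_symmat.rep_eq scaleR_symmat.rep_eq matrix_vector_mult_add_rdistrib
        inner_add_right flip: scaleR_matrix_vector_assoc)
qed

lemma conj_entry_columns: "conj_entry P X i j = column i P \<bullet> (mat_of X *v column j P)"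
proof -
  have *: "(mat_of X ** P) $ k $ j = (mat_of X *v column j P) $ k" for k
    by (simp add: matrix_matrix_mult_def matrix_vector_mult_def column_def)
  have "conj_entry P X i j = (transpose P ** (mat_of X ** P)) $ i $ j"
    by (simp add: conj_entry_def matrix_mul_assoc)
  also have "\<dots> = (\<Sum>k\<in>UNIV. P $ k $ i * (mat_of X ** P) $ k $ j)"
    unfolding matrix_mult_entry [of "transpose P"] transpose_entry ..
  finally show ?thesis unfolding * by (simp add: inner_vec_def column_def)
qed

lemma eigdec_column:
  assumes "eigdec X P x" shows "mat_of X *v column i P = x $ i *\<^sub>R column i P"
proof -
  have "mat_of X ** P = P ** diag_mat x"
    using assms by (auto simp: eigdec_def matrix_mul_assoc orthogonalD)
  then have "(mat_of X ** P) $ k $ i = x $ i * P $ k $ i" for k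
    by (simp add: mult_diag_entry)
  then show ?thesis
    by (simp add: vec_eq_iff column_def matrix_vector_mult_def matrix_matrix_mult_def)
qed

lemma eigdec_psd:
  assumes X: "eigdec X P x" and pos: "\<And>i. 0 \<le> x $ i"
  shows "X \<in> psd"
  unfolding psd_def
proof (intro CollectI allI)
  fix v
  have "v \<bullet> (mat_of X *v v) = (transpose P *v v) \<bullet> (diag_mat x *v (transpose P *v v))"
    using X by (simp add: eigdec_def matrix_vector_mul_assoc [symmetric] dot_lmul_matrix [symmetric])
  also have "\<dots> = (\<Sum>i\<in>UNIV. x $ i * ((transpose P *v v) $ i)\<^sup>2)"
    by (simp add: inner_vec_def diag_mat_vec_entry power2_eq_square mult_ac)
  also have "0 \<le> \<dots>" using pos by (intro sum_nonneg) auto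
  finally show "0 \<le> v \<bullet> (mat_of X *v v)" .
qed

lemma tendsto_matrix_vector:
  fixes M :: "'a \<Rightarrow> real^'n::finite^'m::finite"
  assumes "(M \<longlongrightarrow> N) F" shows "((\<lambda>k. M k *v v) \<longlongrightarrow> N *v v) F"
  unfolding matrix_vector_mult_def
  by (intro vec_tendstoI, simp) (intro tendsto_sum tendsto_mult tendsto_const tendsto_vec_nth assms)

text \<open>On a vector in the kernel of \<open>X\<close> the quadratic forms of \<open>X + t D\<close> and \<open>t D\<close> agree, and nonnegativity passes
to the limit of the directions \<open>D\<close>.\<close>

lemma tangent_psd_kernel:
  assumes L: "L \<in> tangent_cone psd X" and v: "mat_of X *v v = 0"
  shows "0 \<le> v \<bullet> (mat_of L *v v)"
proof -
  obtain ds t where 1: "\<And>k :: nat. 0 < t k \<and> X + t k *\<^sub>R ds k \<in> psd" "ds \<longlonglongrightarrow> L"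
    using L unfolding tangent_cone_def by blast
  have "0 \<le> v \<bullet> (mat_of (ds k) *v v)" for k
  proof -
    have "0 \<le> v \<bullet> (mat_of (X + t k *\<^sub>R ds k) *v v)" using 1(1) [of k] by (simp add: psd_def)
    also have "\<dots> = t k * (v \<bullet> (mat_of (ds k) *v v))"
      by (simp add: plus_symmat.rep_eq scaleR_symmat.rep_eq matrix_vector_mult_add_rdistrib v
          flip: scaleR_matrix_vector_assoc)
    finally show ?thesis using 1(1) [of k] by (simp add: zero_le_mult_iff)
  qed
  moreover have "(\<lambda>k. v \<bullet> (mat_of (ds k) *v v)) \<longlonglongrightarrow> v \<bullet> (mat_of L *v v)"
    by (intro tendsto_inner tendsto_const tendsto_matrix_vector tendsto_mat_of 1(2))
  ultimately show ?thesis by (intro LIMSEQ_le_const) auto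
qed

text \<open>A direction in the lineality space vanishes as a quadratic form on the kernel of \<open>X\<close>, hence, by
polarization, as a bilinear form.\<close>

lemma lin_tangent_psd_block:
  assumes X: "eigdec X P x" "\<And>i. 0 \<le> x $ i" and L: "L \<in> lin (tangent_cone psd X)"
    and ij: "x $ i = 0" "x $ j = 0"
  shows "conj_entry P L i j = 0"
proof -
  have psd: "X \<in> psd" using X by (rule eigdec_psd)
  have L': "L \<in> tangent_cone psd X" "- L \<in> tangent_cone psd X"
    using L unfolding lin_tangent_cone [OF convex_psd psd] by auto
  have q: "v \<bullet> (mat_of L *v v) = 0" if "mat_of X *v v = 0" for v
  proof -
    have "mat_of (- L) *v v = - (mat_of L *v v)"
      by (simp add: uminus_symmat.rep_eq matrix_vector_mult_def vec_eq_iff sum_negf)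
    then show ?thesis using tangent_psd_kernel [OF L'(1) that] tangent_psd_kernel [OF L'(2) that] by simp
  qed
  let ?u = "column i P" and ?v = "column j P"
  have k: "mat_of X *v ?u = 0" "mat_of X *v ?v = 0"
    using eigdec_column [OF X(1)] ij by simp_all
  then have "mat_of X *v (?u + ?v) = 0" by (simp add: matrix_vector_right_distrib)
  from q [OF this] q [OF k(1)] q [OF k(2)]
  have "?u \<bullet> (mat_of L *v ?v) + ?v \<bullet> (mat_of L *v ?u) = 0"
    by (simp add: matrix_vector_right_distrib inner_add_left inner_add_right)
  moreover have "?v \<bullet> (mat_of L *v ?u) = ?u \<bullet> (mat_of L *v ?v)"
    by (metis dot_lmul_matrix inner_commute transpose_mat_of vector_transpose_matrix)
  ultimately show ?thesis by (simp add: conj_entry_columns)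
qed

lemma inner_lin_tangent_psd:
  assumes X: "eigdec X P x" "\<And>i. 0 \<le> x $ i" and L: "L \<in> lin (tangent_cone psd X)"
    and V: "\<And>i j. x $ i \<noteq> 0 \<or> x $ j \<noteq> 0 \<Longrightarrow> conj_entry P V i j = 0"
  shows "L \<bullet> V = 0"
proof -
  have "conj_entry P L i j * conj_entry P V i j = 0" for i j
    using lin_tangent_psd_block [OF X L, of i j] V [of i j] by auto
  then have "(\<Sum>i\<in>UNIV. \<Sum>j\<in>UNIV. conj_entry P L i j * conj_entry P V i j) = 0"
    by (intro sum.neutral ballI)
  then show ?thesis using inner_conj_entry [of P L V] X(1) by (simp add: eigdec_def)
qed

text \<open>Nondegeneracy in dual form: apart from 0 no matrix in the range of the adjoint lives on the kernel of \<open>X\<close>,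
and no nonzero \<open>v\<close> has adjoint 0. To see it, test the decomposition of \<open>(v, 0)\<close> against \<open>v\<close>.\<close>

lemma primal_nondegenerate_kernel:
  assumes nd: "primal_nondegenerate A X" and X: "eigdec X P x" "\<And>i. 0 \<le> x $ i"
    and V: "\<And>i j. x $ i \<noteq> 0 \<or> x $ j \<noteq> 0 \<Longrightarrow> conj_entry P (op_A_adj A v) i j = 0"
  shows "v = 0"
proof -
  have "(v, 0) \<in> {(op_A A H, H) | H. True} + {0} \<times> lin (tangent_cone psd X)"
    using nd by (simp add: primal_nondegenerate_def)
  then obtain H L where HL: "v = op_A A H" "H + L = 0" "L \<in> lin (tangent_cone psd X)"
    by (auto simp: set_plus_def)
  have "v \<bullet> v = H \<bullet> op_A_adj A v" using inner_op_A [of A H v] HL(1) by simp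
  also have "H = - L" using HL(2) by (simp add: eq_neg_iff_add_eq_0)
  also have "- L \<bullet> op_A_adj A v = 0"
    using inner_lin_tangent_psd [OF X HL(3) V] by simp
  finally show ?thesis by simp
qed

text \<open>The counterpart for the dual problem: no nonzero matrix in the kernel of \<open>op_A A\<close> lives on the kernel of \<open>Z\<close>.\<close>

lemma dual_nondegenerate_kernel:
  assumes nd: "dual_nondegenerate A Z" and Z: "eigdec Z P z" "\<And>i. 0 \<le> z $ i"
    and U: "op_A A U = 0" "\<And>i j. z $ i \<noteq> 0 \<or> z $ j \<noteq> 0 \<Longrightarrow> conj_entry P U i j = 0"
  shows "U = 0"
proof -
  have "(U, 0) \<in> {(op_A_adj A y + S, S) | y S. True} + {0} \<times> lin (tangent_cone psd Z)"
    using nd by (simp add: dual_nondegenerate_def)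
  then obtain y S L where SL: "U = op_A_adj A y + S" "S + L = 0" "L \<in> lin (tangent_cone psd Z)"
    by (auto simp: set_plus_def)
  have "U \<bullet> op_A_adj A y = 0" using inner_op_A [of A U y] U(1) by simp
  moreover have "S \<bullet> U = 0"
  proof -
    have "S = - L" using SL(2) by (simp add: eq_neg_iff_add_eq_0)
    then show ?thesis using inner_lin_tangent_psd [OF Z SL(3) U(2)] by simp
  qed
  ultimately have "U \<bullet> U = 0" using SL(1) by (metis add_0 inner_add_right inner_commute)
  then show ?thesis by simp
qed

lemma pos_part_dd_pos:
  fixes a b :: real
  assumes "0 < a \<or> 0 < b"
  shows "0 < (if a = b then (if a > 0 then 1 else 0) else (max 0 a - max 0 b) / (a - b))"
  using assms by (cases a b rule: linorder_cases) (auto simp: zero_less_divide_iff max_def)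

lemma pos_part_dd_less_1:
  fixes a b :: real
  assumes "a < 0 \<or> b < 0"
  shows "(if a = b then (if a > 0 then 1 else 0) else (max 0 a - max 0 b) / (a - b)) < 1"
  using assms by (cases a b rule: linorder_cases) (auto simp: divide_less_eq max_def)

text \<open>The limiting linear system. As \<open>\<langle>U, V\<rangle> = 0\<close>, the sign argument makes every product of entries vanish. If one
of the indices belongs to a positive eigenvalue of \<open>X - Z\<close>, then \<open>\<omega> > 0\<close> forces the entry of \<open>V\<close> to be 0; if one
belongs to a negative eigenvalue, then \<open>\<omega> < 1\<close> forces the entry of \<open>U\<close> to be 0. Thus \<open>V\<close> lives on the kernel of \<open>X\<close>
and \<open>U\<close> on the kernel of \<open>Z\<close>, and the two nondegeneracy conditions apply. Where both indices
belong to the eigenvalue 0, either entry may be nonzero.\<close>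

lemma limit_system_trivial:
  assumes P: "eigdec (X - Z) P l" and XZ: "X = Phi 0 (X - Z)"
    and nd: "primal_nondegenerate A X" "dual_nondegenerate A Z"
    and U: "op_A A U = 0" and V: "V = - op_A_adj A v"
    and ent: "\<And>i j. conj_entry P U i j = \<omega> i j * (conj_entry P U i j - conj_entry P V i j)"
    and \<omega>: "\<And>i j. 0 \<le> \<omega> i j" "\<And>i j. \<omega> i j \<le> 1"
    and lim: "\<And>i j. l $ i \<noteq> 0 \<or> l $ j \<noteq> 0 \<Longrightarrow> \<omega> i j =
      (if l $ i = l $ j then (if l $ i > 0 then 1 else 0) else (max 0 (l $ i) - max 0 (l $ j)) / (l $ i - l $ j))"
  shows "U = 0 \<and> v = 0"
proof -
  have o: "orthogonal_matrix P" using P by (simp add: eigdec_def)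
  define x where "x = (\<chi> i. max 0 (l $ i))"
  define z where "z = (\<chi> i. max 0 (- (l $ i)))"
  have h0: "huber 0 = max 0" by (simp add: huber_def fun_eq_iff)
  have "mat_of X = P ** diag_mat x ** transpose P"
    using mat_of_spectral_fun [OF P, of "huber 0"] XZ by (simp add: Phi_def h0 x_def)
  then have X: "eigdec X P x" using o by (simp add: eigdec_def)
  have "Z = X - (X - Z)" by simp
  then have "mat_of Z = P ** diag_mat x ** transpose P - P ** diag_mat l ** transpose P"
    using X P by (metis eigdec_def minus_symmat.rep_eq)
  also have "\<dots> = P ** (diag_mat x - diag_mat l) ** transpose P"
    by (simp add: linear_diff [OF linear_sandwich])
  also have "diag_mat x - diag_mat l = diag_mat z"
    by (simp add: diag_mat_def vec_eq_iff x_def z_def max_def)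
  finally have Z: "eigdec Z P z" using o by (simp add: eigdec_def)
  have x0: "0 \<le> x $ i" and z0: "0 \<le> z $ i" for i by (simp_all add: x_def z_def)
  have "U \<bullet> V = 0" using inner_op_A [of A U v] U V by simp
  moreover have nonpos: "conj_entry P U i j * conj_entry P V i j \<le> 0" for i j
    by (rule complementary_sign [of 1]) (use ent \<omega> in auto)
  ultimately have UV: "conj_entry P U i j * conj_entry P V i j = 0" for i j
  proof -
    have "(\<Sum>i\<in>UNIV. \<Sum>j\<in>UNIV. - (conj_entry P U i j * conj_entry P V i j)) = 0"
      using \<open>U \<bullet> V = 0\<close> inner_conj_entry [OF o, of U V] by (simp add: sum_negf)
    then have "(\<Sum>j\<in>UNIV. - (conj_entry P U i j * conj_entry P V i j)) = 0"
      using nonpos by (subst (asm) sum_nonneg_eq_0_iff) (auto intro: sum_nonneg)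
    then show ?thesis
      using nonpos by (subst (asm) sum_nonneg_eq_0_iff) auto
  qed
  have V0: "conj_entry P V i j = 0" if "x $ i \<noteq> 0 \<or> x $ j \<noteq> 0" for i j
  proof -
    have l: "0 < l $ i \<or> 0 < l $ j" using that by (auto simp: x_def max_def split: if_splits)
    then have "0 < \<omega> i j" using lim [of i j] pos_part_dd_pos [OF l] by auto
    then show ?thesis using ent [of i j] UV [of i j] by auto
  qed
  have U0: "conj_entry P U i j = 0" if "z $ i \<noteq> 0 \<or> z $ j \<noteq> 0" for i j
  proof -
    have l: "l $ i < 0 \<or> l $ j < 0" using that by (auto simp: z_def max_def split: if_splits)
    then have "\<omega> i j < 1" using lim [of i j] pos_part_dd_less_1 [OF l] by auto
    moreover have "conj_entry P U i j = 0 \<or> conj_entry P U i j = \<omega> i j * conj_entry P U i j"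
      using ent [of i j] UV [of i j] by auto
    ultimately show ?thesis by auto
  qed
  have "v = 0"
    using primal_nondegenerate_kernel [OF nd(1) X x0, of v] V0 by (simp add: V conj_entry_linear)
  moreover have "U = 0" using dual_nondegenerate_kernel [OF nd(2) Z z0 U U0] by simp
  ultimately show ?thesis by simp
qed

lemma tendsto_conj_entry:
  assumes "(P \<longlongrightarrow> P0) F" "(X \<longlongrightarrow> X0) F"
  shows "((\<lambda>k. conj_entry (P k) (X k) i j) \<longlongrightarrow> conj_entry P0 X0 i j) F"
  unfolding conj_entry_def
  by (intro tendsto_vec_nth tendsto_matrix_mult tendsto_transpose tendsto_mat_of assms)

section \<open>Uniform invertibility of the Jacobian near a nondegenerate solution\<close>

context sdp
begin

text \<open>The regularization terms and the derivative in \<open>\<epsilon>\<close> disappear in the limit, the latter because its factor \<open>\<Delta>\<epsilon>\<close>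
tends to 0 and \<open>Phi_eps\<close> is bounded. What is left is the system of \<open>limit_system_trivial\<close>.\<close>

lemma J_limit_kernel:
  fixes v q :: "nat \<Rightarrow> ('m, 'n) point"
  assumes sol: "F (0, Xb, yb, Zb) = 0" and nd: "primal_nondegenerate A Xb" "dual_nondegenerate A Zb"
    and v: "v \<longlonglongrightarrow> (0, Xb, yb, Zb)" "\<And>k. 0 < fst (v k)" and q: "q \<longlonglongrightarrow> q0"
    and Jq: "(\<lambda>k. J (v k) (q k)) \<longlonglongrightarrow> 0"
    and ed: "\<And>k. eigdec (fst (snd (v k)) - snd (snd (snd (v k)))) (P k) (l k)"
    and P: "P \<longlonglongrightarrow> P0" and l: "l \<longlonglongrightarrow> l0"
    and \<Omega>: "\<And>i j. (\<lambda>k. huber_dd (fst (v k)) (l k $ i) (l k $ j)) \<longlonglongrightarrow> \<Omega> i j"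
  shows "q0 = 0"
proof -
  define e X y Z where "e k = fst (v k)" and "X k = fst (snd (v k))" and "y k = fst (snd (snd (v k)))"
    and "Z k = snd (snd (snd (v k)))" for k
  define f U u V where "f k = fst (q k)" and "U k = fst (snd (q k))" and "u k = fst (snd (snd (q k)))"
    and "V k = snd (snd (snd (q k)))" for k
  obtain f0 U0 u0 V0 where q0: "q0 = (f0, U0, u0, V0)" by (cases q0)
  have lv: "e \<longlonglongrightarrow> 0" "X \<longlonglongrightarrow> Xb" "y \<longlonglongrightarrow> yb" "Z \<longlonglongrightarrow> Zb"
    using tendsto_fst [OF v(1)] tendsto_fst [OF tendsto_snd [OF v(1)]]
      tendsto_fst [OF tendsto_snd [OF tendsto_snd [OF v(1)]]] tendsto_snd [OF tendsto_snd [OF tendsto_snd [OF v(1)]]]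
    by (simp_all add: e_def [abs_def] X_def [abs_def] y_def [abs_def] Z_def [abs_def])
  have lq: "f \<longlonglongrightarrow> f0" "U \<longlonglongrightarrow> U0" "u \<longlonglongrightarrow> u0" "V \<longlonglongrightarrow> V0"
    using tendsto_fst [OF q] tendsto_fst [OF tendsto_snd [OF q]]
      tendsto_fst [OF tendsto_snd [OF tendsto_snd [OF q]]] tendsto_snd [OF tendsto_snd [OF tendsto_snd [OF q]]]
    by (simp_all add: q0 f_def [abs_def] U_def [abs_def] u_def [abs_def] V_def [abs_def])
  have e: "0 < e k" for k using v(2) by (simp add: e_def)
  define G where "G k = ((1 + \<kappa>c * e k) *\<^sub>R U k + (\<kappa>c * f k) *\<^sub>R X k)
      - (lowner (e k) (X k - Z k) (U k - V k) + f k *\<^sub>R Phi_eps (e k) (X k - Z k))" for k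
  have J: "J (v k) (q k) = (f k, op_A A (U k) + ((\<kappa>p * e k) *\<^sub>R u k + (\<kappa>p * f k) *\<^sub>R y k),
      - op_A_adj A (u k) - V k, G k)" for k
    by (simp add: J_def E_jac_def case_prod_unfold e_def X_def y_def Z_def f_def U_def u_def V_def G_def)
  have J1: "f \<longlonglongrightarrow> 0"
    using tendsto_fst [OF Jq] by (simp add: J)
  then have f0: "f0 = 0" using lq(1) LIMSEQ_unique by blast
  have J2: "(\<lambda>k. op_A A (U k) + ((\<kappa>p * e k) *\<^sub>R u k + (\<kappa>p * f k) *\<^sub>R y k)) \<longlonglongrightarrow> 0"
    using tendsto_fst [OF tendsto_snd [OF Jq]] by (simp add: J)
  have "(\<lambda>k. op_A A (U k) + ((\<kappa>p * e k) *\<^sub>R u k + (\<kappa>p * f k) *\<^sub>R y k))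
      \<longlonglongrightarrow> op_A A U0 + ((\<kappa>p * 0) *\<^sub>R u0 + (\<kappa>p * 0) *\<^sub>R yb)"
    by (intro tendsto_intros tendsto_linear [OF linear_op_A] lv lq J1)
  from LIMSEQ_unique [OF this J2] have AU: "op_A A U0 = 0" by simp
  have J3: "(\<lambda>k. - op_A_adj A (u k) - V k) \<longlonglongrightarrow> 0"
    using tendsto_fst [OF tendsto_snd [OF tendsto_snd [OF Jq]]] by (simp add: J)
  have "(\<lambda>k. - op_A_adj A (u k) - V k) \<longlonglongrightarrow> - op_A_adj A u0 - V0"
    by (intro tendsto_intros tendsto_linear [OF linear_op_A_adj] lq)
  from LIMSEQ_unique [OF this J3] have V0: "V0 = - op_A_adj A u0" by simp
  have J4: "G \<longlonglongrightarrow> 0"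
    using tendsto_snd [OF tendsto_snd [OF tendsto_snd [OF Jq]]] by (simp add: J)
  have "(\<lambda>k. f k *\<^sub>R Phi_eps (e k) (X k - Z k)) \<longlonglongrightarrow> 0"
  proof (rule Lim_null_comparison)
    show "\<forall>\<^sub>F k in sequentially. norm (f k *\<^sub>R Phi_eps (e k) (X k - Z k)) \<le> \<bar>f k\<bar> * norm (mat 1 :: real^'n^'n)"
      using e by (intro always_eventually allI) (simp add: mult_left_mono norm_Phi_eps_le less_imp_le)
    show "(\<lambda>k. \<bar>f k\<bar> * norm (mat 1 :: real^'n^'n)) \<longlonglongrightarrow> 0"
      using tendsto_mult [OF tendsto_rabs [OF J1] tendsto_const] by simp
  qed
  note Pe = this
  have ed0: "eigdec (Xb - Zb) P0 l0"
    by (rule eigdec_limit [OF tendsto_diff [OF lv(2) lv(4)] _ P l]) (use ed in \<open>simp add: X_def Z_def\<close>)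
  have ent: "conj_entry P0 U0 i j = \<Omega> i j * (conj_entry P0 U0 i j - conj_entry P0 V0 i j)" for i j
  proof -
    have "conj_entry (P k) (G k) i j = (1 + \<kappa>c * e k) * conj_entry (P k) (U k) i j + \<kappa>c * f k * conj_entry (P k) (X k) i j
        - (huber_dd (e k) (l k $ i) (l k $ j) * (conj_entry (P k) (U k) i j - conj_entry (P k) (V k) i j)
          + conj_entry (P k) (f k *\<^sub>R Phi_eps (e k) (X k - Z k)) i j)" for k
      using ed [of k, folded X_def Z_def]
      by (simp add: G_def conj_entry_linear(1,2) conj_entry_lowner conj_entry_linear(3) [of "P k" "1 + \<kappa>c * e k"]
          conj_entry_linear(3) [of "P k" "\<kappa>c * f k"])
    moreover have "(\<lambda>k. (1 + \<kappa>c * e k) * conj_entry (P k) (U k) i j + \<kappa>c * f k * conj_entry (P k) (X k) i j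
        - (huber_dd (e k) (l k $ i) (l k $ j) * (conj_entry (P k) (U k) i j - conj_entry (P k) (V k) i j)
          + conj_entry (P k) (f k *\<^sub>R Phi_eps (e k) (X k - Z k)) i j))
      \<longlonglongrightarrow> (1 + \<kappa>c * 0) * conj_entry P0 U0 i j + \<kappa>c * 0 * conj_entry P0 Xb i j
        - (\<Omega> i j * (conj_entry P0 U0 i j - conj_entry P0 V0 i j) + conj_entry P0 0 i j)"
      by (intro tendsto_intros tendsto_conj_entry P lv lq J1 \<Omega> [folded e_def] Pe)
    moreover have "(\<lambda>k. conj_entry (P k) (G k) i j) \<longlonglongrightarrow> conj_entry P0 0 i j"
      by (intro tendsto_conj_entry P J4)
    ultimately have "conj_entry P0 0 i j = (1 + \<kappa>c * 0) * conj_entry P0 U0 i j + \<kappa>c * 0 * conj_entry P0 Xb i j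
        - (\<Omega> i j * (conj_entry P0 U0 i j - conj_entry P0 V0 i j) + conj_entry P0 0 i j)"
      by (simp only: LIMSEQ_unique)
    then show ?thesis by (simp add: conj_entry_linear(5))
  qed
  have \<Omega>0: "0 \<le> \<Omega> i j" and \<Omega>1: "\<Omega> i j \<le> 1" for i j
    using LIMSEQ_le_const [OF \<Omega>, of 0 i j] LIMSEQ_le_const2 [OF \<Omega>, of i j 1] huber_dd_range v(2)
    by (auto simp: less_imp_le)
  have lim: "\<Omega> i j = (if l0 $ i = l0 $ j then (if l0 $ i > 0 then 1 else 0)
      else (max 0 (l0 $ i) - max 0 (l0 $ j)) / (l0 $ i - l0 $ j))" if "l0 $ i \<noteq> 0 \<or> l0 $ j \<noteq> 0" for i j
    by (rule LIMSEQ_unique [OF \<Omega> [folded e_def] tendsto_huber_dd_zero [OF lv(1) _ tendsto_vec_nth [OF l] tendsto_vec_nth [OF l] that]])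
      (simp add: e)
  have XZ: "Xb = Phi 0 (Xb - Zb)"
    using sol by (simp add: F_def E_hat_def E_map_def zero_prod_def)
  have "U0 = 0 \<and> u0 = 0"
    by (rule limit_system_trivial [OF ed0 XZ nd AU V0 ent \<Omega>0 \<Omega>1 lim])
  then show ?thesis using V0 linear_0 [OF linear_op_A_adj] by (simp add: q0 f0 zero_prod_def)
qed

text \<open>Otherwise there are points \<open>v\<close> tending to the solution and unit vectors \<open>q\<close> with \<open>J v q\<close> tending to 0. Along a
subsequence \<open>q\<close>, the eigenbases and the divided differences all converge, and the limit of \<open>q\<close> would be a unit
vector that is 0.\<close>

lemma J_invertible_near_solution:
  assumes sol: "F (0, Xb, yb, Zb) = 0" and nd: "primal_nondegenerate A Xb" "dual_nondegenerate A Zb"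
  shows "\<exists>R>0. \<exists>m>0. \<forall>v\<in>ball (0, Xb, yb, Zb) R. 0 < fst v \<longrightarrow> (\<forall>d. norm d \<le> m * norm (J v d))"
proof (rule ccontr)
  let ?w = "(0, Xb, yb, Zb) :: ('m, 'n) point"
  assume neg: "\<not> ?thesis"
  have "\<exists>p. dist ?w (fst p) < inverse (real (Suc k)) \<and> 0 < fst (fst p) \<and> norm (snd p) = 1 \<and>
      norm (J (fst p) (snd p)) \<le> inverse (real (Suc k))" for k
  proof -
    have "\<not> (\<forall>v\<in>ball ?w (inverse (real (Suc k))). 0 < fst v \<longrightarrow> (\<forall>d. norm d \<le> real (Suc k) * norm (J v d)))"
      using neg by (meson inverse_positive_iff_positive of_nat_0_less_iff zero_less_Suc)
    then obtain v d where v: "v \<in> ball ?w (inverse (real (Suc k)))" "0 < fst v"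
      and d: "real (Suc k) * norm (J v d) < norm d" by (meson not_le)
    have d0: "0 < norm d" using d by (meson le_less_trans mult_nonneg_nonneg norm_ge_zero of_nat_0_le_iff)
    have "norm (J v (inverse (norm d) *\<^sub>R d)) = inverse (norm d) * norm (J v d)"
      by (simp add: linear_scale [OF linear_J])
    also have "\<dots> \<le> inverse (real (Suc k))"
      using d d0 by (simp add: field_simps)
    finally have "norm (J v (inverse (norm d) *\<^sub>R d)) \<le> inverse (real (Suc k))" .
    moreover have "norm (inverse (norm d) *\<^sub>R d) = 1" using d0 by simp
    ultimately show ?thesis
      using v by (intro exI [of _ "(v, inverse (norm d) *\<^sub>R d)"]) simp
  qed
  then obtain p where p: "\<And>k. dist ?w (fst (p k)) < inverse (real (Suc k))" "\<And>k. 0 < fst (fst (p k))"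
    "\<And>k. norm (snd (p k)) = 1" "\<And>k. norm (J (fst (p k)) (snd (p k))) \<le> inverse (real (Suc k))"
    by metis
  define v q where "v k = fst (p k)" and "q k = snd (p k)" for k
  have v: "v \<longlonglongrightarrow> ?w"
    by (rule tendsto_dist_iff [THEN iffD2], rule Lim_null_comparison [OF _ LIMSEQ_inverse_real_of_nat])
      (use p(1) in \<open>simp add: v_def dist_commute less_imp_le\<close>)
  have Jq: "(\<lambda>k. J (v k) (q k)) \<longlonglongrightarrow> 0"
    by (rule Lim_null_comparison [OF _ LIMSEQ_inverse_real_of_nat])
      (use p(4) in \<open>simp add: v_def q_def\<close>)
  define W where "W k = fst (snd (v k)) - snd (snd (snd (v k)))" for k
  have Wlim: "W \<longlonglongrightarrow> Xb - Zb"
    using tendsto_diff [OF tendsto_fst [OF tendsto_snd [OF v]] tendsto_snd [OF tendsto_snd [OF tendsto_snd [OF v]]]]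
    by (simp add: W_def [abs_def])
  obtain P l where ed: "\<And>k. eigdec (W k) (P k) (l k)" using eigdec_choice [of W] by blast
  define \<Omega> :: "nat \<Rightarrow> real^'n^'n" where "\<Omega> k = (\<chi> i j. huber_dd (fst (v k)) (l k $ i) (l k $ j))" for k
  have "norm (\<Omega> k) \<le> norm (\<chi> i j. 1 :: real^'n^'n)" for k
    by (rule norm_mat_mono) (use huber_dd_range [of "fst (v k)"] p(2) in \<open>simp add: \<Omega>_def v_def less_imp_le\<close>)
  then have "norm (q k, \<Omega> k) \<le> 1 + norm (\<chi> i j. 1 :: real^'n^'n)" for k
    using norm_Pair_le [of "q k" "\<Omega> k"] p(3) [of k] by (simp add: q_def add_left_mono order_trans)
  then have "bounded (range (\<lambda>k. (q k, \<Omega> k)))"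
    unfolding bounded_iff by blast
  then obtain L r where r: "strict_mono r" "((\<lambda>k. (q k, \<Omega> k)) \<circ> r) \<longlonglongrightarrow> L"
    using bounded_imp_convergent_subsequence by blast
  obtain s P0 l0 where s: "strict_mono s" "eigdec (Xb - Zb) P0 l0"
    "((P \<circ> r) \<circ> s) \<longlonglongrightarrow> P0" "((l \<circ> r) \<circ> s) \<longlonglongrightarrow> l0"
    by (rule eigdec_subseq [OF LIMSEQ_subseq_LIMSEQ [OF Wlim r(1)], of "P \<circ> r" "l \<circ> r"]) (use ed in auto)
  define t where "t = r \<circ> s"
  have t: "strict_mono t" using r(1) s(1) by (simp add: t_def strict_mono_o)
  have Lt: "(\<lambda>k. (q (t k), \<Omega> (t k))) \<longlonglongrightarrow> L"
    using LIMSEQ_subseq_LIMSEQ [OF r(2) s(1)] by (simp add: o_def t_def)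
  have "fst L = 0"
  proof (rule J_limit_kernel [OF sol nd])
    show "(\<lambda>k. v (t k)) \<longlonglongrightarrow> ?w" "(\<lambda>k. J (v (t k)) (q (t k))) \<longlonglongrightarrow> 0"
      using LIMSEQ_subseq_LIMSEQ [OF v t] LIMSEQ_subseq_LIMSEQ [OF Jq t] by (simp_all add: o_def)
    show "(\<lambda>k. q (t k)) \<longlonglongrightarrow> fst L" using tendsto_fst [OF Lt] by simp
    show "(\<lambda>k. P (t k)) \<longlonglongrightarrow> P0" "(\<lambda>k. l (t k)) \<longlonglongrightarrow> l0" using s by (simp_all add: t_def o_def)
    show "(\<lambda>k. huber_dd (fst (v (t k))) (l (t k) $ i) (l (t k) $ j)) \<longlonglongrightarrow> snd L $ i $ j" for i j
      using tendsto_vec_nth [OF tendsto_vec_nth [OF tendsto_snd [OF Lt]]] by (simp add: \<Omega>_def)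
    show "0 < fst (v (t k))" for k using p(2) by (simp add: v_def)
    show "eigdec (fst (snd (v (t k))) - snd (snd (snd (v (t k))))) (P (t k)) (l (t k))" for k
      using ed [of "t k"] by (simp add: W_def)
  qed
  moreover have "(\<lambda>k. norm (q (t k))) \<longlonglongrightarrow> norm (fst L)"
    using tendsto_norm [OF tendsto_fst [OF Lt]] by simp
  ultimately show False using p(3) by (simp add: q_def LIMSEQ_const_iff)
qed

end

section \<open>Local superlinear convergence\<close>

lemma norm_quad_le: "norm (a, b, c, d) \<le> norm a + norm b + norm c + norm d"
  using norm_Pair_le [of a "(b, c, d)"] norm_Pair_le [of b "(c, d)"] norm_Pair_le [of c d] by linarith

lemma norm_quad_components:
  shows "norm a \<le> norm (a, b, c, d)" "norm b \<le> norm (a, b, c, d)" "norm c \<le> norm (a, b, c, d)"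
    "norm d \<le> norm (a, b, c, d)"
  using norm_fst_le [of a "(b, c, d)"] norm_snd_le [of "(b, c, d)" a] norm_fst_le [of b "(c, d)"]
    norm_snd_le [of "(c, d)" b] norm_fst_le [of c d] norm_snd_le [of d c] by linarith+

context sdp
begin

lemma F_lipschitz_at:
  "\<exists>L>0. \<forall>v\<in>ball (0, Xb, yb, Zb) 1. 0 < fst v \<longrightarrow>
    norm (F v - F (0, Xb, yb, Zb)) \<le> L * norm (v - (0, Xb, yb, Zb))"
proof -
  obtain BA where BA: "0 < BA" "\<And>X. norm (op_A A X) \<le> BA * norm X"
    using linear_bounded_pos [OF linear_op_A] by blast
  obtain BB where BB: "0 < BB" "\<And>y. norm (op_A_adj A y) \<le> BB * norm y"
    using linear_bounded_pos [OF linear_op_A_adj] by blast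
  define Y N where "Y = norm yb + 1" and "N = norm Xb + 1"
  define I where "I = norm (mat 1 :: real^'n^'n)"
  have pos: "0 < Y" "0 < N" "0 \<le> I" unfolding Y_def N_def I_def by (simp_all add: add_nonneg_pos)
  define L where "L = 1 + (BA + \<kappa>p * Y) + (BB + 1) + (1 + \<kappa>c * N + (2 + I))"
  have "0 < L" using BA(1) BB(1) pos kappa by (auto simp: L_def intro!: add_pos_nonneg add_nonneg_nonneg)
  moreover have "norm (F v - F (0, Xb, yb, Zb)) \<le> L * norm (v - (0, Xb, yb, Zb))"
    if v: "v \<in> ball (0, Xb, yb, Zb) 1" "0 < fst v" for v
  proof -
    obtain e X y Z where vv: "v = (e, X, y, Z)" by (cases v)
    define D where "D = norm (v - (0, Xb, yb, Zb))"
    have D: "D < 1" using v(1) by (simp add: D_def dist_norm norm_minus_commute)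
    have c: "\<bar>e\<bar> \<le> D" "norm (X - Xb) \<le> D" "norm (y - yb) \<le> D" "norm (Z - Zb) \<le> D"
      using norm_quad_components [where a = e and b = "X - Xb" and c = "y - yb" and d = "Z - Zb"] by (simp_all add: D_def vv)
    have e: "0 < e" using v(2) by (simp add: vv)
    have XY: "norm X \<le> N" "norm y \<le> Y"
      using norm_triangle_ineq2 [of X Xb] norm_triangle_ineq2 [of y yb] c D by (auto simp: N_def Y_def)
    have eD: "e \<le> D" using c(1) e by simp
    have "F v - F (0, Xb, yb, Zb) = (e, op_A A (X - Xb) + (\<kappa>p * e) *\<^sub>R y,
        - op_A_adj A (y - yb) - (Z - Zb),
        (X - Xb) + (\<kappa>c * e) *\<^sub>R X - (Phi e (X - Z) - Phi 0 (Xb - Zb)))"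
      using e by (simp add: F_def E_hat_def E_map_def vv linear_diff [OF linear_op_A] linear_diff [OF linear_op_A_adj]
          algebra_simps)
    then have "norm (F v - F (0, Xb, yb, Zb)) \<le> norm e + norm (op_A A (X - Xb) + (\<kappa>p * e) *\<^sub>R y)
       + norm (- op_A_adj A (y - yb) - (Z - Zb))
       + norm ((X - Xb) + (\<kappa>c * e) *\<^sub>R X - (Phi e (X - Z) - Phi 0 (Xb - Zb)))"
      by (simp only: norm_quad_le)
    also have "\<dots> \<le> D + (BA * D + \<kappa>p * D * Y) + (BB * D + D) + (D + \<kappa>c * D * N + (2 * D + D * I))"
    proof (intro add_mono)
      show "norm e \<le> D" using c by simp
      show "norm (op_A A (X - Xb) + (\<kappa>p * e) *\<^sub>R y) \<le> BA * D + \<kappa>p * D * Y"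
      proof (rule norm_triangle_le, rule add_mono)
        show "norm (op_A A (X - Xb)) \<le> BA * D"
          using BA(2) [of "X - Xb"] mult_left_mono [OF c(2), of BA] BA(1) by linarith
        show "norm ((\<kappa>p * e) *\<^sub>R y) \<le> \<kappa>p * D * Y"
          unfolding norm_scaleR using kappa e eD XY pos
          by (intro mult_mono) auto
      qed
      show "norm (- op_A_adj A (y - yb) - (Z - Zb)) \<le> BB * D + D"
      proof (rule order_trans [OF norm_triangle_ineq4], rule add_mono [OF _ c(4)])
        show "norm (- op_A_adj A (y - yb)) \<le> BB * D"
          unfolding norm_minus_cancel by (rule order_trans [OF BB(2) mult_left_mono [OF c(3)]]) (use BB in simp)
      qed
      have P: "norm (Phi e (X - Z) - Phi 0 (Xb - Zb)) \<le> 2 * D + D * I"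
      proof -
        have "norm (X - Z - (Xb - Zb)) \<le> 2 * D"
          using norm_triangle_ineq4 [of "X - Xb" "Z - Zb"] c by (simp add: algebra_simps)
        moreover have "\<bar>e - 0\<bar> * I \<le> D * I" using c pos by (intro mult_right_mono) auto
        ultimately show ?thesis
          using Phi_lipschitz [of e 0 "X - Z" "Xb - Zb"] e unfolding I_def by simp
      qed
      show "norm ((X - Xb) + (\<kappa>c * e) *\<^sub>R X - (Phi e (X - Z) - Phi 0 (Xb - Zb)))
          \<le> D + \<kappa>c * D * N + (2 * D + D * I)"
      proof (rule order_trans [OF norm_triangle_ineq4], rule add_mono [OF _ P], rule norm_triangle_le, rule add_mono [OF c(2)])
        show "norm ((\<kappa>c * e) *\<^sub>R X) \<le> \<kappa>c * D * N"
          unfolding norm_scaleR using kappa e eD XY pos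
          by (intro mult_mono) auto
      qed
    qed
    also have "\<dots> = L * D" by (simp add: L_def algebra_simps)
    finally show ?thesis by (simp add: D_def)
  qed
  ultimately show ?thesis by blast
qed

text \<open>Besides \<open>Phi\<close> only the products of \<open>\<epsilon>\<close> with \<open>X\<close> and \<open>y\<close> are nonlinear, and these are bilinear.\<close>

lemma F_semismooth_at:
  "\<exists>R>0. \<exists>K>0. \<forall>v\<in>ball (0, Xb, yb, Zb) R. 0 < fst v \<longrightarrow>
    norm (F v - F (0, Xb, yb, Zb) - J v (v - (0, Xb, yb, Zb))) \<le> K * (norm (v - (0, Xb, yb, Zb)))\<^sup>2"
proof -
  obtain K s where K: "0 \<le> K" "0 < s" and semi: "\<And>e W. 0 < e \<Longrightarrow> norm (W - (Xb - Zb)) + e \<le> s \<Longrightarrow>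
    norm (Phi e W - Phi 0 (Xb - Zb) - (lowner e W (W - (Xb - Zb)) + e *\<^sub>R Phi_eps e W))
      \<le> K * (norm (W - (Xb - Zb)) + e)\<^sup>2"
    using Phi_strongly_semismooth [of "Xb - Zb"] by blast
  define M where "M = \<kappa>p + \<kappa>c + 9 * K"
  have "0 < M" using kappa K by (simp add: M_def)
  moreover have "norm (F v - F (0, Xb, yb, Zb) - J v (v - (0, Xb, yb, Zb))) \<le> M * (norm (v - (0, Xb, yb, Zb)))\<^sup>2"
    if v: "v \<in> ball (0, Xb, yb, Zb) (s / 3)" "0 < fst v" for v
  proof -
    obtain e X y Z where vv: "v = (e, X, y, Z)" by (cases v)
    define D where "D = norm (v - (0, Xb, yb, Zb))"
    have D: "D < s / 3" "0 \<le> D" using v(1) by (simp_all add: D_def dist_norm norm_minus_commute)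
    have c: "\<bar>e\<bar> \<le> D" "norm (X - Xb) \<le> D" "norm (y - yb) \<le> D" "norm (Z - Zb) \<le> D"
      using norm_quad_components [where a = e and b = "X - Xb" and c = "y - yb" and d = "Z - Zb"] by (simp_all add: D_def vv)
    have e: "0 < e" "e \<le> D" using v(2) c(1) by (simp_all add: vv)
    have W: "norm (X - Z - (Xb - Zb)) \<le> 2 * D"
      using norm_triangle_ineq4 [of "X - Xb" "Z - Zb"] c by (simp add: algebra_simps)
    let ?S = "Phi e (X - Z) - Phi 0 (Xb - Zb) - (lowner e (X - Z) (X - Z - (Xb - Zb)) + e *\<^sub>R Phi_eps e (X - Z))"
    have "norm ?S \<le> K * (norm (X - Z - (Xb - Zb)) + e)\<^sup>2"
      by (rule semi) (use W e D in linarith)+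
    also have "\<dots> \<le> K * (3 * D)\<^sup>2"
      using W e K by (intro mult_left_mono power_mono) auto
    finally have S: "norm ?S \<le> 9 * K * D\<^sup>2" by (simp add: power2_eq_square)
    have Weq: "X - Xb - (Z - Zb) = X - Z - (Xb - Zb)" by simp
    have "F v - F (0, Xb, yb, Zb) - J v (v - (0, Xb, yb, Zb)) =
      (0, - ((\<kappa>p * e) *\<^sub>R (y - yb)), 0, - ((\<kappa>c * e) *\<^sub>R (X - Xb)) - ?S)"
      using e by (simp add: F_def E_hat_def E_map_def J_def E_jac_def vv Weq linear_diff [OF linear_op_A] linear_diff [OF linear_op_A_adj])
        (simp add: algebra_simps)
    then have "norm (F v - F (0, Xb, yb, Zb) - J v (v - (0, Xb, yb, Zb)))
        \<le> norm ((\<kappa>p * e) *\<^sub>R (y - yb)) + norm (- ((\<kappa>c * e) *\<^sub>R (X - Xb)) - ?S)"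
      using norm_quad_le [of "0 :: real" "- ((\<kappa>p * e) *\<^sub>R (y - yb))" "0 :: 'n symmat" "- ((\<kappa>c * e) *\<^sub>R (X - Xb)) - ?S"]
      by (simp only: norm_zero norm_minus_cancel add_0 add_0_right)
    also have "\<dots> \<le> norm ((\<kappa>p * e) *\<^sub>R (y - yb)) + (norm ((\<kappa>c * e) *\<^sub>R (X - Xb)) + norm ?S)"
      by (intro add_left_mono order_trans [OF norm_triangle_ineq4]) simp
    also have "\<dots> \<le> \<kappa>p * D * D + (\<kappa>c * D * D + 9 * K * D\<^sup>2)"
      unfolding norm_scaleR using kappa e c D S by (intro add_mono mult_mono) auto
    also have "\<dots> = M * D\<^sup>2" by (simp add: M_def power2_eq_square algebra_simps)
    finally show ?thesis by (simp add: D_def)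
  qed
  ultimately show ?thesis using K(2) by (intro exI [of _ "s / 3"] exI [of _ M] conjI) (auto simp del: mem_ball split_paired_All)
qed

lemma E_jac_eps_bounded:
  "\<exists>B>0. \<forall>v\<in>ball (0, Xb, yb, Zb) 1. 0 < fst v \<longrightarrow> norm (E_jac A \<kappa>p \<kappa>c v (1, 0, 0, 0)) \<le> B"
proof -
  define B where "B = \<kappa>p * (norm yb + 1) + (\<kappa>c * (norm Xb + 1) + norm (mat 1 :: real^'n^'n))"
  have p: "0 < norm yb + 1" "0 < norm Xb + 1" by (simp_all add: add_nonneg_pos)
  have "0 < B"
    unfolding B_def by (rule add_pos_nonneg [OF mult_pos_pos [OF kappa(1) p(1)]]) (use kappa p in simp)
  moreover have "norm (E_jac A \<kappa>p \<kappa>c v (1, 0, 0, 0)) \<le> B"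
    if v: "v \<in> ball (0, Xb, yb, Zb) 1" "0 < fst v" for v
  proof -
    obtain e X y Z where vv: "v = (e, X, y, Z)" by (cases v)
    have D: "norm (v - (0, Xb, yb, Zb)) < 1" using v(1) by (simp add: dist_norm norm_minus_commute)
    have "norm (X - Xb) \<le> 1" "norm (y - yb) \<le> 1"
      using norm_quad_components [where a = e and b = "X - Xb" and c = "y - yb" and d = "Z - Zb"] D by (simp_all add: vv)
    then have XY: "norm X \<le> norm Xb + 1" "norm y \<le> norm yb + 1"
      using norm_triangle_ineq2 [of X Xb] norm_triangle_ineq2 [of y yb] by auto
    have "E_jac A \<kappa>p \<kappa>c v (1, 0, 0, 0) = (\<kappa>p *\<^sub>R y, 0, \<kappa>c *\<^sub>R X - Phi_eps e (X - Z))"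
      by (simp add: E_jac_def vv linear_0 [OF linear_op_A] linear_0 [OF linear_op_A_adj] linear_0 [OF linear_lowner])
    then have "norm (E_jac A \<kappa>p \<kappa>c v (1, 0, 0, 0)) \<le> norm (\<kappa>p *\<^sub>R y) + norm (\<kappa>c *\<^sub>R X - Phi_eps e (X - Z))"
      using norm_Pair_le [of "\<kappa>p *\<^sub>R y" "(0 :: 'n symmat, \<kappa>c *\<^sub>R X - Phi_eps e (X - Z))"]
        norm_Pair_le [of "0 :: 'n symmat" "\<kappa>c *\<^sub>R X - Phi_eps e (X - Z)"] by simp
    also have "\<dots> \<le> \<kappa>p * (norm yb + 1) + (\<kappa>c * (norm Xb + 1) + norm (mat 1 :: real^'n^'n))"
    proof (intro add_mono order_trans [OF norm_triangle_ineq4])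
      show "norm (\<kappa>p *\<^sub>R y) \<le> \<kappa>p * (norm yb + 1)" "norm (\<kappa>c *\<^sub>R X) \<le> \<kappa>c * (norm Xb + 1)"
        using kappa XY by (simp_all add: mult_left_mono)
      show "norm (Phi_eps e (X - Z)) \<le> norm (mat 1 :: real^'n^'n)"
        using v(2) by (simp add: vv norm_Phi_eps_le)
    qed
    finally show ?thesis by (simp add: B_def)
  qed
  ultimately show ?thesis by blast
qed

end

context ssn
begin

text \<open>The classical estimate: \<open>J v (v + d - w)\<close> is the residual of the Newton equation minus the linearization error.
The former is of order \<open>1 + \<tau>\<close> by the choice of \<open>\<zeta>\<close> and \<open>\<eta>\<close>, the latter is of order 2, and the inverse of \<open>J v\<close>
is bounded. The same linearization error shows that the norm of \<open>F v\<close> is comparable to the distance from the solution.\<close>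

lemma newton_step_superlinear:
  assumes sol: "F (0, Xb, yb, Zb) = 0" and nd: "primal_nondegenerate A Xb" "dual_nondegenerate A Zb"
  shows "\<exists>R>0. \<exists>c>0. \<forall>v\<in>ball (0, Xb, yb, Zb) R. 0 < fst v \<longrightarrow> F v \<noteq> 0 \<longrightarrow>
    norm (v - (0, Xb, yb, Zb)) \<le> c * norm (F v) \<and> norm (F v) \<le> c * norm (v - (0, Xb, yb, Zb)) \<and>
    (\<forall>d. direction v d \<longrightarrow> norm (v + d - (0, Xb, yb, Zb)) \<le> c * norm (v - (0, Xb, yb, Zb)) powr (1 + \<tau>))"
proof -
  let ?w = "(0, Xb, yb, Zb) :: ('m, 'n) point"
  obtain R1 m where R1: "0 < R1" "0 < m" "\<forall>v\<in>ball ?w R1. 0 < fst v \<longrightarrow> (\<forall>d. norm d \<le> m * norm (J v d))"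
    using J_invertible_near_solution [OF sol nd] by blast
  obtain R2 K where R2: "0 < R2" "0 < K" "\<forall>v\<in>ball ?w R2. 0 < fst v \<longrightarrow>
      norm (F v - F ?w - J v (v - ?w)) \<le> K * (norm (v - ?w))\<^sup>2"
    using F_semismooth_at by blast
  obtain L where L: "0 < L" "\<forall>v\<in>ball ?w 1. 0 < fst v \<longrightarrow> norm (F v - F ?w) \<le> L * norm (v - ?w)"
    using F_lipschitz_at by blast
  obtain B where B: "0 < B" "\<forall>v\<in>ball ?w 1. 0 < fst v \<longrightarrow> norm (E_jac A \<kappa>p \<kappa>c v (1, 0, 0, 0)) \<le> B"
    using E_jac_eps_bounded by blast
  (* The last bound lets the quadratic error be absorbed: m K D <= 1/2 for distances D < R. *)
  define R where "R = min (min R1 R2) (min 1 (1 / (2 * m * K)))"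
  define Q where "Q = r * eh + rh * (1 + (r * eh + 1) * B)"
  define c1 where "c1 = m * (Q * L powr (1 + \<tau>) + K)"
  define c where "c = max (2 * m) (max L c1)"
  have "0 < R" using R1 R2 by (simp add: R_def)
  have Q: "0 < Q" using params B by (auto simp: Q_def intro!: add_pos_nonneg add_nonneg_nonneg mult_nonneg_nonneg)
  have "0 < c" using R1 by (simp add: c_def less_max_iff_disj)
  have main: "norm (v - ?w) \<le> c * norm (F v) \<and> norm (F v) \<le> c * norm (v - ?w) \<and>
    (\<forall>d. direction v d \<longrightarrow> norm (v + d - ?w) \<le> c * norm (v - ?w) powr (1 + \<tau>))"
    if v: "v \<in> ball ?w R" and pos: "0 < fst v" and nz: "F v \<noteq> 0" for v
  proof -
    define D n where "D = norm (v - ?w)" and "n = norm (F v)"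
    have vb: "v \<in> ball ?w R1" "v \<in> ball ?w R2" "v \<in> ball ?w 1" and D: "D < 1 / (2 * m * K)" "D < 1"
      using v by (simp_all add: R_def D_def dist_norm norm_minus_commute)
    have inv: "norm d \<le> m * norm (J v d)" for d using R1(3) vb(1) pos by blast
    have semi: "norm (F v - J v (v - ?w)) \<le> K * D\<^sup>2"
      using R2(3) vb(2) pos sol by (simp add: D_def)
    have lip: "n \<le> L * D" using L(2) vb(3) pos sol by (simp add: D_def n_def)
    have D0: "0 \<le> D" and n0: "0 < n" using nz by (simp_all add: D_def n_def)
    have low: "D \<le> 2 * m * n"
    proof -
      have "norm (J v (v - ?w)) \<le> n + K * D\<^sup>2"
        using norm_triangle_ineq4 [of "F v" "F v - J v (v - ?w)"] semi by (simp add: n_def)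
      then have "D \<le> m * (n + K * D\<^sup>2)"
        unfolding D_def by (rule order_trans [OF inv mult_left_mono]) (use R1(2) in simp)
      also have "\<dots> = m * n + (m * K * D) * D" by (simp add: power2_eq_square algebra_simps)
      also have "(m * K * D) * D \<le> 1 / 2 * D"
        using D(1) R1(2) R2(2) D0 by (intro mult_right_mono) (simp_all add: field_simps)
      finally show ?thesis by simp
    qed
    have step: "norm (v + d - ?w) \<le> c1 * D powr (1 + \<tau>)" if d: "direction v d" for d
    proof -
      note res = direction_residual [OF pos d, folded n_def]
      have np: "n powr \<tau> * n = n powr (1 + \<tau>)" using n0 by (simp add: powr_add mult.commute)
      have "norm (fst (F v + J v d)) \<le> r * eh * n powr (1 + \<tau>)"
        using res(1) zeta_bounds(1,4) [OF n0] params mult_right_mono [of "zeta r \<tau> n" "r * n powr (1 + \<tau>)" eh]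
        by (simp add: mult_ac)
      moreover have "norm (snd (F v + J v d)) \<le> rh * (1 + (r * eh + 1) * B) * n powr (1 + \<tau>)"
      proof -
        have "\<bar>fst d\<bar> \<le> (r * eh + 1) * n"
        proof -
          have "fst d = zeta r \<tau> n * eh - fst v" using res(1) by (simp add: J_def fst_F)
          moreover have "zeta r \<tau> n * eh \<le> (r * n) * eh" using zeta_bounds(3) [OF n0] params by (intro mult_right_mono) auto
          moreover have "0 < zeta r \<tau> n * eh" using zeta_bounds(1) [OF n0] params by simp
          moreover have "fst v \<le> n" using norm_fst_le [of "fst (F v)" "snd (F v)", unfolded prod.collapse] by (simp add: n_def fst_F)
          ultimately have "\<bar>fst d\<bar> \<le> r * n * eh + n" using pos by linarith
          then show ?thesis by (simp add: algebra_simps)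
        qed
        then have "norm (fst d *\<^sub>R E_jac A \<kappa>p \<kappa>c v (1, 0, 0, 0)) \<le> ((r * eh + 1) * n) * B"
          unfolding norm_scaleR using B vb(3) pos by (intro mult_mono) auto
        moreover have "norm (E_map A b C \<kappa>p \<kappa>c v) \<le> n"
          using norm_snd_le [of "E_map A b C \<kappa>p \<kappa>c v" "fst v"] by (simp add: n_def F_def E_hat_def)
        ultimately have E: "norm (E_map A b C \<kappa>p \<kappa>c v + fst d *\<^sub>R E_jac A \<kappa>p \<kappa>c v (1, 0, 0, 0))
            \<le> (1 + (r * eh + 1) * B) * n"
          by (intro order_trans [OF norm_triangle_ineq]) (simp add: algebra_simps)
        have "eta rh \<tau> n * norm (E_map A b C \<kappa>p \<kappa>c v + fst d *\<^sub>R E_jac A \<kappa>p \<kappa>c v (1, 0, 0, 0))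
            \<le> (rh * n powr \<tau>) * ((1 + (r * eh + 1) * B) * n)"
          using E params by (intro mult_mono) (auto simp: eta_def)
        with res(2) show ?thesis by (simp add: mult_ac flip: np)
      qed
      ultimately have "norm (F v + J v d) \<le> Q * n powr (1 + \<tau>)"
        using norm_Pair_le [of "fst (F v + J v d)" "snd (F v + J v d)", unfolded prod.collapse]
        unfolding Q_def distrib_right [of "r * eh"] by linarith
      also have "n powr (1 + \<tau>) \<le> L powr (1 + \<tau>) * D powr (1 + \<tau>)"
        using powr_mono2 [of "1 + \<tau>" n "L * D"] lip n0 params L D0 by (simp add: powr_mult)
      finally have r1: "norm (F v + J v d) \<le> Q * L powr (1 + \<tau>) * D powr (1 + \<tau>)"
        using Q by (simp add: mult.assoc)
      have "D\<^sup>2 \<le> D powr (1 + \<tau>)"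
      proof (cases "D = 0")
        case False
        then have "D\<^sup>2 = D powr 2" using D0 by (simp add: powr_numeral)
        also have "\<dots> \<le> D powr (1 + \<tau>)" using D D0 False params by (intro powr_mono') auto
        finally show ?thesis .
      qed simp
      then have r2: "norm (F v - J v (v - ?w)) \<le> K * D powr (1 + \<tau>)"
        using semi mult_left_mono [of "D\<^sup>2" "D powr (1 + \<tau>)" K] R2(2) by linarith
      have eq: "J v (v + d - ?w) = (F v + J v d) - (F v - J v (v - ?w))"
        using linear_add [OF linear_J, of v d "v - ?w"] by (simp add: algebra_simps)
      have "norm (J v (v + d - ?w)) \<le> Q * L powr (1 + \<tau>) * D powr (1 + \<tau>) + K * D powr (1 + \<tau>)"
        unfolding eq using norm_triangle_ineq4 [of "F v + J v d" "F v - J v (v - ?w)"] r1 r2 by linarith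
      then have "m * norm (J v (v + d - ?w)) \<le> c1 * D powr (1 + \<tau>)"
        using R1(2) by (simp add: c1_def mult.assoc distrib_right [of _ K])
      with inv [of "v + d - ?w"] show ?thesis by linarith
    qed
    have "2 * m * n \<le> c * n" "L * D \<le> c * D" "c1 * D powr (1 + \<tau>) \<le> c * D powr (1 + \<tau>)"
      using n0 D0 by (intro mult_right_mono; simp add: c_def)+
    then show ?thesis using low lip step unfolding D_def n_def by fastforce
  qed
  show ?thesis using \<open>0 < R\<close> \<open>0 < c\<close> main by blast
qed

text \<open>Close to the solution the residual after a full step is of higher order than before it, so the line search
stops at its first trial.\<close>

lemma unit_steps_near_solution:
  assumes sol: "F (0, Xb, yb, Zb) = 0" and nd: "primal_nondegenerate A Xb" "dual_nondegenerate A Zb"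
  shows "\<exists>R>0. \<exists>c>0. \<forall>k. w k \<in> ball (0, Xb, yb, Zb) R \<longrightarrow>
    norm (w (Suc k) - (0, Xb, yb, Zb)) \<le> c * norm (w k - (0, Xb, yb, Zb)) powr (1 + \<tau>) \<and>
    norm (w (Suc k) - (0, Xb, yb, Zb)) \<le> norm (w k - (0, Xb, yb, Zb)) / 2"
proof -
  let ?w = "(0, Xb, yb, Zb) :: ('m, 'n) point"
  obtain R1 c where R1: "0 < R1" "0 < c" and local: "\<forall>v\<in>ball ?w R1. 0 < fst v \<longrightarrow> F v \<noteq> 0 \<longrightarrow>
    norm (v - ?w) \<le> c * norm (F v) \<and> norm (F v) \<le> c * norm (v - ?w) \<and>
    (\<forall>d. direction v d \<longrightarrow> norm (v + d - ?w) \<le> c * norm (v - ?w) powr (1 + \<tau>))"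
    using newton_step_superlinear [OF sol nd] by blast
  define q where "q = sqrt (1 - 2 * \<sigma> * (1 - \<delta>))"
  have "2 * \<sigma> * (1 - \<delta>) < 1 * 1"
    using params delta by (intro mult_less_le_imp_less) auto
  then have q: "0 < q" "q\<^sup>2 = 1 - 2 * \<sigma> * (1 - \<delta>)" by (simp_all add: q_def)
  (* If D powr tau <= a for the distance D, then a full step halves the error and reduces the residual
     by the factor q that the line search demands. *)
  define a where "a = min (1 / (2 * c)) (q / (c * c * c))"
  have a: "0 < a" "c * a \<le> 1 / 2" "c * c * c * a \<le> q"
    using R1 q by (auto simp: a_def min_def field_simps)
  define R where "R = min R1 (a powr (1 / \<tau>))"
  have R: "0 < R" using R1 a by (simp add: R_def)
  have "norm (w (Suc k) - ?w) \<le> c * norm (w k - ?w) powr (1 + \<tau>) \<and> norm (w (Suc k) - ?w) \<le> norm (w k - ?w) / 2"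
    if wk: "w k \<in> ball ?w R" for k
  proof -
    define D where "D = norm (w k - ?w)"
    have D: "0 \<le> D" "D < R" using wk by (simp_all add: D_def dist_norm norm_minus_commute)
    have "D powr \<tau> \<le> (a powr (1 / \<tau>)) powr \<tau>"
      using D params by (intro powr_mono2) (auto simp: R_def)
    then have Dt: "D powr \<tau> \<le> a" using params a by (simp add: powr_powr)
    have Dp: "D powr (1 + \<tau>) = D * D powr \<tau>" using D by (cases "D = 0") (simp_all add: powr_add)
    have wk1: "w k \<in> ball ?w R1" using wk by (simp add: R_def)
    have loc: "D \<le> c * norm (F (w k)) \<and> norm (F (w k)) \<le> c * D \<and>
        (\<forall>d. direction (w k) d \<longrightarrow> norm (w k + d - ?w) \<le> c * D powr (1 + \<tau>))"
      unfolding D_def using local wk1 eps_pos F_nonzero by blast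
    obtain d l where st: "direction (w k) d" "accepts (w k) d l" "\<And>j. j < l \<Longrightarrow> \<not> accepts (w k) d j"
      "w (Suc k) = w k + \<rho> ^ l *\<^sub>R d" using step [of k] by metis
    have full: "norm (w k + d - ?w) \<le> c * D powr (1 + \<tau>)" using loc st(1) by blast
    have "c * D powr (1 + \<tau>) = D * (c * D powr \<tau>)" by (simp add: Dp)
    also have "c * D powr \<tau> \<le> 1 / 2"
      using mult_left_mono [OF Dt, of c] R1(2) a(2) by linarith
    then have "D * (c * D powr \<tau>) \<le> D * (1 / 2)" using D by (intro mult_left_mono) auto
    finally have half: "norm (w k + d - ?w) \<le> D / 2" using full by simp
    have next_pos: "0 < fst (w k + d)"
    proof -
      have "fst (w k + d) = zeta r \<tau> (norm (F (w k))) * eh"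
        using direction_residual(1) [OF eps_pos st(1)] by (simp add: J_def fst_F)
      also have "0 < \<dots>"
        using zeta_bounds(1) [of "norm (F (w k))"] F_nonzero params by (intro mult_pos_pos) auto
      finally show ?thesis .
    qed
    have "norm (F (w k + d)) \<le> q * norm (F (w k))"
    proof (cases "F (w k + d) = 0")
      case False
      have "w k + d \<in> ball ?w R1"
        using half D by (simp add: dist_norm norm_minus_commute [of ?w] R_def)
      then have "norm (F (w k + d)) \<le> c * norm (w k + d - ?w)"
        using local next_pos False by blast
      also have "\<dots> \<le> c * (c * (D * a))"
        using full R1(2) D Dt unfolding Dp
        by (intro mult_left_mono order_trans [OF full [unfolded Dp]] mult_left_mono) auto
      also have "\<dots> \<le> c * (c * ((c * norm (F (w k))) * a))"
        using loc R1(2) a(1) by (intro mult_left_mono mult_right_mono) auto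
      also have "\<dots> = c * c * c * a * norm (F (w k))" by simp
      also have "\<dots> \<le> q * norm (F (w k))" using a(3) by (intro mult_right_mono) auto
      finally show ?thesis .
    qed (use q in simp)
    then have "(norm (F (w k + d)))\<^sup>2 \<le> q\<^sup>2 * (norm (F (w k)))\<^sup>2"
      using power_mono [of "norm (F (w k + d))" "q * norm (F (w k))" 2] by (simp add: power_mult_distrib)
    then have "accepts (w k) d 0" by (simp add: accepts_def q(2))
    then have "l = 0" using st(3) by (cases l) auto
    then have "w (Suc k) = w k + d" using st(4) by simp
    then show ?thesis using full half by (simp add: D_def)
  qed
  then show ?thesis using R R1 by blast
qed

theorem converges_superlinearly:
  assumes s: "strict_mono s" and lim: "(w \<circ> s) \<longlonglongrightarrow> (eb, Xb, yb, Zb)"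
    and nd: "primal_nondegenerate A Xb" "dual_nondegenerate A Zb"
  shows "w \<longlonglongrightarrow> (eb, Xb, yb, Zb)"
    "(\<lambda>k. norm (w (Suc k) - (eb, Xb, yb, Zb))) \<in> O(\<lambda>k. norm (w k - (eb, Xb, yb, Zb)) powr (1 + \<tau>))"
proof -
  let ?w = "(eb, Xb, yb, Zb)"
  have sol: "F ?w = 0" using accumulation_point_solves [OF s lim] .
  then have eb: "eb = 0" using fst_F [of ?w] by simp
  obtain R c where R: "0 < R" and step: "\<forall>k. w k \<in> ball ?w R \<longrightarrow>
    norm (w (Suc k) - ?w) \<le> c * norm (w k - ?w) powr (1 + \<tau>) \<and> norm (w (Suc k) - ?w) \<le> norm (w k - ?w) / 2"
    using unit_steps_near_solution [OF sol [unfolded eb] nd] unfolding eb by blast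
  have "\<forall>\<^sub>F j in sequentially. dist ((w \<circ> s) j) ?w < R" using lim R by (rule tendstoD)
  then obtain j where "dist ((w \<circ> s) j) ?w < R" using eventually_happens' sequentially_bot by blast
  then have j: "norm (w (s j) - ?w) < R" by (simp add: dist_norm)
  have stay: "norm (w (i + s j) - ?w) \<le> (1 / 2) ^ i * R" for i
  proof (induction i)
    case 0
    then show ?case using j by simp
  next
    case (Suc i)
    have "norm (w (i + s j) - ?w) < R"
    proof (cases i)
      case (Suc i')
      have "(1 / 2) ^ i * R < 1 * R" using R Suc by (intro mult_strict_right_mono power_less_one_iff [THEN iffD2]) auto
      then show ?thesis using \<open>norm (w (i + s j) - ?w) \<le> (1 / 2) ^ i * R\<close> by simp
    qed (use j in simp)
    then have "norm (w (Suc (i + s j)) - ?w) \<le> norm (w (i + s j) - ?w) / 2"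
      using step by (simp add: dist_norm norm_minus_commute [of ?w])
    then show ?case using Suc.IH by simp
  qed
  have "(\<lambda>i. norm (w (i + s j) - ?w)) \<longlonglongrightarrow> 0"
  proof (rule Lim_null_comparison)
    show "\<forall>\<^sub>F i in sequentially. norm (norm (w (i + s j) - ?w)) \<le> (1 / 2) ^ i * R"
      using stay by (intro always_eventually allI) simp
    show "(\<lambda>i. (1 / 2) ^ i * R) \<longlonglongrightarrow> 0"
      using tendsto_mult [OF LIMSEQ_power_zero [of "1 / 2 :: real"] tendsto_const, of R] by simp
  qed
  then have "(\<lambda>i. w (i + s j)) \<longlonglongrightarrow> ?w"
    by (simp only: tendsto_norm_zero_iff LIM_zero_iff)
  then show conv: "w \<longlonglongrightarrow> ?w" by (rule LIMSEQ_offset)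
  have "\<forall>\<^sub>F k in sequentially. dist (w k) ?w < R" using conv R by (rule tendstoD)
  then have "\<forall>\<^sub>F k in sequentially. norm (norm (w (Suc k) - ?w)) \<le> c * norm (norm (w k - ?w) powr (1 + \<tau>))"
  proof eventually_elim
    case (elim k)
    then have "w k \<in> ball ?w R" by (simp add: dist_commute)
    then show ?case using step by simp
  qed
  then show "(\<lambda>k. norm (w (Suc k) - ?w)) \<in> O(\<lambda>k. norm (w k - ?w) powr (1 + \<tau>))"
    by (rule bigoI)
qed

end

theorem theorem3:
  fixes A :: "'m::finite \<Rightarrow> 'n::finite symmat"
    and b :: "real ^ 'm"
    and C :: "'n symmat"
    and \<kappa>p \<kappa>c eh r rh \<eta>h \<rho> \<sigma> \<tau> :: real
    and w :: "nat \<Rightarrow> ('m, 'n) point"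
    and eb :: real and Xb :: "'n symmat" and yb :: "real ^ 'm" and Zb :: "'n symmat"
  assumes "\<exists>X. primal_optimal A b C X"
    and "\<exists>X\<in>pd. op_A A X = b"
    and "0 < \<kappa>p" and "0 < \<kappa>c"
    and "0 < eh" and "0 < r" and "r < 1" and "0 < rh" and "0 < \<eta>h" and "\<eta>h < 1"
    and "sqrt 2 * max (r * eh) \<eta>h < 1"
    and "0 < \<rho>" and "\<rho> < 1" and "0 < \<sigma>" and "\<sigma> < 1 / 2" and "0 < \<tau>" and "\<tau> \<le> 1"
    and "ssn_sequence A b C \<kappa>p \<kappa>c eh r rh \<eta>h \<rho> \<sigma> \<tau> w"
    and "\<exists>s. strict_mono s \<and> (w \<circ> s) \<longlonglongrightarrow> (eb, Xb, yb, Zb)"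
    and "primal_nondegenerate A Xb"
    and "dual_nondegenerate A Zb"
  shows "w \<longlonglongrightarrow> (eb, Xb, yb, Zb) \<and>
    (\<lambda>k. norm (w (Suc k) - (eb, Xb, yb, Zb)))
      \<in> O(\<lambda>k. norm (w k - (eb, Xb, yb, Zb)) powr (1 + \<tau>))"
proof -
  interpret ssn A b C \<kappa>p \<kappa>c eh r rh \<eta>h \<rho> \<sigma> \<tau> w
    by unfold_locales (use assms in simp_all)
  obtain s where "strict_mono s" "(w \<circ> s) \<longlonglongrightarrow> (eb, Xb, yb, Zb)"
    using assms(19) by blast
  from converges_superlinearly [OF this assms(20,21)] show ?thesis by blast
qed

end
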